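(* Let $G_1,G_2$ be locally finite connected graphs and let $\Gamma_1,\Gamma_2$ be groups acting quasi-transitively on $G_1,G_2$, respectively. Let $G=G_1\ast G_2$ be a tree amalgamation of $G_1$ and $G_2$ of finite identification respecting the actions of $\Gamma_1$ and $\Gamma_2$. Then $$\operatorname{asdim}(G)\leq \max\{\operatorname{asdim}(G_1),\operatorname{asdim}(G_2),\operatorname{asdim}(C)+1\},$$ where $C$ is an arbitrary adhesion set of $G_1\ast G_2$. (Adhesion sets are not assumed to be finite.)
   Context: **Conventions.** A group acts quasi-transitively on a graph if it acts by graph automorphisms with only finitely many orbits on vertices. A graph is regarded as a metric space with its graph distance; subsets (such as adhesion sets) carry the metric restricted from the graph in which they lie. **Asymptotic dimension.** A cover $\mathcal V$ of a metric space $X$ is uniformly bounded if $\sup\{\operatorname{diam}(V)\mid V\in\mathcal V\}<\infty$. Its multiplicity is the smallest $n$ such that every $x\in X$ lies in at most $n$ elements of $\mathcal V$. A cover $\mathcal V$ refines a cover $\mathcal U$ if every $V\in\mathcal V$ is contained in some $U\in\mathcal U$. $X$ has asymptotic dimension at most $n$ if for every uniformly bounded open cover $\mathcal V$ of $X$ there is a uniformly bounded open cover $\mathcal U$ of $X$ of multiplicity at most $n+1$ such that $\mathcal V$ refines $\mathcal U$. $\operatorname{asdim}(X)$ is the least such $n$ ($\infty$ if there is none). **Tree amalgamation.** Let $I_1,I_2$ be disjoint sets and $G_1,G_2$ graphs. Let $(S^i_k)_{k\in I_i}$ be families of subsets of $V(G_i)$, $i=1,2$, all $S^i_k$ having the same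 cardinality. For all $k\in I_1,\ \ell\in I_2$ let $\phi_{k\ell}\colon S^1_k\to S^2_\ell$ be a bijection and put $\phi_{\ell k}=\phi_{k\ell}^{-1}$; these are the bonding maps. Let $T$ be a tree with canonical bipartition $\{V_1,V_2\}$ such that all vertices in $V_i$ have degree $|I_i|$. Let $D(T)$ be the set of directed edges of $T$ (each edge $xy$ gives $\overrightarrow{xy}$ and $\overrightarrow{yx}$); for $\vec e=\overrightarrow{xy}$ write $\overleftarrow{e}=\overrightarrow{yx}$. Let $f\colon D(T)\to I_1\cup I_2$ be a labelling such that for every $i\in\{1,2\}$ and every $v\in V_i$ each $k\in I_i$ occurs precisely once among the labels of the directed edges starting at $v$. For $v\in V_i$ let $G_v$ be a copy of $G_i$, with $S^v_k$ the copy of $S^i_k$ in it. $G_1+G_2$ is the graph obtained from the disjoint union of all $G_v$, $v\in V(T)$, by adding, for every $\vec e=\overrightarrow{uv}$ with $f(\vec e)=k$, $f(\overleftarrow e)=\ell$, an edge between each $x\in S^u_k$ and $\phi_{k\ell}(x)\in S^v_\ell$. Contracting all edges of $G_1+G_2$ lying outside the copies $G_v$ gives the tree amalgamation $G_1\ast G_2=G_1\ast_T G_2$ over the connecting tree $T$. Let $\pi\colon V(G_1+G_2)\to V(G_1\ast G_2)$ be the canonical map sending each vertex to the vertex obtained from it after all contractions. The sets $S^i_k$ and their images under $\pi$ in $G_1\ast G_2$ are the adhesion sets of the tree amalgamation. For $x\in V(G_1\ast G_2)$ let $T_x$ be the maximal subtree of $T$ such that for each node $u$ of $T_x$ the graph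 $G_u$ contains a vertex $y$ with $\pi(y)=x$. The identification size of $x$ is $|V(T_x)|$. The tree amalgamation has finite identification if the identification sizes of all its vertices are bounded. **Respecting the actions.** Let $\Gamma_i$ be a group acting on $G_i$ for $i=1,2$, and let $\{i,j\}=\{1,2\}$. The tree amalgamation respects $\gamma\in\Gamma_i$ if there is a permutation $\sigma$ of $I_i$ such that for every $k\in I_i$ there exist $\ell\in I_j$ and $\tau$ in the setwise stabiliser of $S_\ell$ in $\Gamma_j$ such that $\phi_{k\ell}=\tau\circ\phi_{\sigma(k)\ell}\circ\gamma|_{S_k}$. It respects $\Gamma_i$ if it respects every $\gamma\in\Gamma_i$. For $k\in I_i$ and $\ell,\ell'\in I_j$, the bonding maps from $k$ to $\ell$ and $\ell'$ are consistent if there exists $\gamma\in\Gamma_j$ such that $\phi_{k\ell}=\gamma\circ\phi_{k\ell'}$. The bonding maps between $J_i\subseteq I_i$ and $J_j\subseteq I_j$ are consistent if they are consistent for all $k\in J_i$ and $\ell,\ell'\in J_j$. The tree amalgamation is of Type 1 respecting the actions of $\Gamma_1$ and $\Gamma_2$ if (i) it respects $\Gamma_1$ and $\Gamma_2$, and (ii) the bonding maps between $I_1$ and $I_2$ are consistent. It is of Type 2 respecting the actions of $\Gamma_1$ and $\Gamma_2$ if (o) $G_1=G_2$, $\Gamma_1=\Gamma_2=:\Gamma$ and $I_1=I_2=:I$ (formally one works with a bijection $I_1\to I_2$, since $I_1$ and $I_2$ are disjoint), and there exists $J\subseteq I$ such that $f(\vec e)\in J$ if and only if $f(\overleftarrow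 e)\notin J$; (i) it respects $\Gamma$; and (ii) the bonding maps between $J$ and $I\setminus J$ are consistent. The tree amalgamation respects the actions of $\Gamma_1$ and $\Gamma_2$ if it is of Type 1 or of Type 2 respecting these actions.
   Formalization: In Type 2, "respects Γ" counts only bonding maps φ_kℓ with exactly one index in J (for k and for σ(k)), i.e. those used in the construction, and φ_kℓ is one family on I; if unused maps may serve as witnesses, the bound fails (ladders glued by an arbitrary bijection). *)

theory Defs
  imports
    "HOL-Analysis.Abstract_Metric_Spaces"
    "HOL-Library.Equipollence"
    "HOL-Library.Extended_Nat"
    "HOL-Algebra.Group_Action"
    "Graph_Theory.Shortest_Path"
    "Graph_Theory.Pair_Digraph"
    "Graph_Theory.Digraph_Component"
begin

section \<open>Asymptotic dimension\<close>

text \<open>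
  Distances take values in the extended reals, because the graph distance of a disconnected graph
  is infinite between different components. For metric spaces in the usual sense the open sets
  are those of the library, as the lemma shows.
\<close>

definition open_in :: "'a set \<Rightarrow> ('a \<Rightarrow> 'a \<Rightarrow> ereal) \<Rightarrow> 'a set \<Rightarrow> bool" where
  "open_in X d V \<longleftrightarrow> V \<subseteq> X \<and> (\<forall>x\<in>V. \<exists>\<epsilon>>0::real. \<forall>y\<in>X. d x y < ereal \<epsilon> \<longrightarrow> y \<in> V)"

lemma open_in_iff_openin_mtopology:
  assumes "Metric_space X d"
  shows "open_in X (\<lambda>x y. ereal (d x y)) V \<longleftrightarrow> openin (Metric_space.mtopology X d) V"
proof -
  interpret Metric_space X d by fact
  show ?thesis
    unfolding open_in_def openin_mtopology mball_def by (simp add: subset_iff) blast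
qed

definition open_cover :: "'a set \<Rightarrow> ('a \<Rightarrow> 'a \<Rightarrow> ereal) \<Rightarrow> 'a set set \<Rightarrow> bool" where
  "open_cover X d \<V> \<longleftrightarrow> (\<forall>V\<in>\<V>. open_in X d V) \<and> \<Union>\<V> = X"

definition uniformly_bounded :: "('a \<Rightarrow> 'a \<Rightarrow> ereal) \<Rightarrow> 'a set set \<Rightarrow> bool" where
  "uniformly_bounded d \<V> \<longleftrightarrow> (\<exists>B::real. \<forall>V\<in>\<V>. \<forall>x\<in>V. \<forall>y\<in>V. d x y \<le> ereal B)"

definition multiplicity_le :: "'a set \<Rightarrow> 'a set set \<Rightarrow> nat \<Rightarrow> bool" where
  "multiplicity_le X \<V> n \<longleftrightarrow> (\<forall>x\<in>X. finite {V\<in>\<V>. x \<in> V} \<and> card {V\<in>\<V>. x \<in> V} \<le> n)"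

definition refines :: "'a set set \<Rightarrow> 'a set set \<Rightarrow> bool" where
  "refines \<V> \<U> \<longleftrightarrow> (\<forall>V\<in>\<V>. \<exists>U\<in>\<U>. V \<subseteq> U)"

definition asdim_le :: "'a set \<Rightarrow> ('a \<Rightarrow> 'a \<Rightarrow> ereal) \<Rightarrow> nat \<Rightarrow> bool" where
  "asdim_le X d n \<longleftrightarrow>
     (\<forall>\<V>. open_cover X d \<V> \<and> uniformly_bounded d \<V> \<longrightarrow>
        (\<exists>\<U>. open_cover X d \<U> \<and> uniformly_bounded d \<U> \<and>
             multiplicity_le X \<U> (n + 1) \<and> refines \<V> \<U>))"

text \<open>The infimum in \<^typ>\<open>enat\<close> is a minimum on nonempty sets and \<open>\<infinity>\<close> on the empty set.\<close>

definition asdim :: "'a set \<Rightarrow> ('a \<Rightarrow> 'a \<Rightarrow> ereal) \<Rightarrow> enat" where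
  "asdim X d = Inf {enat n | n. asdim_le X d n}"

section \<open>Graphs\<close>

text \<open>
  A (possibly infinite) simple graph is a \<^locale>\<open>pair_bidirected_digraph\<close>: a vertex set with a
  symmetric loop-free set of arcs. Its underlying metric space is the vertex set with the
  number of edges of a shortest path as distance.
\<close>

definition graph_dist :: "'a pair_pre_digraph \<Rightarrow> 'a \<Rightarrow> 'a \<Rightarrow> ereal" where
  "graph_dist G = wf_digraph.\<mu> (with_proj G) (\<lambda>_. 1)"

definition graph_asdim :: "'a pair_pre_digraph \<Rightarrow> enat" where
  "graph_asdim G = asdim (pverts G) (graph_dist G)"

definition locally_finite :: "'a pair_pre_digraph \<Rightarrow> bool" where
  "locally_finite G \<longleftrightarrow> (\<forall>v\<in>pverts G. finite (out_arcs (with_proj G) v))"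

text \<open>
  The library predicate \<^const>\<open>tree\<close> is not usable for symmetric digraphs, since there every edge
  traversed back and forth is a \<^const>\<open>pre_digraph.cycle\<close> of length 2. The cycles of a simple
  undirected graph are those of length at least 3.
\<close>

definition undirected_tree :: "'a pair_pre_digraph \<Rightarrow> bool" where
  "undirected_tree T \<longleftrightarrow>
     pair_bidirected_digraph T \<and> Digraph_Component.connected (with_proj T) \<and>
     \<not> (\<exists>p. pre_digraph.cycle (with_proj T) p \<and> 3 \<le> length p)"

definition quasi_transitive_action ::
  "'g monoid \<Rightarrow> ('g \<Rightarrow> 'a \<Rightarrow> 'a) \<Rightarrow> 'a pair_pre_digraph \<Rightarrow> bool" where
  "quasi_transitive_action \<Gamma> \<rho> G \<longleftrightarrow>
     group_action \<Gamma> (pverts G) \<rho> \<and>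
     (\<forall>g\<in>carrier \<Gamma>. \<forall>x\<in>pverts G. \<forall>y\<in>pverts G.
        (\<rho> g x, \<rho> g y) \<in> parcs G \<longleftrightarrow> (x, y) \<in> parcs G) \<and>
     finite (orbits \<Gamma> (pverts G) \<rho>)"

text \<open>
  Contraction of all edges in a symmetric set \<open>F\<close> of arcs: the new vertices are the components of
  \<open>F\<close>; loops and parallel edges are discarded.
\<close>

definition contraction_map :: "'a rel \<Rightarrow> 'a \<Rightarrow> 'a set" where
  "contraction_map F x = F\<^sup>* `` {x}"

definition contract :: "'a pair_pre_digraph \<Rightarrow> 'a rel \<Rightarrow> 'a set pair_pre_digraph" where
  "contract G F =
     \<lparr> pverts = contraction_map F ` pverts G,
       parcs = {(X, Y). X \<noteq> Y \<and>
         (\<exists>x y. (x, y) \<in> parcs G \<and> X = contraction_map F x \<and> Y = contraction_map F y)} \<rparr>"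

section \<open>Tree amalgamations\<close>

datatype side = First | Second

fun other :: "side \<Rightarrow> side" where
  "other First = Second"
| "other Second = First"

text \<open>
  The two factors are indexed by \<^typ>\<open>side\<close>. The index sets \<open>I\<^sub>1, I\<^sub>2\<close> of the adhesion sets are
  sets \<open>index First\<close>, \<open>index Second\<close> of a common type which are not required to be disjoint:
  every use of an index comes with its side, so that the disjoint union of the two sets is
  meant. This allows for \<open>I\<^sub>1 = I\<^sub>2\<close> in amalgamations of Type 2. Likewise both factors have
  vertices of a common type, so that \<open>G\<^sub>1 = G\<^sub>2\<close> can be expressed.

  The field \<open>bonding\<close> contains \<open>\<phi>\<^sub>k\<^sub>l\<close> for \<open>k \<in> I\<^sub>1\<close>, \<open>l \<in> I\<^sub>2\<close>; the maps in the other direction are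
  their inverses, see \<open>bond\<close> below.
\<close>

record ('a, 'i, 't) amalgam =
  factor :: "side \<Rightarrow> 'a pair_pre_digraph"
  index :: "side \<Rightarrow> 'i set"
  adh :: "side \<Rightarrow> 'i \<Rightarrow> 'a set"
  bonding :: "'i \<Rightarrow> 'i \<Rightarrow> 'a \<Rightarrow> 'a"
  conn_tree :: "'t pair_pre_digraph"
  part :: "side \<Rightarrow> 't set"
  label :: "'t \<times> 't \<Rightarrow> 'i"

text \<open>\<open>bond A i k l\<close> is the bonding map from \<open>k \<in> I\<^sub>i\<close> to \<open>l \<in> I\<^sub>j\<close>, where \<open>{i, j} = {1, 2}\<close>.\<close>

fun bond :: "('a, 'i, 't) amalgam \<Rightarrow> side \<Rightarrow> 'i \<Rightarrow> 'i \<Rightarrow> 'a \<Rightarrow> 'a" where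
  "bond A First k l = bonding A k l"
| "bond A Second k l = inv_into (adh A First l) (bonding A l k)"

locale tree_amalgamation =
  fixes A :: "('a, 'i, 't) amalgam"
  assumes factor_graph: "pair_bidirected_digraph (factor A i)"
    and adh_subset: "k \<in> index A i \<Longrightarrow> adh A i k \<subseteq> pverts (factor A i)"
    and adh_eqpoll: "k \<in> index A i \<Longrightarrow> l \<in> index A j \<Longrightarrow> adh A i k \<approx> adh A j l"
    and bonding_bij: "k \<in> index A First \<Longrightarrow> l \<in> index A Second \<Longrightarrow>
      bij_betw (bonding A k l) (adh A First k) (adh A Second l)"
    and conn_tree: "undirected_tree (conn_tree A)"
    and part_Un: "part A First \<union> part A Second = pverts (conn_tree A)"
    and part_Int: "part A First \<inter> part A Second = {}"
    and bipartite: "(u, v) \<in> parcs (conn_tree A) \<Longrightarrow> u \<in> part A i \<Longrightarrow> v \<in> part A (other i)"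
    and degree: "v \<in> part A i \<Longrightarrow> out_arcs (with_proj (conn_tree A)) v \<approx> index A i"
    and label_index: "v \<in> part A i \<Longrightarrow> e \<in> out_arcs (with_proj (conn_tree A)) v \<Longrightarrow>
      label A e \<in> index A i"
    and label_unique: "v \<in> part A i \<Longrightarrow> k \<in> index A i \<Longrightarrow>
      \<exists>!e. e \<in> out_arcs (with_proj (conn_tree A)) v \<and> label A e = k"

definition side_of :: "('a, 'i, 't) amalgam \<Rightarrow> 't \<Rightarrow> side" where
  "side_of A v = (if v \<in> part A First then First else Second)"

text \<open>The pair \<open>(v, x)\<close> is the copy of the vertex \<open>x\<close> in the graph \<open>G\<^sub>v\<close>.\<close>

definition copy_arcs :: "('a, 'i, 't) amalgam \<Rightarrow> ('t \<times> 'a) rel" where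
  "copy_arcs A = {((v, x), (v, y)) | v x y.
     v \<in> pverts (conn_tree A) \<and> (x, y) \<in> parcs (factor A (side_of A v))}"

definition bond_arcs :: "('a, 'i, 't) amalgam \<Rightarrow> ('t \<times> 'a) rel" where
  "bond_arcs A = {((u, x), (v, bond A (side_of A u) (label A (u, v)) (label A (v, u)) x)) | u v x.
     (u, v) \<in> parcs (conn_tree A) \<and> x \<in> adh A (side_of A u) (label A (u, v))}"

definition sum_graph :: "('a, 'i, 't) amalgam \<Rightarrow> ('t \<times> 'a) pair_pre_digraph" where
  "sum_graph A =
     \<lparr> pverts = {(v, x). v \<in> pverts (conn_tree A) \<and> x \<in> pverts (factor A (side_of A v))},
       parcs = copy_arcs A \<union> bond_arcs A \<rparr>"

definition amalgam_graph :: "('a, 'i, 't) amalgam \<Rightarrow> ('t \<times> 'a) set pair_pre_digraph" where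
  "amalgam_graph A = contract (sum_graph A) (bond_arcs A)"

definition proj :: "('a, 'i, 't) amalgam \<Rightarrow> 't \<times> 'a \<Rightarrow> ('t \<times> 'a) set" where
  "proj A = contraction_map (bond_arcs A)"

definition occupied_subtree ::
  "('a, 'i, 't) amalgam \<Rightarrow> ('t \<times> 'a) set \<Rightarrow> 't pair_pre_digraph \<Rightarrow> bool" where
  "occupied_subtree A x U \<longleftrightarrow>
     undirected_tree U \<and> subgraph (with_proj U) (with_proj (conn_tree A)) \<and>
     (\<forall>u\<in>pverts U. \<exists>y\<in>pverts (factor A (side_of A u)). proj A (u, y) = x)"

definition identification_tree ::
  "('a, 'i, 't) amalgam \<Rightarrow> ('t \<times> 'a) set \<Rightarrow> 't pair_pre_digraph \<Rightarrow> bool" where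
  "identification_tree A x U \<longleftrightarrow>
     occupied_subtree A x U \<and>
     (\<forall>U'. occupied_subtree A x U' \<and> subgraph (with_proj U) (with_proj U') \<longrightarrow> U' = U)"

definition finite_identification :: "('a, 'i, 't) amalgam \<Rightarrow> bool" where
  "finite_identification A \<longleftrightarrow>
     (\<exists>N. \<forall>x\<in>pverts (amalgam_graph A).
        \<exists>U. identification_tree A x U \<and> finite (pverts U) \<and> card (pverts U) \<le> N)"

section \<open>Respecting group actions\<close>

text \<open>
  The parameter \<open>R\<close> says which pairs of indices are bonded. In Type 1 these are all
  pairs from \<open>I\<^sub>1\<close> and \<open>I\<^sub>2\<close>. In Type 2 these are the pairs with exactly one member in \<open>J\<close>:
  the other maps \<open>\<phi>\<^sub>k\<^sub>l\<close> belong to no edge of the connecting tree, hence do not enter the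
  construction of the amalgamation, and are not counted as bonding maps. Admitting them as
  witnesses would make respecting \<open>\<Gamma>\<close> void: if \<open>I = {a, b}\<close>, \<open>J = {a}\<close>, all \<open>S\<^sub>k\<close> are invariant under
  \<open>\<Gamma>\<close> and the irrelevant maps \<open>\<phi>\<^sub>a\<^sub>a\<close> and \<open>\<phi>\<^sub>b\<^sub>b\<close> are identities, then \<open>\<sigma> = id\<close>, \<open>\<tau> = \<gamma>\<^sup>-\<^sup>1\<close> would do for
  an arbitrary bijection \<open>\<phi>\<^sub>a\<^sub>b\<close>.

  Since \<open>\<phi>\<^sub>\<sigma>\<^sub>(\<^sub>k\<^sub>)\<^sub>l\<close> is defined on \<open>S\<^sub>\<sigma>\<^sub>(\<^sub>k\<^sub>)\<close> only, composability of the maps is a separate clause.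
\<close>

definition respects_element ::
  "('a, 'i, 't) amalgam \<Rightarrow> (side \<Rightarrow> 'g monoid) \<Rightarrow> (side \<Rightarrow> 'g \<Rightarrow> 'a \<Rightarrow> 'a) \<Rightarrow>
   ('i \<Rightarrow> 'i \<Rightarrow> bool) \<Rightarrow> side \<Rightarrow> 'g \<Rightarrow> bool" where
  "respects_element A \<Gamma> \<rho> R i \<gamma> \<longleftrightarrow>
     (\<exists>\<sigma>. bij_betw \<sigma> (index A i) (index A i) \<and>
       (\<forall>k\<in>index A i. \<exists>l\<in>index A (other i).
          R k l \<and> R (\<sigma> k) l \<and>
          (\<exists>\<tau>\<in>stabilizer (\<Gamma> (other i)) (\<lambda>g. image (\<rho> (other i) g)) (adh A (other i) l).
             \<rho> i \<gamma> ` adh A i k \<subseteq> adh A i (\<sigma> k) \<and>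
             (\<forall>x\<in>adh A i k. bond A i k l x = \<rho> (other i) \<tau> (bond A i (\<sigma> k) l (\<rho> i \<gamma> x))))))"

definition respects_group ::
  "('a, 'i, 't) amalgam \<Rightarrow> (side \<Rightarrow> 'g monoid) \<Rightarrow> (side \<Rightarrow> 'g \<Rightarrow> 'a \<Rightarrow> 'a) \<Rightarrow>
   ('i \<Rightarrow> 'i \<Rightarrow> bool) \<Rightarrow> side \<Rightarrow> bool" where
  "respects_group A \<Gamma> \<rho> R i \<longleftrightarrow> (\<forall>\<gamma>\<in>carrier (\<Gamma> i). respects_element A \<Gamma> \<rho> R i \<gamma>)"

definition consistent ::
  "('a, 'i, 't) amalgam \<Rightarrow> (side \<Rightarrow> 'g monoid) \<Rightarrow> (side \<Rightarrow> 'g \<Rightarrow> 'a \<Rightarrow> 'a) \<Rightarrow>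
   side \<Rightarrow> 'i set \<Rightarrow> 'i set \<Rightarrow> bool" where
  "consistent A \<Gamma> \<rho> i K L \<longleftrightarrow>
     (\<forall>k\<in>K. \<forall>l\<in>L. \<forall>l'\<in>L. \<exists>\<gamma>\<in>carrier (\<Gamma> (other i)).
        \<forall>x\<in>adh A i k. bond A i k l x = \<rho> (other i) \<gamma> (bond A i k l' x))"

definition type1 ::
  "('a, 'i, 't) amalgam \<Rightarrow> (side \<Rightarrow> 'g monoid) \<Rightarrow> (side \<Rightarrow> 'g \<Rightarrow> 'a \<Rightarrow> 'a) \<Rightarrow> bool" where
  "type1 A \<Gamma> \<rho> \<longleftrightarrow>
     respects_group A \<Gamma> \<rho> (\<lambda>_ _. True) First \<and>
     respects_group A \<Gamma> \<rho> (\<lambda>_ _. True) Second \<and>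
     consistent A \<Gamma> \<rho> First (index A First) (index A Second)"

text \<open>
  Besides \<open>G\<^sub>1 = G\<^sub>2\<close>, \<open>\<Gamma>\<^sub>1 = \<Gamma>\<^sub>2\<close> and \<open>I\<^sub>1 = I\<^sub>2\<close>, the actions and the families \<open>S\<^sub>k\<close> and \<open>\<phi>\<^sub>k\<^sub>l\<close>
  agree on the two sides. After this identification it suffices to refer to the side \<^const>\<open>First\<close>.
\<close>

definition type2 ::
  "('a, 'i, 't) amalgam \<Rightarrow> (side \<Rightarrow> 'g monoid) \<Rightarrow> (side \<Rightarrow> 'g \<Rightarrow> 'a \<Rightarrow> 'a) \<Rightarrow> bool" where
  "type2 A \<Gamma> \<rho> \<longleftrightarrow>
     factor A First = factor A Second \<and>
     \<Gamma> First = \<Gamma> Second \<and>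
     (\<forall>g\<in>carrier (\<Gamma> First). \<forall>x\<in>pverts (factor A First). \<rho> First g x = \<rho> Second g x) \<and>
     index A First = index A Second \<and>
     (\<forall>k\<in>index A First. adh A First k = adh A Second k) \<and>
     (\<exists>J\<subseteq>index A First.
        (\<forall>k\<in>index A First. \<forall>l\<in>index A First. (k \<in> J \<longleftrightarrow> l \<notin> J) \<longrightarrow>
           (\<forall>x\<in>adh A First k. bond A First k l x = bond A Second k l x)) \<and>
        (\<forall>u v. (u, v) \<in> parcs (conn_tree A) \<longrightarrow> (label A (u, v) \<in> J \<longleftrightarrow> label A (v, u) \<notin> J)) \<and>
        respects_group A \<Gamma> \<rho> (\<lambda>k l. k \<in> J \<longleftrightarrow> l \<notin> J) First \<and>
        consistent A \<Gamma> \<rho> First J (index A First - J))"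

definition respects_actions ::
  "('a, 'i, 't) amalgam \<Rightarrow> (side \<Rightarrow> 'g monoid) \<Rightarrow> (side \<Rightarrow> 'g \<Rightarrow> 'a \<Rightarrow> 'a) \<Rightarrow> bool" where
  "respects_actions A \<Gamma> \<rho> \<longleftrightarrow> type1 A \<Gamma> \<rho> \<or> type2 A \<Gamma> \<rho>"

end

theory Submission
  imports Defs
begin

text \<open>
  Asymptotic dimension at most \<open>n\<close> means that for every scale \<open>r\<close> the space can be coloured with
  \<open>n + 1\<close> colours such that monochromatic chains with steps of length at most \<open>r\<close> stay bounded.
  Finite identification makes \<open>G\<^sub>1 \<ast> G\<^sub>2\<close> quasi-isometric to \<open>G\<^sub>1 + G\<^sub>2\<close>, which maps onto the tree \<open>T\<close>.
  As the actions are quasi-transitive on locally finite graphs and are respected, there are only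
  finitely many possibilities for the bonding maps near a vertex, so all of them are uniformly
  coarse equivalences. Hence every \<open>G\<^sub>v\<close> is uniformly coarsely embedded in \<open>G\<^sub>1 + G\<^sub>2\<close>, and all
  adhesion sets are uniformly coarsely equivalent.

  Root \<open>T\<close>. By the union theorem, the parts of \<open>G\<^sub>1 + G\<^sub>2\<close> over subtrees of bounded depth have
  asymptotic dimension at most \<open>n\<close>, uniformly. Cut \<open>G\<^sub>1 + G\<^sub>2\<close> along the points at a fixed large
  distance beyond the adhesion sets at every \<open>L\<close>-th level of \<open>T\<close>. The distance separates the
  cuts of siblings, so the bands around the cuts need \<open>n\<close> colours only. The remaining colour is
  used to change the colours within a band step by step, so that no monochromatic chain gets
  across it.
\<close>

section \<open>Coarse geometry of relations\<close>

text \<open>Two obstacles shape the argument. The bound speaks of one adhesion set, while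
  \<open>T\<close> may have infinitely many edges. So estimates are made for whole families of sets
  with one constant per scale, and bonding maps, which need not be isometries, have to be compared
  before one set can control all others. Finite identification enters twice here: a vertex lies in
  finitely many adhesion sets of its factor, and vertices contracted to one are boundedly close in
  the sum graph. The other obstacle is a circularity. To unite the colourings of the bands and of
  the pieces between them, the pieces would have to be separated at a scale depending on the bound
  \<open>D\<close> for chains inside the bands, but \<open>D\<close> depends on the width of the
  bands. The recolouring breaks the circle: its width depends on \<open>r\<close> and the dimension
  \<open>m\<close> of the adhesion set only, and it is possible since \<open>m < n\<close> leaves a
  colour free. A chain that comes close to a cut then never leaves its band, and all others stay on
  one side. Distances occur only as \<open>near E r\<close>, so that infinite distances need no
  separate treatment.\<close>

definition near :: "'a rel \<Rightarrow> nat \<Rightarrow> 'a rel" where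
  "near E r = (E\<^sup>=) ^^ r"

lemma near_0 [simp]: "near E 0 = Id"
  by (simp add: near_def)

lemma near_Suc: "near E (Suc r) = near E r O (E\<^sup>=)"
  by (simp add: near_def)

lemma near_refl [simp, intro]: "(x, x) \<in> near E r"
  by (induction r) (auto simp: near_Suc)

lemma near_trans: "(x, y) \<in> near E a \<Longrightarrow> (y, z) \<in> near E b \<Longrightarrow> (x, z) \<in> near E (a + b)"
  by (auto simp: near_def relpow_add)

lemma near_add: "near E (a + b) = near E a O near E b"
  by (simp add: near_def relpow_add)

lemma near_mono: "(x, y) \<in> near E a \<Longrightarrow> a \<le> b \<Longrightarrow> (x, y) \<in> near E b"
  using near_trans[of x y E a y "b - a"] by simp

lemma near_trans_le:
  "(x, y) \<in> near E a \<Longrightarrow> (y, z) \<in> near E b \<Longrightarrow> a + b \<le> c \<Longrightarrow> (x, z) \<in> near E c"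
  by (meson near_mono near_trans)

lemma near_arc: "(x, y) \<in> E \<Longrightarrow> 1 \<le> a \<Longrightarrow> (x, y) \<in> near E a"
  by (rule near_mono[of _ _ _ 1]) (simp_all add: near_def)

lemma near_1: "near E (Suc 0) = E\<^sup>="
  by (simp add: near_def)

lemma near_Suc_left:
  "(x, y) \<in> near E (Suc m) \<longleftrightarrow> (\<exists>z. (z = x \<or> (x, z) \<in> E) \<and> (z, y) \<in> near E m)"
proof -
  have "near E (Suc m) = near E 1 O near E m" using near_add[of E 1 m] by (simp only: plus_1_eq_Suc)
  then show ?thesis by (auto simp: near_1)
qed

lemma near_sym: "sym E \<Longrightarrow> (x, y) \<in> near E r \<Longrightarrow> (y, x) \<in> near E r"
proof (induction r arbitrary: x y)
  case (Suc r)
  then obtain z where z: "(x, z) \<in> near E r" "(z, y) \<in> E\<^sup>=" by (auto simp: near_Suc)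
  have "(y, z) \<in> near E 1" using z(2) Suc.prems(1) by (auto simp: near_1 sym_def)
  then show ?case using Suc z(1) near_trans_le[of y z E 1 x r "Suc r"] by auto
qed auto

lemma near_imp_rtrancl: "(x, y) \<in> near E r \<Longrightarrow> (x, y) \<in> E\<^sup>*"
  by (induction r arbitrary: y) (auto simp: near_Suc intro: rtrancl.rtrancl_into_rtrancl)

lemma rtrancl_imp_near: "(x, y) \<in> E\<^sup>* \<Longrightarrow> \<exists>r. (x, y) \<in> near E r"
proof (induction rule: rtrancl_induct)
  case (step y z)
  then show ?case by (meson near_arc near_trans order.refl)
qed auto

lemma near_map:
  assumes "\<And>x y. (x, y) \<in> E \<Longrightarrow> (f x, f y) \<in> near E' k"
  shows "(x, y) \<in> near E r \<Longrightarrow> (f x, f y) \<in> near E' (k * r)"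
proof (induction r arbitrary: y)
  case (Suc r)
  then obtain z where z: "(x, z) \<in> near E r" "(z, y) \<in> E\<^sup>=" by (auto simp: near_Suc)
  have "(f z, f y) \<in> near E' k" using z(2) assms by auto
  then show ?case using near_trans_le[OF Suc.IH[OF z(1)]] by simp
qed auto

lemma near_closed:
  assumes "(x, y) \<in> near E r" "x \<in> V" "\<And>x y. (x, y) \<in> E \<Longrightarrow> x \<in> V \<Longrightarrow> y \<in> V"
  shows "y \<in> V"
  using assms(1) by (induction r arbitrary: y) (use assms(2,3) in \<open>auto simp: near_Suc\<close>)

text \<open>The distance from \<open>x\<close> to \<open>S\<close>, capped at \<open>M\<close>.\<close>

definition gap :: "'a rel \<Rightarrow> nat \<Rightarrow> 'a set \<Rightarrow> 'a \<Rightarrow> nat" where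
  "gap E M S x = card {k. k < M \<and> (\<forall>z\<in>S. (x, z) \<notin> near E k)}"

lemma gap_le_cap: "gap E M S x \<le> M"
proof -
  have "gap E M S x \<le> card {..<M}" unfolding gap_def by (rule card_mono) auto
  then show ?thesis by simp
qed

lemma gap_le: "z \<in> S \<Longrightarrow> (x, z) \<in> near E k \<Longrightarrow> gap E M S x \<le> k"
proof -
  assume z: "z \<in> S" "(x, z) \<in> near E k"
  have "{j. j < M \<and> (\<forall>z\<in>S. (x, z) \<notin> near E j)} \<subseteq> {..<k}"
    using z near_mono[of x z E k] by (fastforce simp: not_less[symmetric])
  then have "gap E M S x \<le> card {..<k}" unfolding gap_def by (rule card_mono[rotated]) simp
  then show ?thesis by simp
qed

lemma gap_attained:
  assumes "gap E M S x < M"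
  shows "\<exists>z\<in>S. (x, z) \<in> near E (gap E M S x)"
proof (rule ccontr)
  assume *: "\<not> ?thesis"
  have "{..gap E M S x} \<subseteq> {k. k < M \<and> (\<forall>z\<in>S. (x, z) \<notin> near E k)}"
    using * assms near_mono by fastforce
  then have "card {..gap E M S x} \<le> gap E M S x" unfolding gap_def by (rule card_mono[rotated]) simp
  then show False by simp
qed

lemma gap_Lipschitz:
  assumes "(x, y) \<in> near E r"
  shows "gap E M S x \<le> gap E M S y + r"
proof (cases "gap E M S y < M")
  case True
  then obtain z where z: "z \<in> S" "(y, z) \<in> near E (gap E M S y)"
    using gap_attained[OF True] by blast
  have "(x, z) \<in> near E (r + gap E M S y)" using assms z(2) by (rule near_trans)
  then show ?thesis using gap_le[OF z(1)] by (simp add: add.commute)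
next
  case False
  then show ?thesis using gap_le_cap[of E M S x] by simp
qed

text \<open>The walk is cut where it first enters the fibre of \<open>v\<close>. Both remaining
  lengths are strictly smaller than \<open>m\<close>, which makes strong induction on the length of
  walks possible.\<close>

lemma first_return:
  assumes "(p, q) \<in> near E m" "node p \<noteq> v" "node q = v"
  shows "\<exists>k<m. \<exists>j<m. \<exists>p' q'. (p, p') \<in> near (E \<inter> {z. node z \<noteq> v} \<times> {z. node z \<noteq> v}) k \<and>
    (p', q') \<in> E \<and> node p' \<noteq> v \<and> node q' = v \<and> (q', q) \<in> near E j"
  using assms(1,2)
proof (induction m arbitrary: p)
  case 0
  then show ?case using assms(3) by simp
next
  case (Suc m)
  have "(p, q) \<in> near E 1 O near E m" using Suc.prems(1) near_add[of E 1 m] by simp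
  then obtain z where z: "z = p \<or> (p, z) \<in> E" "(z, q) \<in> near E m" by (auto simp: near_1)
  show ?case
  proof (cases "node z = v")
    case True
    then show ?thesis using z Suc.prems(2)
      by (intro exI[of _ 0] exI[of _ m] exI[of _ p] exI[of _ z] conjI) auto
  next
    case False
    let ?A = "E \<inter> {z. node z \<noteq> v} \<times> {z. node z \<noteq> v}"
    obtain k j p' q' where *: "k < m" "j < m" "(z, p') \<in> near ?A k" "(p', q') \<in> E"
      "node p' \<noteq> v" "node q' = v" "(q', q) \<in> near E j"
      using Suc.IH[OF z(2) False] by blast
    have "(p, z) \<in> near ?A 1" using z(1) False Suc.prems(2) by (auto intro: near_arc)
    from near_trans[OF this *(3)] have "(p, p') \<in> near ?A (Suc k)" by simp
    then show ?thesis using *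
      by (intro exI[of _ "Suc k"] exI[of _ j] exI[of _ p'] exI[of _ q'] conjI) auto
  qed
qed

text \<open>Restricted to the component of \<open>p\<close>, \<open>F\<close> is finite, and a
  finite relation reaches everything within as many steps as it has pairs. The bound is crude, but
  it depends on the size of the component only.\<close>

lemma finite_rtrancl_near:
  assumes "(p, q) \<in> F\<^sup>*" "finite (F\<^sup>* `` {p})"
  shows "(p, q) \<in> near F (card (F\<^sup>* `` {p}) * card (F\<^sup>* `` {p}))"
proof -
  let ?C = "F\<^sup>* `` {p}" and ?R = "F \<inter> (F\<^sup>* `` {p}) \<times> (F\<^sup>* `` {p})"
  have "(p, q) \<in> ?R\<^sup>*"
    using assms(1)
  proof (induction rule: rtrancl_induct)
    case (step y z)
    then have "(y, z) \<in> ?R" by (auto intro: rtrancl.rtrancl_into_rtrancl)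
    with step.IH show ?case by (rule rtrancl.rtrancl_into_rtrancl)
  qed simp
  moreover have fin: "finite ?R" using assms(2) by (intro finite_subset[of ?R "?C \<times> ?C"]) auto
  ultimately obtain n where n: "n \<le> card ?R" "(p, q) \<in> ?R ^^ n"
    using rtrancl_finite_eq_relpow[OF fin] by auto
  have "card ?R \<le> card (?C \<times> ?C)" using assms(2) by (intro card_mono) auto
  then have "n \<le> card ?C * card ?C" using n(1) by (simp add: card_cartesian_product)
  moreover have "(p, q) \<in> near F n" using n(2)
  proof (induction n arbitrary: q)
    case (Suc n)
    then obtain z where z: "(p, z) \<in> ?R ^^ n" "(z, q) \<in> F" by auto
    have "(p, z) \<in> near F n" using z(1) by (rule Suc.IH)
    then show ?case unfolding near_Suc using z(2) by blast
  qed simp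
  ultimately show ?thesis by (rule near_mono[rotated])
qed

lemma near_rel_mono: "E \<subseteq> F \<Longrightarrow> (x, y) \<in> near E r \<Longrightarrow> (x, y) \<in> near F r"
  using near_map[of E "\<lambda>x. x" F 1 x y r] near_arc[of _ _ F 1] by auto

section \<open>Colourings with bounded monochromatic chains, for families of sets\<close>

definition colour_links :: "'a rel \<Rightarrow> 'a set \<Rightarrow> ('a \<Rightarrow> nat) \<Rightarrow> nat \<Rightarrow> 'a rel" where
  "colour_links E Y c r = {(x, y). x \<in> Y \<and> y \<in> Y \<and> c x = c y \<and> (x, y) \<in> near E r}"

lemma colour_links_rtrancl: "(x, y) \<in> (colour_links E Y c r)\<^sup>* \<Longrightarrow> c x = c y"
  by (induction rule: rtrancl_induct) (auto simp: colour_links_def)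

text \<open>\<open>D\<close> is chosen before \<open>Y\<close>, so that one bound serves the whole
  family. Chains run inside \<open>Y\<close>, but distances are those of the ambient relation
  \<open>E\<close>.\<close>

definition colourable :: "'a rel \<Rightarrow> 'a set set \<Rightarrow> nat \<Rightarrow> nat \<Rightarrow> bool" where
  "colourable E \<F> n r \<longleftrightarrow>
     (\<exists>D. \<forall>Y\<in>\<F>. \<exists>c. (\<forall>x\<in>Y. c x \<le> n) \<and> (colour_links E Y c r)\<^sup>* \<subseteq> near E D)"

definition uniform_asdim_le :: "'a rel \<Rightarrow> 'a set set \<Rightarrow> nat \<Rightarrow> bool" where
  "uniform_asdim_le E \<F> n \<longleftrightarrow> (\<forall>r. colourable E \<F> n r)"

lemma colourableE:
  assumes "colourable E \<F> n r"
  obtains D c where "\<And>Y x. Y \<in> \<F> \<Longrightarrow> x \<in> Y \<Longrightarrow> c Y x \<le> n"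
    "\<And>Y x y. Y \<in> \<F> \<Longrightarrow> (x, y) \<in> (colour_links E Y (c Y) r)\<^sup>* \<Longrightarrow> (x, y) \<in> near E D"
proof -
  obtain D where "\<forall>Y\<in>\<F>. \<exists>c. (\<forall>x\<in>Y. c x \<le> n) \<and> (colour_links E Y c r)\<^sup>* \<subseteq> near E D"
    using assms unfolding colourable_def by blast
  then obtain c where
    "\<forall>Y\<in>\<F>. (\<forall>x\<in>Y. c Y x \<le> n) \<and> (colour_links E Y (c Y) r)\<^sup>* \<subseteq> near E D"
    by metis
  then show thesis using that by blast
qed

lemma uniform_asdim_leD: "uniform_asdim_le E \<F> n \<Longrightarrow> colourable E \<F> n r"
  by (simp add: uniform_asdim_le_def)

text \<open>If no step of length \<open>r\<close> leads from one part of a set to another, a chain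
  never changes its part, and colourings of the parts fit together. Siblings in the tree are handled
  this way without additional colours.\<close>

lemma colourable_separated:
  assumes "colourable E (range F) n r"
    and sep: "\<And>Z. Z \<in> \<G> \<Longrightarrow> \<exists>g. (\<forall>x\<in>Z. x \<in> F (g x)) \<and>
      (\<forall>x\<in>Z. \<forall>y\<in>Z. (x, y) \<in> near E r \<longrightarrow> g x = g y)"
  shows "colourable E \<G> n r"
proof -
  obtain D c' where c': "\<And>Y x. Y \<in> range F \<Longrightarrow> x \<in> Y \<Longrightarrow> c' Y x \<le> n"
    and D': "\<And>Y x y. Y \<in> range F \<Longrightarrow> (x, y) \<in> (colour_links E Y (c' Y) r)\<^sup>* \<Longrightarrow> (x, y) \<in> near E D"
    by (rule colourableE[OF assms(1)]) blast
  define c where "c i = c' (F i)" for i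
  have c: "x \<in> F i \<Longrightarrow> c i x \<le> n" for i x
    using c'[of "F i" x] by (simp add: c_def)
  have D: "(x, y) \<in> (colour_links E (F i) (c i) r)\<^sup>* \<Longrightarrow> (x, y) \<in> near E D" for i x y
    using D'[of "F i" x y] by (simp add: c_def)
  have "\<exists>c. (\<forall>x\<in>Z. c x \<le> n) \<and> (colour_links E Z c r)\<^sup>* \<subseteq> near E D" if "Z \<in> \<G>" for Z
  proof -
    obtain g where g: "\<And>x. x \<in> Z \<Longrightarrow> x \<in> F (g x)"
      and gg: "\<And>x y. x \<in> Z \<Longrightarrow> y \<in> Z \<Longrightarrow> (x, y) \<in> near E r \<Longrightarrow> g x = g y"
      using sep[OF \<open>Z \<in> \<G>\<close>] by blast
    have *: "x = y \<or> x \<in> Z \<and> g x = g y \<and> (x, y) \<in> (colour_links E (F (g x)) (c (g x)) r)\<^sup>*"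
      if "(x, y) \<in> (colour_links E Z (\<lambda>x. c (g x) x) r)\<^sup>*" for x y
      using that
    proof (induction rule: rtrancl_induct)
      case (step y z)
      have "(y, z) \<in> colour_links E (F (g y)) (c (g y)) r" "y \<in> Z" "g y = g z"
        using step.hyps(2) g[of y] g[of z] gg[of y z] by (auto simp: colour_links_def)
      with step.IH show ?case by (auto intro: rtrancl.rtrancl_into_rtrancl)
    qed simp
    have "(x, y) \<in> near E D" if "(x, y) \<in> (colour_links E Z (\<lambda>x. c (g x) x) r)\<^sup>*" for x y
      using *[OF that] D[of x y "g x"] by (elim disjE) (simp, blast)
    moreover have "\<forall>x\<in>Z. c (g x) x \<le> n" using c g by blast
    ultimately show ?thesis by (intro exI[of _ "\<lambda>x. c (g x) x"]) auto
  qed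
  then show ?thesis unfolding colourable_def by blast
qed

lemma uniform_asdim_le_mono: "uniform_asdim_le E \<F> m \<Longrightarrow> m \<le> n \<Longrightarrow> uniform_asdim_le E \<F> n"
  unfolding uniform_asdim_le_def colourable_def by (meson order_trans)

text \<open>The colouring for scale \<open>s r\<close> is pulled back along \<open>f\<close>:
  \<open>s\<close> keeps steps short on the way to the target, and \<open>t\<close> turns the bound
  there into one here. Only the control functions have to be uniform; \<open>f\<close> varies with
  \<open>Z\<close>.\<close>

lemma uniform_asdim_le_coarse_pullback:
  assumes "uniform_asdim_le E \<F> n"
    and maps: "\<And>Z. Z \<in> \<G> \<Longrightarrow> \<exists>Y\<in>\<F>. \<exists>f. f ` Z \<subseteq> Y \<and>
      (\<forall>r. \<forall>x\<in>Z. \<forall>y\<in>Z. (x, y) \<in> near E' r \<longrightarrow> (f x, f y) \<in> near E (s r)) \<and>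
      (\<forall>r. \<forall>x\<in>Z. \<forall>y\<in>Z. (f x, f y) \<in> near E r \<longrightarrow> (x, y) \<in> near E' (t r))"
  shows "uniform_asdim_le E' \<G> n"
  unfolding uniform_asdim_le_def colourable_def
proof
  fix r
  obtain D c where c: "\<And>Y x. Y \<in> \<F> \<Longrightarrow> x \<in> Y \<Longrightarrow> c Y x \<le> n"
    and D: "\<And>Y x y. Y \<in> \<F> \<Longrightarrow> (x, y) \<in> (colour_links E Y (c Y) (s r))\<^sup>* \<Longrightarrow> (x, y) \<in> near E D"
    by (rule colourableE[OF uniform_asdim_leD[OF assms(1)], where r = "s r"]) blast
  show "\<exists>D. \<forall>Z\<in>\<G>. \<exists>c. (\<forall>x\<in>Z. c x \<le> n) \<and> (colour_links E' Z c r)\<^sup>* \<subseteq> near E' D"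
  proof (rule exI, rule ballI)
    fix Z assume "Z \<in> \<G>"
    then obtain Y f where Y: "Y \<in> \<F>" and f: "f ` Z \<subseteq> Y"
      and s: "\<And>r x y. x \<in> Z \<Longrightarrow> y \<in> Z \<Longrightarrow> (x, y) \<in> near E' r \<Longrightarrow> (f x, f y) \<in> near E (s r)"
      and t: "\<And>r x y. x \<in> Z \<Longrightarrow> y \<in> Z \<Longrightarrow> (f x, f y) \<in> near E r \<Longrightarrow> (x, y) \<in> near E' (t r)"
      using maps by meson
    have *: "(x, y) \<in> (colour_links E' Z (c Y \<circ> f) r)\<^sup>* \<Longrightarrow>
      x = y \<or> x \<in> Z \<and> y \<in> Z \<and> (f x, f y) \<in> (colour_links E Y (c Y) (s r))\<^sup>*" for x y
    proof (induction rule: rtrancl_induct)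
      case (step y z)
      then have "(f y, f z) \<in> colour_links E Y (c Y) (s r)" "y \<in> Z" "z \<in> Z"
        using f s by (auto simp: colour_links_def)
      with step.IH show ?case by (auto intro: rtrancl.rtrancl_into_rtrancl)
    qed simp
    have "(x, y) \<in> near E' (t D)"
      if "(x, y) \<in> (colour_links E' Z (c Y \<circ> f) r)\<^sup>*" for x y
      using *[OF that] D[OF Y, of "f x" "f y"] t[of x y D] by (elim disjE) simp_all
    moreover have "\<forall>x\<in>Z. (c Y \<circ> f) x \<le> n"
      using c[OF Y] f by auto
    ultimately show "\<exists>c. (\<forall>x\<in>Z. c x \<le> n) \<and> (colour_links E' Z c r)\<^sup>* \<subseteq> near E' (t D)"
      by (intro exI[of _ "c Y \<circ> f"]) auto
  qed
qed

text \<open>Moving each point to one of \<open>Y\<close> within distance \<open>k\<close> changes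
  distances by at most \<open>2 * k\<close>. The case \<open>k = 0\<close> is the passage to
  subsets.\<close>

lemma uniform_asdim_le_nearby:
  assumes "uniform_asdim_le E \<F> n" and "sym E"
    and near: "\<And>Z. Z \<in> \<G> \<Longrightarrow> \<exists>Y\<in>\<F>. \<forall>x\<in>Z. \<exists>y\<in>Y. (x, y) \<in> near E k"
  shows "uniform_asdim_le E \<G> n"
proof (rule uniform_asdim_le_coarse_pullback[OF assms(1),
      where s = "\<lambda>r. k + r + k" and t = "\<lambda>r. k + r + k"])
  fix Z assume "Z \<in> \<G>"
  then obtain Y where Y: "Y \<in> \<F>" and "\<forall>x\<in>Z. \<exists>y\<in>Y. (x, y) \<in> near E k"
    using near by blast
  then obtain f where f: "\<And>x. x \<in> Z \<Longrightarrow> f x \<in> Y \<and> (x, f x) \<in> near E k"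
    by metis
  have 1: "(f x, f y) \<in> near E (k + r + k)" if "x \<in> Z" "y \<in> Z" "(x, y) \<in> near E r" for x y r
    using that f near_sym[OF assms(2)] by (meson near_trans)
  have 2: "(x, y) \<in> near E (k + r + k)" if "x \<in> Z" "y \<in> Z" "(f x, f y) \<in> near E r" for x y r
    using that f near_sym[OF assms(2)] by (meson near_trans)
  show "\<exists>Y\<in>\<F>. \<exists>f. f ` Z \<subseteq> Y \<and>
      (\<forall>r. \<forall>x\<in>Z. \<forall>y\<in>Z. (x, y) \<in> near E r \<longrightarrow> (f x, f y) \<in> near E (k + r + k)) \<and>
      (\<forall>r. \<forall>x\<in>Z. \<forall>y\<in>Z. (f x, f y) \<in> near E r \<longrightarrow> (x, y) \<in> near E (k + r + k))"
  proof (intro bexI exI conjI)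
    show "f ` Z \<subseteq> Y" using f by blast
  qed (use Y 1 2 in blast)+
qed

text \<open>The heart of the union theorem. Between two visits to \<open>Y\<close> a chain makes an
  excursion of extent at most \<open>D\<close> with a step of length \<open>r\<close> at either end;
  so successive visits are within \<open>D + 2 * r\<close> and form a chain of \<open>Q\<close>. The
  parts before the first and after the last visit cost \<open>D + r\<close> each.\<close>

lemma chain_absorption:
  assumes R: "R \<subseteq> near E r"
    and small: "(R \<inter> (- Y) \<times> (- Y))\<^sup>* \<subseteq> near E D"
    and big: "\<And>x y. x \<in> Y \<Longrightarrow> y \<in> Y \<Longrightarrow> (x, y) \<in> R\<^sup>* \<Longrightarrow> (x, y) \<in> near E (D + 2 * r) \<Longrightarrow> (x, y) \<in> Q"
    and Q: "Q\<^sup>* \<subseteq> near E B"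
  shows "R\<^sup>* \<subseteq> near E (B + 2 * (D + r))"
proof clarify
  fix x y
  let ?S = "R \<inter> (- Y) \<times> (- Y)"
  let ?in = "\<lambda>x u. x = u \<or> (\<exists>x'. (x, x') \<in> ?S\<^sup>* \<and> (x', u) \<in> R)"
  let ?out = "\<lambda>w y. y = w \<or> (y \<notin> Y \<and> (\<exists>y'. (w, y') \<in> R \<and> y' \<notin> Y \<and> (y', y) \<in> ?S\<^sup>*))"
  have S: "(a, b) \<in> near E D \<and> (a, b) \<in> R\<^sup>*" if "(a, b) \<in> ?S\<^sup>*" for a b
    using small that rtrancl_mono[of ?S R] by blast
  have out: "(w, y) \<in> near E (D + r) \<and> (w, y) \<in> R\<^sup>*" if "?out w y" for w y
    using that
  proof
    assume "y \<notin> Y \<and> (\<exists>y'. (w, y') \<in> R \<and> y' \<notin> Y \<and> (y', y) \<in> ?S\<^sup>*)"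
    then obtain y' where "(w, y') \<in> R" "(y', y) \<in> ?S\<^sup>*" by blast
    then have "(w, y') \<in> near E r" "(y', y) \<in> near E D" "(w, y) \<in> R\<^sup>*"
      using S R by (auto intro: converse_rtrancl_into_rtrancl)
    then show ?thesis using near_trans_le[of w y' E r y D "D + r"] by simp
  qed auto
  have into: "(x, u) \<in> near E (D + r)" if "?in x u" for x u
    using that
  proof
    assume "\<exists>x'. (x, x') \<in> ?S\<^sup>* \<and> (x', u) \<in> R"
    then obtain x' where "(x, x') \<in> near E D" "(x', u) \<in> near E r" using S R by blast
    then show ?thesis by (rule near_trans)
  qed auto
  assume "(x, y) \<in> R\<^sup>*"
  \<comment> \<open>Either \<open>Y\<close> has not been met so far, or \<open>u\<close> is the
    first and \<open>w\<close> the latest visit.\<close>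
  then have "(y \<notin> Y \<and> (x, y) \<in> ?S\<^sup>*) \<or> (\<exists>u w. u \<in> Y \<and> w \<in> Y \<and> ?in x u \<and> (u, w) \<in> Q\<^sup>* \<and> ?out w y)"
  proof (induction rule: rtrancl_induct)
    case base
    then show ?case by auto
  next
    case (step y z)
    show ?case using step.IH
    proof
      assume y: "y \<notin> Y \<and> (x, y) \<in> ?S\<^sup>*"
      show ?thesis
      proof (cases "z \<in> Y")
        case True
        then have "?in x z" using y step.hyps by blast
        then show ?thesis using True by blast
      next
        case False
        then have "(y, z) \<in> ?S" using y step.hyps(2) by blast
        then have "(x, z) \<in> ?S\<^sup>*" using y rtrancl.rtrancl_into_rtrancl[of x y ?S z] by blast
        then show ?thesis using False by blast
      qed
    next
      assume "\<exists>u w. u \<in> Y \<and> w \<in> Y \<and> ?in x u \<and> (u, w) \<in> Q\<^sup>* \<and> ?out w y"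
      then obtain u w where uw: "u \<in> Y" "w \<in> Y" "?in x u" "(u, w) \<in> Q\<^sup>*" "?out w y" by blast
      show ?thesis
      proof (cases "z \<in> Y")
        case True
        have "(w, z) \<in> near E (D + 2 * r)" "(w, z) \<in> R\<^sup>*"
          using out[OF uw(5)] step.hyps(2) R near_trans_le[of w y E "D + r" z r]
          by (auto intro: rtrancl.rtrancl_into_rtrancl)
        then have "(w, z) \<in> Q" using big uw True by blast
        then have "(u, z) \<in> Q\<^sup>*" using uw(4) by (rule rtrancl.rtrancl_into_rtrancl[rotated])
        then show ?thesis using uw True by blast
      next
        case False
        have "?out w z"
        proof (cases "y = w")
          case True
          then show ?thesis using False step.hyps(2) by blast
        next
          case neq: False
          then obtain y' where "y \<notin> Y" "(w, y') \<in> R" "y' \<notin> Y" "(y', y) \<in> ?S\<^sup>*" using uw(5) by blast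
          moreover from this have "(y', z) \<in> ?S\<^sup>*"
            using step.hyps(2) False rtrancl.rtrancl_into_rtrancl[of y' y ?S z] by blast
          ultimately show ?thesis using False by blast
        qed
        then show ?thesis using uw by blast
      qed
    qed
  qed
  then show "(x, y) \<in> near E (B + 2 * (D + r))"
  proof
    assume "y \<notin> Y \<and> (x, y) \<in> ?S\<^sup>*"
    then have "(x, y) \<in> near E D" using S by blast
    then show ?thesis by (rule near_mono) simp
  next
    assume "\<exists>u w. u \<in> Y \<and> w \<in> Y \<and> ?in x u \<and> (u, w) \<in> Q\<^sup>* \<and> ?out w y"
    then obtain u w where *: "?in x u" "(u, w) \<in> Q\<^sup>*" "?out w y" by blast
    have uw: "(x, u) \<in> near E (D + r)" "(u, w) \<in> near E B" "(w, y) \<in> near E (D + r)"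
      using into[OF *(1)] subsetD[OF Q *(2)] out[OF *(3)] by simp_all
    show ?thesis
      by (rule near_trans_le[OF near_trans[OF uw(1,2)] uw(3)]) simp
  qed
qed

text \<open>The order of choices matters: the bound \<open>D\<close> for \<open>\<G>\<close> at
  scale \<open>r\<close> fixes the scale \<open>D + 2 * r\<close> at which \<open>\<F>\<close> is
  coloured. As \<open>\<G>\<close> is coloured at the scale \<open>r\<close> only, its members may
  themselves depend on \<open>r\<close>.\<close>

lemma colourable_union:
  assumes "uniform_asdim_le E \<F> n" "colourable E \<G> n r"
    and un: "\<And>Z. Z \<in> \<H> \<Longrightarrow> \<exists>X\<in>\<F>. \<exists>Y\<in>\<G>. Z \<subseteq> X \<union> Y"
  shows "colourable E \<H> n r"
  unfolding colourable_def
proof -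
  obtain D b where b: "\<And>Y x. Y \<in> \<G> \<Longrightarrow> x \<in> Y \<Longrightarrow> b Y x \<le> n"
    and D: "\<And>Y x y. Y \<in> \<G> \<Longrightarrow> (x, y) \<in> (colour_links E Y (b Y) r)\<^sup>* \<Longrightarrow> (x, y) \<in> near E D"
    by (rule colourableE[OF assms(2)]) blast
  obtain B a where a: "\<And>Y x. Y \<in> \<F> \<Longrightarrow> x \<in> Y \<Longrightarrow> a Y x \<le> n"
    and B: "\<And>Y x y. Y \<in> \<F> \<Longrightarrow> (x, y) \<in> (colour_links E Y (a Y) (D + 2 * r))\<^sup>* \<Longrightarrow> (x, y) \<in> near E B"
    by (rule colourableE[OF uniform_asdim_leD[OF assms(1)], where r = "D + 2 * r"]) blast
  show "\<exists>D. \<forall>Z\<in>\<H>. \<exists>c. (\<forall>x\<in>Z. c x \<le> n) \<and> (colour_links E Z c r)\<^sup>* \<subseteq> near E D"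
  proof (rule exI, rule ballI)
    fix Z assume "Z \<in> \<H>"
    then obtain X Y where XY: "X \<in> \<F>" "Y \<in> \<G>" "Z \<subseteq> X \<union> Y" using un by blast
    define c where "c x = (if x \<in> X then a X x else b Y x)" for x
    have "(colour_links E Z c r)\<^sup>* \<subseteq> near E (B + 2 * (D + r))"
    proof (rule chain_absorption[where Y = X and Q = "colour_links E X (a X) (D + 2 * r)"])
      have "colour_links E Z c r \<inter> (- X) \<times> (- X) \<subseteq> colour_links E Y (b Y) r"
        using XY(3) by (auto simp: colour_links_def c_def)
      then show "(colour_links E Z c r \<inter> (- X) \<times> (- X))\<^sup>* \<subseteq> near E D"
        using D[OF XY(2)] by (intro subrelI) (drule (1) subsetD[OF rtrancl_mono], simp)
      show "(x, y) \<in> colour_links E X (a X) (D + 2 * r)"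
        if "x \<in> X" "y \<in> X" "(x, y) \<in> (colour_links E Z c r)\<^sup>*" "(x, y) \<in> near E (D + 2 * r)" for x y
        using that(1,2,4) colour_links_rtrancl[OF that(3)] by (simp add: colour_links_def c_def)
    qed (use B[OF XY(1)] in \<open>auto simp: colour_links_def\<close>)
    moreover have "\<forall>x\<in>Z. c x \<le> n" using XY a b by (auto simp: c_def)
    ultimately show "\<exists>c. (\<forall>x\<in>Z. c x \<le> n) \<and> (colour_links E Z c r)\<^sup>* \<subseteq> near E (B + 2 * (D + r))"
      by blast
  qed
qed

lemma uniform_asdim_le_Un:
  assumes "uniform_asdim_le E \<F> n" "uniform_asdim_le E \<G> n"
  shows "uniform_asdim_le E (\<F> \<union> \<G>) n"
  unfolding uniform_asdim_le_def
proof
  fix r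
  obtain D where D: "\<forall>Y\<in>\<F>. \<exists>c. (\<forall>x\<in>Y. c x \<le> n) \<and> (colour_links E Y c r)\<^sup>* \<subseteq> near E D"
    using uniform_asdim_leD[OF assms(1), of r] unfolding colourable_def by blast
  obtain D' where D': "\<forall>Y\<in>\<G>. \<exists>c. (\<forall>x\<in>Y. c x \<le> n) \<and> (colour_links E Y c r)\<^sup>* \<subseteq> near E D'"
    using uniform_asdim_leD[OF assms(2), of r] unfolding colourable_def by blast
  have "near E D \<subseteq> near E (max D D')" "near E D' \<subseteq> near E (max D D')"
    by (auto intro: near_mono)
  then have "\<forall>Y\<in>\<F> \<union> \<G>. \<exists>c. (\<forall>x\<in>Y. c x \<le> n) \<and> (colour_links E Y c r)\<^sup>* \<subseteq> near E (max D D')"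
    using D D' by (metis Un_iff order_trans)
  then show "colourable E (\<F> \<union> \<G>) n r" unfolding colourable_def by blast
qed

section \<open>Graphs over a rooted forest\<close>

text \<open>Only the shadow of a tree is recorded: arcs stay in a fibre or lead to the fibre of a
  parent or child. Truncated subtraction in \<open>depth_parent\<close> allows a root to have a
  parent of depth \<open>0\<close>.\<close>

locale graph_over_forest =
  fixes E :: "'p rel" and V :: "'p set"
    and node :: "'p \<Rightarrow> 't" and depth :: "'t \<Rightarrow> nat" and parent :: "'t \<Rightarrow> 't"
  assumes sym: "sym E"
    and arc_in_V: "(p, q) \<in> E \<Longrightarrow> p \<in> V"
    and arc_nodes: "(p, q) \<in> E \<Longrightarrow> node p = node q \<or>
      node q = parent (node p) \<and> depth (node p) = Suc (depth (node q)) \<or>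
      node p = parent (node q) \<and> depth (node q) = Suc (depth (node p))"
    and depth_parent: "depth (parent v) = depth v - 1"
begin

text \<open>For \<open>depth v \<le> j\<close> truncated subtraction makes this \<open>v\<close>
  itself.\<close>

definition ancestor :: "nat \<Rightarrow> 't \<Rightarrow> 't" where
  "ancestor j v = (parent ^^ (depth v - j)) v"

text \<open>For the sum graph this is contained in the adhesion set of the edge from
  \<open>v\<close> to its parent. The condition on depths makes the entrance of a root
  empty.\<close>

definition entrance :: "'t \<Rightarrow> 'p set" where
  "entrance v = {p \<in> V. node p = v \<and>
     (\<exists>q. (p, q) \<in> E \<and> node q = parent v \<and> depth v = Suc (depth (node q)))}"

definition trunk :: "'t \<Rightarrow> nat \<Rightarrow> 'p set" where
  "trunk v j = {p \<in> V. depth v \<le> depth (node p) \<and> depth (node p) < depth v + j \<and>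
     ancestor (depth v) (node p) = v}"

lemma near_symD: "(p, q) \<in> near E r \<Longrightarrow> (q, p) \<in> near E r"
  using near_sym[OF sym] .

lemma ancestor_self: "depth v \<le> j \<Longrightarrow> ancestor j v = v"
  by (simp add: ancestor_def)

lemma ancestor_parent: "j < depth v \<Longrightarrow> ancestor j (parent v) = ancestor j v"
proof -
  assume "j < depth v"
  then obtain k where k: "depth v - j = Suc k" by (metis Suc_diff_Suc)
  then have "depth v - 1 - j = k" by simp
  then show ?thesis by (simp add: ancestor_def depth_parent k funpow_swap1)
qed

lemma depth_funpow_parent: "depth ((parent ^^ k) v) = depth v - k"
  by (induction k) (simp_all add: depth_parent)

lemma depth_ancestor: "j \<le> depth v \<Longrightarrow> depth (ancestor j v) = j"
  by (simp add: ancestor_def depth_funpow_parent)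

lemma ancestor_ancestor: "i \<le> j \<Longrightarrow> ancestor i (ancestor j v) = ancestor i v"
proof (cases "j \<le> depth v")
  case True
  assume "i \<le> j"
  with True have "(j - i) + (depth v - j) = depth v - i" by simp
  then show ?thesis
    unfolding ancestor_def[of i] depth_ancestor[OF True] unfolding ancestor_def[of j]
    by (metis comp_apply funpow_add)
next
  case False
  then show ?thesis by (simp add: ancestor_self)
qed

lemma entranceD: "z \<in> entrance v \<Longrightarrow> z \<in> V \<and> node z = v \<and> 0 < depth v"
  by (auto simp: entrance_def)

lemma arc_ancestor:
  assumes "(p, q) \<in> E" "j \<le> depth (node p)"
  shows "(j \<le> depth (node q) \<and> ancestor j (node q) = ancestor j (node p)) \<or>
    p \<in> entrance (ancestor j (node p))"
  using arc_nodes[OF assms(1)]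
proof (elim disjE)
  assume *: "node q = parent (node p) \<and> depth (node p) = Suc (depth (node q))"
  show ?thesis
  proof (cases "j < depth (node p)")
    case True
    then show ?thesis using * ancestor_parent[of j "node p"] by auto
  next
    case False
    then have "ancestor j (node p) = node p" by (simp add: ancestor_self)
    then show ?thesis using * assms(1) arc_in_V by (auto simp: entrance_def)
  qed
next
  assume *: "node p = parent (node q) \<and> depth (node q) = Suc (depth (node p))"
  then show ?thesis using assms(2) ancestor_parent[of j "node q"] by auto
qed (use assms(2) in simp)

text \<open>The first arc that leaves the subtree below an ancestor starts in the entrance of that
  ancestor. All separation properties of siblings rest on this.\<close>

lemma leaves_subtree_through_entrance:
  assumes "(p, q) \<in> near E r" "j \<le> depth (node p)"
  shows "(j \<le> depth (node q) \<and> ancestor j (node q) = ancestor j (node p)) \<or>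
    (\<exists>z\<in>entrance (ancestor j (node p)). (p, z) \<in> near E r)"
  using assms(1)
proof (induction r arbitrary: q)
  case 0
  then show ?case using assms(2) by simp
next
  case (Suc r)
  then obtain z where z: "(p, z) \<in> near E r" "z = q \<or> (z, q) \<in> E" by (auto simp: near_Suc)
  from Suc.IH[OF z(1)] show ?case
  proof
    assume *: "j \<le> depth (node z) \<and> ancestor j (node z) = ancestor j (node p)"
    from z(2) show ?thesis
    proof
      assume "(z, q) \<in> E"
      then show ?thesis using arc_ancestor[of z q j] * z(1) near_mono[of p z E r "Suc r"] by auto
    qed (use * in auto)
  next
    assume "\<exists>z\<in>entrance (ancestor j (node p)). (p, z) \<in> near E r"
    then show ?thesis using near_mono[of p _ E r "Suc r"] by auto
  qed
qed

lemma depth_Lipschitz: "(p, q) \<in> near E r \<Longrightarrow> depth (node p) \<le> depth (node q) + r"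
proof (induction r arbitrary: q)
  case (Suc r)
  then obtain z where z: "(p, z) \<in> near E r" "z = q \<or> (z, q) \<in> E" by (auto simp: near_Suc)
  have "depth (node z) \<le> depth (node q) + 1" using z(2) arc_nodes[of z q] by auto
  then show ?case using Suc.IH[OF z(1)] by simp
qed auto

lemma entrance_parent:
  assumes "z \<in> entrance (node p)" "depth v < depth (node p)" "ancestor (depth v) (node p) = v"
  shows "\<exists>y\<in>trunk v (depth (node p) - depth v). (z, y) \<in> near E 1"
proof -
  obtain y where y: "(z, y) \<in> E" "node y = parent (node p)" "depth (node p) = Suc (depth (node y))"
    using assms(1) by (auto simp: entrance_def)
  have "y \<in> V" using y(1) arc_in_V sym by (meson symD)
  moreover have "ancestor (depth v) (node y) = v" using assms y ancestor_parent by simp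
  ultimately have "y \<in> trunk v (depth (node p) - depth v)" using assms(2) y(3) by (simp add: trunk_def)
  then show ?thesis using near_arc[OF y(1)] by blast
qed

context
  fixes n
  assumes fibres: "uniform_asdim_le E (range (\<lambda>v. {p \<in> V. node p = v})) n"
begin

text \<open>Induction on the number of levels with the union theorem. A neighbourhood of the upper
  levels is set apart; on the rest of the new level, points in different fibres are more than
  \<open>r\<close> apart, because a walk between them would pass an entrance, and entrances are
  adjacent to the trunk above.\<close>

lemma uniform_asdim_le_trunks: "uniform_asdim_le E (range (\<lambda>v. trunk v j)) n"
proof (induction j)
  case 0
  then show ?case by (intro uniform_asdim_le_nearby[OF fibres sym]) (auto simp: trunk_def)
next
  case (Suc j)
  show ?case
  \<comment> \<open>A single level lies in one fibre. For more levels, the parents of the bottom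
    level belong to the trunk, which the separation argument uses.\<close>
  proof (cases j)
    case 0
    show ?thesis
    proof (rule uniform_asdim_le_nearby[OF fibres sym, where k = 0])
      fix Z assume "Z \<in> range (\<lambda>v. trunk v (Suc j))"
      then obtain v where Z: "Z = trunk v (Suc j)" by blast
      have "Z \<subseteq> {p \<in> V. node p = v}"
        using ancestor_self by (auto simp: Z 0 trunk_def)
      then show "\<exists>Y\<in>range (\<lambda>v. {p \<in> V. node p = v}). \<forall>x\<in>Z. \<exists>y\<in>Y. (x, y) \<in> near E 0"
        by (intro bexI[of _ "{p \<in> V. node p = v}"]) auto
    qed
  next
    case (Suc i)
    show ?thesis unfolding uniform_asdim_le_def
    proof
      fix r
      \<comment> \<open>\<open>Suc r\<close> allows for \<open>r\<close> steps to an entrance and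
        one more into the fibre of the parent.\<close>
      define core where "core v = {p. \<exists>y\<in>trunk v j. (p, y) \<in> near E (Suc r)}" for v
      define rest where "rest v = trunk v (Suc j) - core v" for v
      have core: "uniform_asdim_le E (range core) n"
        by (rule uniform_asdim_le_nearby[OF Suc.IH sym, where k = "Suc r"]) (auto simp: core_def)
      have depth_rest: "depth (node p) = depth v + j" if "p \<in> rest v" for p v
      proof -
        have "p \<notin> trunk v j" using that by (auto simp: rest_def core_def)
        then show ?thesis using that by (auto simp: rest_def trunk_def)
      qed
      have rest: "colourable E (range rest) n r"
      proof (rule colourable_separated[OF uniform_asdim_leD[OF fibres]])
        fix Z assume "Z \<in> range rest"
        then obtain v where Z: "Z = rest v" by blast
        have "node p = node q" if pq: "p \<in> Z" "q \<in> Z" "(p, q) \<in> near E r" for p q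
        proof (rule ccontr)
          assume neq: "node p \<noteq> node q"
          have d: "depth (node p) = depth v + j" "depth (node q) = depth v + j"
            using depth_rest pq Z by auto
          obtain z where z: "z \<in> entrance (node p)" "(p, z) \<in> near E r"
            using leaves_subtree_through_entrance[OF pq(3), of "depth v + j"] neq d
            by (auto simp: ancestor_self)
          obtain y where "y \<in> trunk v (depth (node p) - depth v)" "(z, y) \<in> near E 1"
            using entrance_parent[OF z(1), of v] pq(1) d Suc Z by (auto simp: rest_def trunk_def)
          then have "p \<in> core v"
            using near_trans_le[OF z(2), of y 1 "Suc r"] d by (auto simp: core_def)
          then show False using pq(1) Z by (simp add: rest_def)
        qed
        moreover have "\<forall>p\<in>Z. p \<in> V" using Z by (auto simp: rest_def trunk_def)
        ultimately show "\<exists>g. (\<forall>x\<in>Z. x \<in> {p \<in> V. node p = g x}) \<and>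
            (\<forall>x\<in>Z. \<forall>y\<in>Z. (x, y) \<in> near E r \<longrightarrow> g x = g y)"
          by (intro exI[of _ node] conjI) blast+
      qed
      show "colourable E (range (\<lambda>v. trunk v (Suc j))) n r"
        by (rule colourable_union[OF core rest]) (auto simp: rest_def)
    qed
  qed
qed

context
  fixes m
  assumes entrances: "uniform_asdim_le E (range entrance) m" and m_less: "m < n"
begin

text \<open>The cuts are at distance \<open>t\<close> from the entrances on levels divisible by
  \<open>L\<close>. \<open>Band\<close> is the zone of half-width \<open>T\<close> around all cuts,
  and a \<open>Piece\<close> is what lies between a cut and the cuts of the next generation.\<close>

theorem uniform_asdim_le_graph_over_forest: "uniform_asdim_le E {V} n"
  unfolding uniform_asdim_le_def
proof
  fix r
  \<comment> \<open>\<open>s\<close> exceeds the length of a step. \<open>T\<close> has room for the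
    thresholds \<open>(k + 1) * s\<close> of the colours \<open>k \<le> m\<close> and for one more
    layer. \<open>t\<close> keeps the band further than \<open>r\<close> from the entrance,
    \<open>M\<close> is the far end of the band, and \<open>L\<close> keeps it more than
    \<open>r\<close> levels above the next level of cuts.\<close>
  define s where "s = Suc r"
  define T where "T = (m + 2) * s"
  define t where "t = T + r + 1"
  define M where "M = t + T"
  define L where "L = M + r + 1"
  have L: "L > 0" "M + r < L" "r < M" "t \<le> M" "r < t" "s \<le> T" "s \<le> t" "r < s"
    by (simp_all add: L_def M_def t_def s_def T_def)
  define level where "level p = L * (depth (node p) div L)" for p
  define top where "top p = ancestor (level p) (node p)" for p
  \<comment> \<open>If \<open>level p = 0\<close>, the entrance is empty and \<open>h p = M\<close>,
    so that \<open>p\<close> counts as lying beyond its cut.\<close>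
  define h where "h p = gap E M (entrance (top p)) p" for p
  \<comment> \<open>The absolute difference of \<open>h p\<close> and \<open>t\<close>: one of the
    truncated differences vanishes.\<close>
  define off where "off p = (h p - t) + (t - h p)" for p
  \<comment> \<open>A point that is not yet beyond its cut still belongs to the previous generation,
    \<open>L\<close> levels up.\<close>
  define piece where
    "piece p = (if t \<le> h p then top p else ancestor (level p - L) (node p))" for p

  have level: "level p \<le> depth (node p)" "depth (node p) < level p + L" for p
    using mod_less_divisor[OF L(1), of "depth (node p)"] mult_div_mod_eq[of L "depth (node p)"]
    unfolding level_def by linarith+
  have level_mono: "level q \<le> level p" if "level q \<le> depth (node p)" for p q
  proof -
    have "depth (node q) div L \<le> depth (node p) div L"
      using that L(1) unfolding level_def by (metis div_le_mono nonzero_mult_div_cancel_left less_numeral_extra(3))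
    then show ?thesis by (simp add: level_def)
  qed
  have depth_top: "depth (top p) = level p" for p
    using level(1) by (simp add: top_def depth_ancestor)
  have h_le: "h p \<le> M" for p by (simp add: h_def gap_le_cap)
  have h_reach: "\<exists>z\<in>entrance (top p). (p, z) \<in> near E (h p)" if "h p < M" for p
    using gap_attained[of E M "entrance (top p)" p] that by (simp add: h_def)
  have h_close: "h p \<le> k" if "z \<in> entrance (top p)" "(p, z) \<in> near E k" for p z k
    using gap_le[OF that] by (simp add: h_def)
  have h_Lipschitz: "h p \<le> h q + r" if "(p, q) \<in> near E r" "top p = top q" for p q
    using gap_Lipschitz[OF that(1)] that(2) by (simp add: h_def)
  \<comment> \<open>\<open>p\<close> is not below \<open>top q\<close>, so a walk from
    \<open>q\<close> to \<open>p\<close> passes the entrance of \<open>top q\<close>.\<close>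
  have h_small: "h q \<le> r" if pq: "(p, q) \<in> near E r" and top: "top p \<noteq> top q" and le: "level p \<le> level q" for p q
  proof -
    have "\<not> (level q \<le> depth (node p) \<and> ancestor (level q) (node p) = top q)"
      using le top level_mono[of q p] by (auto simp: top_def)
    then show ?thesis
      using leaves_subtree_through_entrance[OF near_symD[OF pq] level(1)] h_close
      by (fastforce simp: top_def)
  qed
  \<comment> \<open>Here \<open>p\<close> lies at least \<open>L - r = M + 1\<close> levels below
    its top, which puts it beyond the reach \<open>M\<close> of the entrance.\<close>
  have descend: "h p = M \<and> level q = level p + L \<and> top p = ancestor (level p) (node q)"
    if pq: "(p, q) \<in> near E r" and less: "level p < level q" for p q
  proof -
    have d: "depth (node q) \<le> depth (node p) + r"
      using depth_Lipschitz[OF near_symD[OF pq]] .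
    have "level q < level p + 2 * L"
      using d level[of p] level[of q] L by linarith
    moreover obtain i j where ij: "level p = L * i" "level q = L * j" by (auto simp: level_def)
    ultimately have "L * i < L * j" "L * j < L * (i + 2)" using less by (simp_all add: algebra_simps)
    then have "i < j" "j < i + 2" unfolding nat_mult_less_cancel_disj by blast+
    then have "j = Suc i" by simp
    then have q: "level q = level p + L" using ij by simp
    have hp: "h p = M"
    proof (rule ccontr)
      assume "h p \<noteq> M"
      then have "h p < M" using h_le[of p] by simp
      then obtain z where z: "z \<in> entrance (top p)" "(p, z) \<in> near E (h p)" using h_reach by blast
      have "depth (node p) \<le> level p + h p"
        using depth_Lipschitz[OF z(2)] entranceD[OF z(1)] depth_top[of p] by simp
      then show False using d \<open>h p < M\<close> level(1)[of q] q L by linarith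
    qed
    moreover have "top p = ancestor (level p) (node q)"
    proof (rule ccontr)
      assume "\<not> ?thesis"
      then obtain z where "z \<in> entrance (top p)" "(p, z) \<in> near E r"
        using leaves_subtree_through_entrance[OF pq level(1)] by (auto simp: top_def)
      then show False using h_close hp L by fastforce
    qed
    ultimately show ?thesis using q by simp
  qed
  have piece_less: "piece p = piece q"
    if pq: "(p, q) \<in> near E r" and less: "level p < level q" for p q
  proof -
    have "top p \<noteq> top q" using less depth_top by (metis less_irrefl)
    then have "h q \<le> r" using h_small[OF pq] less by simp
    then show ?thesis using descend[OF pq less] L by (simp add: piece_def)
  qed
  \<comment> \<open>With the same top, a step is too short to cross the cut. With different tops on
    one level, both points are still before their cuts, and they share the ancestor \<open>L\<close>
    levels up, because a step is too short to reach its entrance.\<close>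
  have piece_eq: "piece p = piece q"
    if pq: "(p, q) \<in> near E r" and off: "s \<le> off p" "s \<le> off q" for p q
  proof (rule linorder_cases[of "level p" "level q"])
    assume lev: "level p = level q"
    show ?thesis
    proof (cases "top p = top q")
      case True
      have "h p \<le> h q + r" "h q \<le> h p + r"
        using h_Lipschitz pq near_symD[OF pq] True by simp_all
      then have "t \<le> h p \<longleftrightarrow> t \<le> h q" using off L unfolding off_def by linarith
      moreover have "ancestor (level p - L) (node p) = ancestor (level q - L) (node q)"
        using True lev ancestor_ancestor[of "level p - L" "level p"] unfolding top_def
        by (metis diff_le_self)
      ultimately show ?thesis using True by (simp add: piece_def)
    next
      case False
      then have h: "h p \<le> r" "h q \<le> r"
        using h_small pq near_symD[OF pq] lev by (metis order_refl)+
      have "ancestor (level p - L) (node q) = ancestor (level p - L) (node p)"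
      proof (rule ccontr)
        assume *: "\<not> ?thesis"
        have "level p - L \<le> depth (node p)" using level(1)[of p] by simp
        then obtain z where z: "z \<in> entrance (ancestor (level p - L) (node p))" "(p, z) \<in> near E r"
          using leaves_subtree_through_entrance[OF pq] * by blast
        have "depth (node z) = level p - L" "0 < level p - L"
          using entranceD[OF z(1)] level(1)[of p] by (auto simp: depth_ancestor)
        then show False using depth_Lipschitz[OF z(2)] level(1)[of p] L by linarith
      qed
      then show ?thesis using h lev L by (simp add: piece_def)
    qed
  qed (use piece_less pq near_symD[OF pq] in metis)+

  define Band where "Band = {p \<in> V. off p < T}"
  have band_top: "top p = top q" if pq: "(p, q) \<in> near E r" and "off p < T" for p q
  proof (rule ccontr)
    assume neq: "top p \<noteq> top q"
    have hp: "r < h p" "h p < M" using \<open>off p < T\<close> by (auto simp: off_def t_def M_def)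
    show False
    proof (cases "level q \<le> level p")
      case True
      then show False using h_small[OF near_symD[OF pq]] neq hp by fastforce
    next
      case False
      then show False using descend[OF pq] hp by simp
    qed
  qed
  \<comment> \<open>Nearby points of the band have the same top, so it is enough to colour the part
    below one top, which stays within \<open>M\<close> of one entrance. This is where the dimension
    \<open>m\<close> of the entrances enters.\<close>
  have "colourable E {Band} m r"
  proof (rule colourable_separated[OF uniform_asdim_leD])
    show "uniform_asdim_le E (range (\<lambda>v. {p \<in> Band. top p = v})) m"
    proof (rule uniform_asdim_le_nearby[OF entrances sym, where k = M])
      fix Z assume "Z \<in> range (\<lambda>v. {p \<in> Band. top p = v})"
      then obtain v where Z: "Z = {p \<in> Band. top p = v}" by blast
      have "\<exists>y\<in>entrance v. (p, y) \<in> near E M" if "p \<in> Z" for p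
      proof -
        have "h p < M" "top p = v" using that Z by (auto simp: Band_def off_def M_def)
        then obtain z where "z \<in> entrance v" "(p, z) \<in> near E (h p)" using h_reach[of p] by blast
        then show ?thesis by (intro bexI[of _ z] near_mono[of p z E "h p" M] h_le)
      qed
      then show "\<exists>Y\<in>range entrance. \<forall>x\<in>Z. \<exists>y\<in>Y. (x, y) \<in> near E M" by blast
    qed
    show "\<exists>g. (\<forall>x\<in>Z. x \<in> {p \<in> Band. top p = g x}) \<and>
        (\<forall>x\<in>Z. \<forall>y\<in>Z. (x, y) \<in> near E r \<longrightarrow> g x = g y)" if "Z \<in> {Band}" for Z
      using that band_top by (intro exI[of _ top] conjI ballI impI) (auto simp: Band_def)
  qed
  then obtain D b' where b': "\<And>Y x. Y \<in> {Band} \<Longrightarrow> x \<in> Y \<Longrightarrow> b' Y x \<le> m"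
    and D': "\<And>Y x y. Y \<in> {Band} \<Longrightarrow> (x, y) \<in> (colour_links E Y (b' Y) r)\<^sup>* \<Longrightarrow> (x, y) \<in> near E D"
    by (rule colourableE) blast
  define b where "b = b' Band"
  have b: "b p \<le> m" if "p \<in> V" "off p < T" for p
    using b'[of Band p] that by (simp add: b_def Band_def)
  have D: "(p, q) \<in> (colour_links E Band b r)\<^sup>* \<Longrightarrow> (p, q) \<in> near E D" for p q
    using D'[of Band p q] by (simp add: b_def)

  define Piece where "Piece w = {p \<in> V. piece p = w}" for w
  \<comment> \<open>\<open>Suc L\<close> levels, since a point before its cut is close to an
    entrance at depth \<open>depth w + L\<close>.\<close>
  have "uniform_asdim_le E (range Piece) n"
  proof (rule uniform_asdim_le_nearby[OF uniform_asdim_le_trunks[of "Suc L"] sym, where k = t])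
    fix Z assume "Z \<in> range Piece"
    then obtain w where Z: "Z = Piece w" by blast
    have "\<exists>y\<in>trunk w (Suc L). (p, y) \<in> near E t" if "p \<in> Z" for p
    proof -
      have p: "p \<in> V" "piece p = w" using that Z by (auto simp: Piece_def)
      show ?thesis
      proof (cases "t \<le> h p")
        case True
        then have w: "w = ancestor (level p) (node p)" "depth w = level p"
          using p depth_top by (auto simp: piece_def top_def)
        then have "p \<in> trunk w (Suc L)"
          using p level[of p] by (auto simp: trunk_def)
        then show ?thesis by blast
      next
        case False
        then have w: "w = ancestor (level p - L) (node p)" using p by (simp add: piece_def)
        then have dw: "depth w = level p - L" using level(1)[of p] by (simp add: depth_ancestor)
        obtain z where z: "z \<in> entrance (top p)" "(p, z) \<in> near E (h p)"
          using h_reach[of p] False L by auto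
        have zV: "z \<in> V" "node z = top p" "0 < level p"
          using entranceD[OF z(1)] depth_top[of p] by auto
        then have "L \<le> level p" by (auto simp: level_def)
        moreover have "ancestor (level p - L) (node z) = w"
          unfolding zV(2) top_def w by (rule ancestor_ancestor) simp
        ultimately have "z \<in> trunk w (Suc L)"
          using zV depth_top[of p] dw by (simp add: trunk_def)
        moreover have "(p, z) \<in> near E t" using z(2) False by (simp add: near_mono)
        ultimately show ?thesis by blast
      qed
    qed
    then show "\<exists>Y\<in>range (\<lambda>v. trunk v (Suc L)). \<forall>x\<in>Z. \<exists>y\<in>Y. (x, y) \<in> near E t" by blast
  qed
  \<comment> \<open>The scale \<open>D + 2 * r\<close> is the one that
    \<open>chain_absorption\<close> demands when excursions into the band have extent
    \<open>D\<close>.\<close>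
  then obtain B a' where a': "\<And>Y x. Y \<in> range Piece \<Longrightarrow> x \<in> Y \<Longrightarrow> a' Y x \<le> n"
    and B': "\<And>Y x y. Y \<in> range Piece \<Longrightarrow> (x, y) \<in> (colour_links E Y (a' Y) (D + 2 * r))\<^sup>* \<Longrightarrow>
      (x, y) \<in> near E B"
    by (rule colourableE[OF uniform_asdim_leD, where r = "D + 2 * r"]) blast
  define a where "a w = a' (Piece w)" for w
  have a: "a (piece p) p \<le> n" if "p \<in> V" for p
    using a'[of "Piece (piece p)" p] that by (simp add: a_def Piece_def)
  have B: "(p, q) \<in> (colour_links E (Piece w) (a w) (D + 2 * r))\<^sup>* \<Longrightarrow> (p, q) \<in> near E B" for p q w
    using B'[of "Piece w" p q] by (simp add: a_def)

  text \<open>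
    At offset \<open>(k + 1) * s\<close> from the cut, colour \<open>k\<close> of the band changes to \<open>k - 1\<close>, and \<open>0\<close> to the
    additional colour \<open>m + 1\<close>. Colour \<open>k - 1\<close> has been given up at \<open>k * s\<close>, so no chain connects the
    two, and the sets recoloured lie on one side of the cut.
  \<close>
  define core where "core p \<longleftrightarrow> off p < T \<and> off p < (b p + 1) * s" for p
  define c where "c p = (if T \<le> off p then a (piece p) p else if core p then b p
    else if b p = 0 then m + 1 else b p - 1)" for p
  let ?R = "colour_links E V c r"
  let ?R' = "?R \<inter> {p. \<not> core p} \<times> {p. \<not> core p}"
  \<comment> \<open>If \<open>q\<close> were outside the core with the same colour, its band colour
    would be \<open>b p + 1\<close>, as \<open>m + 1\<close> is excluded by
    \<open>b p \<le> m\<close>. Its offset would be at least \<open>(b p + 2) * s\<close>, too far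
    from an offset below \<open>(b p + 1) * s\<close> for one step.\<close>
  have core_step: "core q \<and> (p, q) \<in> colour_links E Band b r"
    if pq: "(p, q) \<in> ?R" and p: "core p" for p q
  proof -
    have V: "p \<in> V" "q \<in> V" "c p = c q" "(p, q) \<in> near E r" using pq by (auto simp: colour_links_def)
    have band: "off p < T" using p by (simp add: core_def)
    have top: "top p = top q" using band_top[OF V(4) band] .
    have "h p \<le> h q + r" "h q \<le> h p + r"
      using h_Lipschitz V(4) near_symD[OF V(4)] top by simp_all
    then have off: "off q \<le> off p + r" unfolding off_def by linarith
    have cp: "c p = b p" using p band by (simp add: c_def)
    have p_off: "off p < (b p + 1) * s" using p by (simp add: core_def)
    have off_q: "off q < (b p + 1) * s + s" using p_off off L by linarith
    also have "\<dots> = (b p + 2) * s" by simp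
    finally have q_off: "off q < (b p + 2) * s" .
    \<comment> \<open>The additional layer in \<open>T\<close>: even from the core of colour
      \<open>m\<close> a step does not lead out of the band.\<close>
    have "(b p + 2) * s \<le> T" unfolding T_def using b[OF V(1) band] by (intro mult_right_mono) auto
    then have q_band: "off q < T" using q_off by simp
    have "core q"
    proof (rule ccontr)
      assume nc: "\<not> core q"
      then have cq: "c q = (if b q = 0 then m + 1 else b q - 1)" using q_band by (simp add: c_def)
      have "b p \<le> m" using b[OF V(1) band] .
      then have bq: "b q = b p + 1" using cq cp V(3) by (auto split: if_splits)
      have "(b q + 1) * s \<le> off q" using nc q_band by (simp add: core_def)
      then show False using q_off bq by simp
    qed
    moreover have "c q = b q" using \<open>core q\<close> q_band by (simp add: c_def)
    ultimately show ?thesis using V cp band q_band by (simp add: colour_links_def Band_def)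
  qed
  have R_sym: "(q, p) \<in> ?R" if "(p, q) \<in> ?R" for p q
    using that near_symD by (auto simp: colour_links_def)
  have noncore_step: "(p, q) \<in> ?R'" if "(p, q) \<in> ?R" "\<not> core p" for p q
    using that core_step[OF R_sym[OF that(1)]] by auto
  have noncore_off: "s \<le> off p" if "\<not> core p" for p
  proof (cases "off p < T")
    case True
    then have "(b p + 1) * s \<le> off p" using that by (simp add: core_def)
    then show ?thesis by simp
  qed (use L in simp)
  have piece_chain: "piece p = piece q" if "(p, q) \<in> ?R'\<^sup>*" for p q
    using that
  proof (induction rule: rtrancl_induct)
    case (step y z)
    then show ?case using piece_eq[of y z] noncore_off by (auto simp: colour_links_def)
  qed simp
  have R'_c: "c p = c q" if "(p, q) \<in> ?R'\<^sup>*" for p q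
    using that by (induction rule: rtrancl_induct) (auto simp: colour_links_def)
  \<comment> \<open>Outside the core a chain stays in one piece. So \<open>Q\<close> can demand
    equal pieces, and the colourings of different pieces do not interact although the pieces may be
    close to each other.\<close>
  have "?R'\<^sup>* \<subseteq> near E (B + 2 * (D + r))"
  proof (rule chain_absorption[where Y = "{p \<in> V. T \<le> off p}" and
        Q = "{(p, q). piece p = piece q \<and> (p, q) \<in> colour_links E (Piece (piece p)) (a (piece p)) (D + 2 * r)}"])
    show "?R' \<subseteq> near E r" by (auto simp: colour_links_def)
    let ?Y = "{p \<in> V. T \<le> off p}"
    have "?R' \<inter> (- ?Y) \<times> (- ?Y) \<subseteq> colour_links E Band b r"
    proof (rule subrelI)
      fix p q assume "(p, q) \<in> ?R' \<inter> (- ?Y) \<times> (- ?Y)"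
      then have V: "p \<in> V" "q \<in> V" "c p = c q" "(p, q) \<in> near E r" "\<not> core p" "\<not> core q"
        and band: "off p < T" "off q < T"
        by (auto simp: colour_links_def)
      \<comment> \<open>The recolouring is injective: \<open>0\<close> becomes \<open>m + 1\<close>
        and every other colour drops by one.\<close>
      have "b p = b q"
        using V band b[OF V(1) band(1)] b[OF V(2) band(2)] by (auto simp: c_def split: if_splits)
      then show "(p, q) \<in> colour_links E Band b r" using V band by (simp add: colour_links_def Band_def)
    qed
    then have "(?R' \<inter> (- ?Y) \<times> (- ?Y))\<^sup>* \<subseteq> (colour_links E Band b r)\<^sup>*" by (rule rtrancl_mono)
    then show "(?R' \<inter> (- ?Y) \<times> (- ?Y))\<^sup>* \<subseteq> near E D" using D by auto
  next
    fix p q assume *: "p \<in> {p \<in> V. T \<le> off p}" "q \<in> {p \<in> V. T \<le> off p}"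
      "(p, q) \<in> ?R'\<^sup>*" "(p, q) \<in> near E (D + 2 * r)"
    then show "(p, q) \<in> {(p, q). piece p = piece q \<and>
        (p, q) \<in> colour_links E (Piece (piece p)) (a (piece p)) (D + 2 * r)}"
      using piece_chain[OF *(3)] R'_c[OF *(3)] by (auto simp: c_def colour_links_def Piece_def)
  next
    let ?Q = "{(p, q). piece p = piece q \<and>
      (p, q) \<in> colour_links E (Piece (piece p)) (a (piece p)) (D + 2 * r)}"
    have "piece p = piece q \<and> (p, q) \<in> (colour_links E (Piece (piece p)) (a (piece p)) (D + 2 * r))\<^sup>*"
      if "(p, q) \<in> ?Q\<^sup>*" for p q
      using that
    proof (induction rule: rtrancl_induct)
      case (step y z)
      then show ?case by (auto intro: rtrancl.rtrancl_into_rtrancl)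
    qed simp
    then show "?Q\<^sup>* \<subseteq> near E B" using B by (intro subrelI) blast
  qed
  have core_chain: "core q \<and> (p, q) \<in> (colour_links E Band b r)\<^sup>*" if "(p, q) \<in> ?R\<^sup>*" "core p" for p q
    using that(1)
  proof (induction rule: rtrancl_induct)
    case (step y z)
    then show ?case using core_step[of y z] by (auto intro: rtrancl.rtrancl_into_rtrancl)
  qed (use that in simp)
  have noncore_chain: "\<not> core q \<and> (p, q) \<in> ?R'\<^sup>*" if "(p, q) \<in> ?R\<^sup>*" "\<not> core p" for p q
    using that(1)
  proof (induction rule: rtrancl_induct)
    case (step y z)
    then have "(y, z) \<in> ?R'" using noncore_step by blast
    then show ?case using step.IH rtrancl.rtrancl_into_rtrancl[of p y ?R' z] by blast
  qed (use that in simp)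
  have "(p, q) \<in> near E (B + 2 * (D + r))" if "(p, q) \<in> ?R\<^sup>*" for p q
  proof (cases "core p")
    case True
    then have "(p, q) \<in> near E D" using core_chain[OF that] D by blast
    then show ?thesis by (rule near_mono) simp
  next
    case False
    then show ?thesis
      using noncore_chain[OF that] subsetD[OF \<open>?R'\<^sup>* \<subseteq> near E (B + 2 * (D + r))\<close>] by blast
  qed
  then have "?R\<^sup>* \<subseteq> near E (B + 2 * (D + r))" by (intro subrelI)
  moreover have "\<forall>p\<in>V. c p \<le> n"
  proof
    fix p assume p: "p \<in> V"
    show "c p \<le> n"
    proof (cases "T \<le> off p")
      case False
      then have "b p \<le> m" using b[OF p] by simp
      then show ?thesis using m_less False by (auto simp: c_def)
    qed (use a[OF p] in \<open>simp add: c_def\<close>)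
  qed
  ultimately show "colourable E {V} n r" unfolding colourable_def by blast
qed

end

end

end

section \<open>Covers and colourings\<close>

text \<open>Pigeonhole: at most \<open>N - 1\<close> elements other than \<open>u\<close> cannot
  occupy all \<open>N\<close> intervals from \<open>j * s\<close> to \<open>(j + 1) * s\<close> with
  \<open>j < N\<close>. The elements above a free interval form \<open>\<sigma>\<close>.\<close>

lemma ex_gap_in_values:
  fixes f :: "'b \<Rightarrow> nat"
  assumes "finite S" "card S \<le> N" "u \<in> S" "N * s \<le> f u" "0 < s"
  shows "\<exists>\<sigma>\<subseteq>S. u \<in> \<sigma> \<and> (\<forall>x\<in>\<sigma>. s \<le> f x) \<and> (\<forall>x\<in>\<sigma>. \<forall>y\<in>S - \<sigma>. f y + s \<le> f x)"
proof -
  have "card ((\<lambda>x. f x div s) ` (S - {u})) \<le> card (S - {u})"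
    using assms(1) by (intro card_image_le) simp
  also have "\<dots> < card {..<N}"
    using assms(2,3) card_gt_0_iff[of S] assms(1) by (auto simp: card_Diff_singleton)
  finally obtain j where j: "j < N" "j \<notin> (\<lambda>x. f x div s) ` (S - {u})"
    using assms(1) by (metis card_mono finite_Diff finite_imageI lessThan_iff not_le subsetI)
  let ?\<sigma> = "{x \<in> S. (j + 1) * s \<le> f x}"
  have "(j + 1) * s \<le> N * s" using j(1) by (intro mult_right_mono) auto
  then have u: "u \<in> ?\<sigma>" using assms(3,4) by simp
  have "f y + s \<le> f x" if "x \<in> ?\<sigma>" "y \<in> S - ?\<sigma>" for x y
  proof -
    have "f y < (j + 1) * s" "f y div s \<noteq> j" using that(2) u j(2) by auto
    then have "f y div s < j + 1" using assms(5) by (simp add: div_less_iff_less_mult)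
    then have "f y div s < j" using \<open>f y div s \<noteq> j\<close> by simp
    then have "f y < j * s" using assms(5) by (simp add: div_less_iff_less_mult)
    then show ?thesis using that(1) by simp
  qed
  then show ?thesis using u by (intro exI[of _ ?\<sigma>]) auto
qed

text \<open>\<open>X\<close> may be a set of vertices with the restricted metric, such as an
  adhesion set; walks counted by \<open>near E\<close> may leave it. By \<open>discrete\<close>
  every subset of \<open>X\<close> is open.\<close>

locale discrete_dist =
  fixes X :: "'a set" and d :: "'a \<Rightarrow> 'a \<Rightarrow> ereal" and E :: "'a rel"
  assumes sym: "sym E"
    and dist_le: "x \<in> X \<Longrightarrow> y \<in> X \<Longrightarrow> d x y \<le> ereal (real r) \<longleftrightarrow> (x, y) \<in> near E r"
    and discrete: "x \<in> X \<Longrightarrow> y \<in> X \<Longrightarrow> d x y < 1 \<Longrightarrow> x = y"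
begin

lemma open_in_iff: "open_in X d V \<longleftrightarrow> V \<subseteq> X"
proof
  assume V: "V \<subseteq> X"
  have "\<forall>y\<in>X. d x y < ereal 1 \<longrightarrow> y \<in> V" if "x \<in> V" for x
    using discrete[of x] V that by (auto simp: one_ereal_def)
  then show "open_in X d V"
    unfolding open_in_def using V zero_less_one by blast
qed (simp add: open_in_def)

lemma dist_le_real: "x \<in> X \<Longrightarrow> y \<in> X \<Longrightarrow> d x y \<le> ereal B \<Longrightarrow> (x, y) \<in> near E (nat \<lceil>B\<rceil>)"
proof -
  assume xy: "x \<in> X" "y \<in> X"
  assume "d x y \<le> ereal B"
  also have "ereal B \<le> ereal (real (nat \<lceil>B\<rceil>))" by (simp add: real_nat_ceiling_ge)
  finally show ?thesis using dist_le[OF xy] by blast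
qed

text \<open>The idea is the barycentric subdivision of the nerve of a cover with large Lebesgue
  number: \<open>\<sigma> x\<close> consists of the members in which \<open>x\<close> lies
  distinctly deeper than in all others, and the colour is the dimension of the simplex
  \<open>\<sigma> x\<close>.\<close>

lemma colourable_if_asdim_le:
  assumes "asdim_le X d n"
  shows "colourable E {X} n r"
proof -
  define s where "s = Suc r"
  \<comment> \<open>The pigeonhole lemma for at most \<open>n + 1\<close> members with gaps of size
    \<open>s\<close> asks for one member in which the point has depth
    \<open>(n + 1) * s\<close>.\<close>
  define lam where "lam = (n + 1) * s"
  define \<V> where "\<V> = (\<lambda>x. {y \<in> X. (x, y) \<in> near E lam}) ` X"
  have "open_cover X d \<V>" by (auto simp: open_cover_def open_in_iff \<V>_def)
  moreover have "uniformly_bounded d \<V>"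
    unfolding uniformly_bounded_def
  proof (intro exI ballI)
    fix V y z assume "V \<in> \<V>" "y \<in> V" "z \<in> V"
    then obtain x where x: "y \<in> X" "z \<in> X" "(x, y) \<in> near E lam" "(x, z) \<in> near E lam"
      by (auto simp: \<V>_def)
    have "(y, z) \<in> near E (lam + lam)" using near_sym[OF sym x(3)] x(4) by (rule near_trans)
    then show "d y z \<le> ereal (real (lam + lam))" using dist_le x by blast
  qed
  ultimately obtain \<U> where \<U>: "open_cover X d \<U>" "uniformly_bounded d \<U>"
    "multiplicity_le X \<U> (n + 1)" "refines \<V> \<U>"
    using assms unfolding asdim_le_def by blast
  obtain B where B: "\<And>U x y. U \<in> \<U> \<Longrightarrow> x \<in> U \<Longrightarrow> y \<in> U \<Longrightarrow> d x y \<le> ereal B"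
    using \<U>(2) unfolding uniformly_bounded_def by blast
  have U_sub: "U \<subseteq> X" if "U \<in> \<U>" for U
    using \<U>(1) that by (simp add: open_cover_def open_in_iff)
  \<comment> \<open>The depth of \<open>x\<close> in \<open>U\<close>, capped at
    \<open>lam\<close>.\<close>
  define f where "f U x = gap E lam (X - U) x" for U x
  have f_pos: "x \<in> U" if "x \<in> X" "0 < f U x" for U x
    using gap_le[of x "X - U" x E 0 lam] that by (auto simp: f_def)
  have f_step: "f U x \<le> f U y + r" if "(x, y) \<in> near E r" for U x y
    using gap_Lipschitz[OF that] by (simp add: f_def)
  have "\<exists>\<sigma>. \<sigma> \<subseteq> \<U> \<and> \<sigma> \<noteq> {} \<and> finite \<sigma> \<and> card \<sigma> \<le> n + 1 \<and> (\<forall>U\<in>\<sigma>. x \<in> U) \<and>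
      (\<forall>U\<in>\<sigma>. \<forall>U'\<in>\<U> - \<sigma>. f U' x + s \<le> f U x)" if x: "x \<in> X" for x
  proof -
    let ?S = "{U \<in> \<U>. x \<in> U}"
    have S: "finite ?S" "card ?S \<le> n + 1" using \<U>(3) x by (auto simp: multiplicity_le_def)
    obtain U where U: "U \<in> \<U>" "{y \<in> X. (x, y) \<in> near E lam} \<subseteq> U"
      using \<U>(4) x by (auto simp: refines_def \<V>_def)
    have "f U x = lam"
    proof (rule ccontr)
      assume "f U x \<noteq> lam"
      then have less: "gap E lam (X - U) x < lam" using gap_le_cap[of E lam "X - U" x] by (simp add: f_def)
      obtain z where z: "z \<in> X - U" "(x, z) \<in> near E (gap E lam (X - U) x)"
        using gap_attained[OF less] by blast
      have "(x, z) \<in> near E lam" using z(2) less by (simp add: near_mono)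
      then show False using z U by blast
    qed
    moreover have "U \<in> ?S" using U x by auto
    ultimately obtain \<sigma> where \<sigma>: "\<sigma> \<subseteq> ?S" "U \<in> \<sigma>" "\<forall>U\<in>\<sigma>. s \<le> f U x"
      "\<forall>U\<in>\<sigma>. \<forall>U'\<in>?S - \<sigma>. f U' x + s \<le> f U x"
      using ex_gap_in_values[OF S, of U s "\<lambda>U. f U x"] by (auto simp: lam_def s_def)
    have "f U' x + s \<le> f V x" if "V \<in> \<sigma>" "U' \<in> \<U> - \<sigma>" for V U'
    proof (cases "x \<in> U'")
      case False
      then have "f U' x = 0" using f_pos x by blast
      then show ?thesis using \<sigma>(3) that by simp
    qed (use \<sigma>(4) that in blast)
    moreover have "finite \<sigma>" "card \<sigma> \<le> n + 1"
      using \<sigma>(1) S by (auto intro: finite_subset dest: card_mono[OF S(1)])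
    ultimately show ?thesis using \<sigma> by (intro exI[of _ \<sigma>]) blast
  qed
  then obtain \<sigma> where \<sigma>: "\<And>x. x \<in> X \<Longrightarrow> \<sigma> x \<subseteq> \<U> \<and> \<sigma> x \<noteq> {} \<and> finite (\<sigma> x) \<and> card (\<sigma> x) \<le> n + 1 \<and>
      (\<forall>U\<in>\<sigma> x. x \<in> U) \<and> (\<forall>U\<in>\<sigma> x. \<forall>U'\<in>\<U> - \<sigma> x. f U' x + s \<le> f U x)"
    by metis
  have \<sigma>_mem: "U \<in> \<U>" "x \<in> U" if "x \<in> X" "U \<in> \<sigma> x" for x U
    using \<sigma>[OF that(1)] that(2) by auto
  have \<sigma>_gap: "f U' x + s \<le> f U x" if "x \<in> X" "U \<in> \<sigma> x" "U' \<in> \<U>" "U' \<notin> \<sigma> x" for x U U'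
    using \<sigma>[OF that(1)] that(2-4) by simp
  text \<open>
    Two points whose sets \<open>\<sigma>\<close> have the same size but differ are far apart: some depth \<open>f\<close> drops
    by more than \<open>r\<close> on the way from one to the other.
  \<close>
  define c where "c x = card (\<sigma> x) - 1" for x
  have card: "card (\<sigma> x) = Suc (c x)" if "x \<in> X" for x
    using \<sigma>[OF that] by (simp add: c_def card_gt_0_iff)
  have same: "\<sigma> x = \<sigma> y" if xy: "(x, y) \<in> colour_links E X c r" for x y
  proof (rule ccontr)
    assume neq: "\<sigma> x \<noteq> \<sigma> y"
    have X: "x \<in> X" "y \<in> X" "c x = c y" "(x, y) \<in> near E r" using xy by (auto simp: colour_links_def)
    then have eq: "card (\<sigma> x) = card (\<sigma> y)" using card by simp
    have "\<not> \<sigma> x \<subseteq> \<sigma> y" "\<not> \<sigma> y \<subseteq> \<sigma> x"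
      using neq eq \<sigma>[OF X(1)] \<sigma>[OF X(2)] card_subset_eq[of "\<sigma> y" "\<sigma> x"]
        card_subset_eq[of "\<sigma> x" "\<sigma> y"] by auto
    then obtain U U' where U: "U \<in> \<sigma> x" "U \<notin> \<sigma> y" "U' \<in> \<sigma> y" "U' \<notin> \<sigma> x" by blast
    then have "f U' x + s \<le> f U x" "f U y + s \<le> f U' y"
      using \<sigma>_gap \<sigma>_mem X by auto
    moreover have "f U x \<le> f U y + r" using f_step[OF X(4)] .
    moreover have "f U' y \<le> f U' x + r" using f_step[OF near_sym[OF sym X(4)]] .
    ultimately show False by (simp add: s_def)
  qed
  have "(x, y) \<in> near E (nat \<lceil>B\<rceil>)" if "(x, y) \<in> (colour_links E X c r)\<^sup>*" for x y
  proof -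
    have "x = y \<or> x \<in> X \<and> y \<in> X \<and> \<sigma> x = \<sigma> y"
      using that
    proof (induction rule: rtrancl_induct)
      case (step y z)
      then show ?case using same[of y z] by (auto simp: colour_links_def)
    qed simp
    then show ?thesis
    proof
      assume *: "x \<in> X \<and> y \<in> X \<and> \<sigma> x = \<sigma> y"
      then have "\<sigma> x \<noteq> {}" using \<sigma>[of x] by simp
      then obtain U where "U \<in> \<sigma> x" by blast
      then have "U \<in> \<U>" "x \<in> U" "y \<in> U"
        using \<sigma>_mem[of x U] \<sigma>_mem[of y U] * by auto
      then have "d x y \<le> ereal B" by (rule B)
      then show ?thesis using dist_le_real[of x y B] * by simp
    qed auto
  qed
  moreover have "c x \<le> n" if "x \<in> X" for x using \<sigma>[OF that] card[OF that] by simp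
  ultimately show ?thesis
    unfolding colourable_def by (intro exI[of _ "nat \<lceil>B\<rceil>"]) (auto intro!: exI[of _ c])
qed

text \<open>With \<open>b\<close> bounding the diameters of the given cover, the new members are the
  \<open>b\<close>-neighbourhoods of the classes of chains at scale \<open>2 * b\<close>. Two
  classes of one colour whose neighbourhoods share a point contain points within
  \<open>2 * b\<close>, hence coincide; this leaves one member per colour.\<close>

lemma asdim_le_if_colourable:
  assumes "uniform_asdim_le E {X} n"
  shows "asdim_le X d n"
  unfolding asdim_le_def
proof (intro allI impI)
  fix \<V> assume \<V>: "open_cover X d \<V> \<and> uniformly_bounded d \<V>"
  then obtain B where B: "\<And>V x y. V \<in> \<V> \<Longrightarrow> x \<in> V \<Longrightarrow> y \<in> V \<Longrightarrow> d x y \<le> ereal B"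
    unfolding uniformly_bounded_def by blast
  define b where "b = nat \<lceil>B\<rceil>"
  have V_sub: "V \<subseteq> X" if "V \<in> \<V>" for V
    using \<V> that by (simp add: open_cover_def open_in_iff)
  obtain D c' where c': "\<And>Y x. Y \<in> {X} \<Longrightarrow> x \<in> Y \<Longrightarrow> c' Y x \<le> n"
    and D': "\<And>Y x y. Y \<in> {X} \<Longrightarrow> (x, y) \<in> (colour_links E Y (c' Y) (b + b))\<^sup>* \<Longrightarrow> (x, y) \<in> near E D"
    by (rule colourableE[OF uniform_asdim_leD[OF assms], where r = "b + b"]) blast
  define c where "c = c' X"
  define links where "links = colour_links E X c (b + b)"
  have c: "x \<in> X \<Longrightarrow> c x \<le> n" for x using c'[of X x] by (simp add: c_def)
  have D: "(x, y) \<in> links\<^sup>* \<Longrightarrow> (x, y) \<in> near E D" for x y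
    using D'[of X x y] by (simp add: c_def links_def)
  have sym_links: "sym (links\<^sup>*)"
    using near_sym[OF sym] by (intro sym_rtrancl) (auto simp: links_def colour_links_def sym_def)
  have links_X: "y \<in> X" if "(x, y) \<in> links\<^sup>*" "x \<in> X" for x y
    using that by (induction rule: rtrancl_induct) (auto simp: links_def colour_links_def)
  have links_c: "c x = c y" if "(x, y) \<in> links\<^sup>*" for x y
    using colour_links_rtrancl that by (simp add: links_def)
  define cell where "cell x = {y \<in> X. \<exists>z. (x, z) \<in> links\<^sup>* \<and> (z, y) \<in> near E b}" for x
  have cell_eq: "cell x = cell y" if "(x, y) \<in> links\<^sup>*" for x y
  proof -
    have "(x, z) \<in> links\<^sup>* \<longleftrightarrow> (y, z) \<in> links\<^sup>*" for z
      using that sym_links by (meson rtrancl_trans symD)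
    then show ?thesis by (simp add: cell_def)
  qed
  \<comment> \<open>If \<open>X\<close> is empty, the empty set may be a member of
    \<open>\<V>\<close> and has to be contained in a member of \<open>\<U>\<close>.\<close>
  define \<U> where "\<U> = insert {} (cell ` X)"
  have "open_cover X d \<U>"
    by (auto simp: open_cover_def open_in_iff \<U>_def cell_def)
  moreover have "uniformly_bounded d \<U>"
    unfolding uniformly_bounded_def
  proof (intro exI ballI)
    fix U y y' assume U: "U \<in> \<U>" "y \<in> U" "y' \<in> U"
    then obtain x where x: "x \<in> X" "U = cell x" by (auto simp: \<U>_def)
    obtain z z' where z: "(x, z) \<in> links\<^sup>*" "(z, y) \<in> near E b" "(x, z') \<in> links\<^sup>*" "(z', y') \<in> near E b"
      and X: "y \<in> X" "y' \<in> X"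
      using U x by (auto simp: cell_def)
    have "(z, z') \<in> links\<^sup>*" using z sym_links by (meson rtrancl_trans symD)
    then have "(y, y') \<in> near E (b + D + b)"
      using near_trans[OF near_trans[OF near_sym[OF sym z(2)] D] z(4)] by blast
    then show "d y y' \<le> ereal (real (b + D + b))" using dist_le X by blast
  qed
  moreover have "multiplicity_le X \<U> (n + 1)"
    unfolding multiplicity_le_def
  proof
    fix x assume x: "x \<in> X"
    define F where "F i = cell (SOME z. z \<in> X \<and> c z = i \<and> (z, x) \<in> near E b)" for i
    have "{U \<in> \<U>. x \<in> U} \<subseteq> F ` {..n}"
    proof
      fix U assume "U \<in> {U \<in> \<U>. x \<in> U}"
      then obtain w where w: "w \<in> X" "U = cell w" "x \<in> cell w" by (auto simp: \<U>_def)
      then obtain z where z: "(w, z) \<in> links\<^sup>*" "(z, x) \<in> near E b" by (auto simp: cell_def)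
      have zX: "z \<in> X" using links_X z(1) w(1) by blast
      define z0 where "z0 = (SOME z0. z0 \<in> X \<and> c z0 = c z \<and> (z0, x) \<in> near E b)"
      have z0: "z0 \<in> X \<and> c z0 = c z \<and> (z0, x) \<in> near E b"
        unfolding z0_def by (rule someI[of _ z]) (use zX z in simp)
      have "(z, z0) \<in> near E (b + b)" using near_trans[OF z(2)] near_sym[OF sym] z0 by blast
      then have "(z, z0) \<in> links" using zX z0 by (simp add: links_def colour_links_def)
      then have "U = F (c z)"
        using w(2) cell_eq[OF z(1)] cell_eq[of z z0] by (auto simp: F_def z0_def)
      then show "U \<in> F ` {..n}" using c[OF zX] by blast
    qed
    moreover from this have "card {U \<in> \<U>. x \<in> U} \<le> card (F ` {..n})" by (intro card_mono) auto
    moreover have "card (F ` {..n}) \<le> n + 1" using card_image_le[of "{..n}" F] by simp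
    ultimately show "finite {U \<in> \<U>. x \<in> U} \<and> card {U \<in> \<U>. x \<in> U} \<le> n + 1"
      by (auto intro: finite_subset)
  qed
  moreover have "refines \<V> \<U>"
    unfolding refines_def
  proof
    fix V assume V: "V \<in> \<V>"
    show "\<exists>U\<in>\<U>. V \<subseteq> U"
    proof (cases "V = {}")
      case False
      then obtain x where x: "x \<in> V" by blast
      have "V \<subseteq> cell x"
        using B[OF V x] V_sub[OF V] x dist_le_real by (fastforce simp: cell_def b_def)
      then show ?thesis using x V_sub[OF V] by (auto simp: \<U>_def)
    qed (auto simp: \<U>_def)
  qed
  ultimately show "\<exists>\<U>. open_cover X d \<U> \<and> uniformly_bounded d \<U> \<and>
      multiplicity_le X \<U> (n + 1) \<and> refines \<V> \<U>" by blast
qed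

lemma asdim_le_iff: "asdim_le X d n \<longleftrightarrow> uniform_asdim_le E {X} n"
  using colourable_if_asdim_le asdim_le_if_colourable unfolding uniform_asdim_le_def by blast

lemma asdim_le_enat_iff: "asdim X d \<le> enat n \<longleftrightarrow> uniform_asdim_le E {X} n"
proof
  assume "uniform_asdim_le E {X} n"
  then show "asdim X d \<le> enat n" unfolding asdim_def asdim_le_iff[symmetric] by (auto intro: Inf_lower)
next
  assume le: "asdim X d \<le> enat n"
  have "asdim X d \<in> {enat n | n. asdim_le X d n}"
    using le unfolding asdim_def Inf_enat_def by (auto split: if_splits intro: LeastI)
  then obtain k where "asdim X d = enat k" "asdim_le X d k" by blast
  then show "uniform_asdim_le E {X} n"
    using le uniform_asdim_le_mono by (simp add: asdim_le_iff)
qed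

end

section \<open>The graph distance in terms of lengths of walks\<close>

lemma (in pair_wf_digraph) near_iff_awalk:
  assumes "x \<in> pverts G"
  shows "(x, y) \<in> near (parcs G) r \<longleftrightarrow> (\<exists>p. awalk x p y \<and> length p \<le> r)"
proof
  assume "(x, y) \<in> near (parcs G) r"
  then show "\<exists>p. awalk x p y \<and> length p \<le> r"
  proof (induction r arbitrary: y)
    case 0
    then show ?case using assms by (intro exI[of _ "[]"]) (simp add: awalk_Nil_iff)
  next
    case (Suc r)
    then obtain z where z: "(x, z) \<in> near (parcs G) r" "z = y \<or> (z, y) \<in> parcs G"
      by (auto simp: near_Suc)
    obtain p where p: "awalk x p z" "length p \<le> r" using Suc.IH[OF z(1)] by blast
    show ?case using z(2)
    proof
      assume "(z, y) \<in> parcs G"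
      then have "awalk z [(z, y)] y" by (simp add: awalk_Cons_iff awalk_Nil_iff in_arcsD2)
      then have "awalk x (p @ [(z, y)]) y" by (rule awalk_appendI[OF p(1)])
      then show ?thesis using p(2) by (intro exI[of _ "p @ [(z, y)]"]) simp
    qed (use p in \<open>auto intro!: exI[of _ p]\<close>)
  qed
next
  assume "\<exists>p. awalk x p y \<and> length p \<le> r"
  then obtain p where "awalk x p y" "length p \<le> r" by blast
  then show "(x, y) \<in> near (parcs G) r"
  proof (induction p arbitrary: x r)
    case Nil
    then show ?case by (simp add: awalk_Nil_iff)
  next
    case (Cons e p)
    then have "(x, snd e) \<in> near (parcs G) 1" "(snd e, y) \<in> near (parcs G) (r - 1)"
      using near_arc[of "fst e" "snd e" "parcs G" 1] by (auto simp: awalk_Cons_iff)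
    then show ?case using Cons.prems(2) by (auto intro: near_trans_le)
  qed
qed

lemma (in pair_wf_digraph) awalk_cost_one: "awalk_cost (\<lambda>_. 1) p = real (length p)"
  by (induction p) (simp_all add: awalk_cost_def)

lemma (in pair_wf_digraph) graph_dist_le_iff:
  assumes "x \<in> pverts G"
  shows "graph_dist G x y \<le> ereal (real r) \<longleftrightarrow> (x, y) \<in> near (parcs G) r"
proof
  assume le: "graph_dist G x y \<le> ereal (real r)"
  have "\<exists>p. awalk x p y \<and> length p \<le> r"
  proof (rule ccontr)
    assume "\<not> ?thesis"
    then have "ereal (real (Suc r)) \<le> graph_dist G x y"
      unfolding graph_dist_def \<mu>_def by (intro INF_greatest) (auto simp: awalk_cost_one not_le)
    then have "ereal (real (Suc r)) \<le> ereal (real r)" using le by (rule order_trans)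
    then show False by simp
  qed
  then show "(x, y) \<in> near (parcs G) r" using near_iff_awalk[OF assms] by blast
next
  assume "(x, y) \<in> near (parcs G) r"
  then obtain p where p: "awalk x p y" "length p \<le> r" using near_iff_awalk[OF assms] by blast
  then show "graph_dist G x y \<le> ereal (real r)"
    unfolding graph_dist_def \<mu>_def by (intro INF_lower2[of p]) (auto simp: awalk_cost_one)
qed

lemma (in pair_wf_digraph) graph_dist_less_one:
  assumes "graph_dist G x y < 1"
  shows "x = y"
proof -
  obtain p where "awalk x p y" "ereal (awalk_cost (\<lambda>_. 1) p) < 1"
    using assms unfolding graph_dist_def \<mu>_def INF_less_iff by auto
  then show ?thesis by (simp add: awalk_cost_one awalk_Nil_iff one_ereal_def)
qed

lemma (in pair_sym_digraph) sym_parcs: "sym (parcs G)"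
  using arcs_symmetric by (auto simp: sym_def)

lemma (in pair_sym_digraph) discrete_dist_graph_dist:
  "X \<subseteq> pverts G \<Longrightarrow> discrete_dist X (graph_dist G) (parcs G)"
  using sym_parcs graph_dist_le_iff graph_dist_less_one by unfold_locales blast+

section \<open>Equivariant families of bijections\<close>

lemma finite_uniform_bound:
  assumes "finite P" "\<And>p. p \<in> P \<Longrightarrow> \<exists>s::nat. Q p s" "\<And>p s t. Q p s \<Longrightarrow> s \<le> t \<Longrightarrow> Q p t"
  shows "\<exists>s. \<forall>p\<in>P. Q p s"
  using assms(1,2)
proof (induction rule: finite_induct)
  case (insert p P)
  then obtain s t where "\<forall>p\<in>P. Q p s" "Q p t" by blast
  then have "\<forall>q\<in>insert p P. Q q (max s t)"
    using assms(3)[of _ s "max s t"] assms(3)[of p t "max s t"] by simp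
  then show ?case by blast
qed simp

text \<open>A pair of points of \<open>S k\<close> is moved by some \<open>g\<close> so that
  \<open>x\<close> comes to lie in the finite set \<open>X0\<close>. Distances of the images do not
  change: \<open>resp\<close> and \<open>cons\<close> alter the bijection by isometries only,
  finally to the index \<open>l0\<close>. By \<open>point_finite\<close>, finitely many choices of
  an index and a first point remain, each with finitely many second points, and a maximum can be
  taken.\<close>

lemma equivariant_bijections_coarse:
  fixes E :: "'a rel" and E' :: "'b rel" and r :: nat
  assumes conn: "\<And>x y. x \<in> V \<Longrightarrow> y \<in> V \<Longrightarrow> \<exists>r. (x, y) \<in> near E r"
    and conn': "\<And>x y. x \<in> V' \<Longrightarrow> y \<in> V' \<Longrightarrow> \<exists>r. (x, y) \<in> near E' r"
    and ball: "\<And>x r. x \<in> V \<Longrightarrow> finite {y. (x, y) \<in> near E r}"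
    and ball': "\<And>x r. x \<in> V' \<Longrightarrow> finite {y. (x, y) \<in> near E' r}"
    and reps: "finite X0" "\<And>x. x \<in> V \<Longrightarrow> \<exists>g\<in>G. g x \<in> X0"
    and iso: "\<And>g x y r. g \<in> G \<Longrightarrow> x \<in> V \<Longrightarrow> y \<in> V \<Longrightarrow> (g x, g y) \<in> near E r \<longleftrightarrow> (x, y) \<in> near E r"
    and iso': "\<And>g x y r. g \<in> G' \<Longrightarrow> x \<in> V' \<Longrightarrow> y \<in> V' \<Longrightarrow> (g x, g y) \<in> near E' r \<longleftrightarrow> (x, y) \<in> near E' r"
    and S: "\<And>k. k \<in> K \<Longrightarrow> S k \<subseteq> V" and S': "\<And>l. l \<in> L \<Longrightarrow> S' l \<subseteq> V'"
    and bij: "\<And>k l. k \<in> K \<Longrightarrow> l \<in> L \<Longrightarrow> bij_betw (\<phi> k l) (S k) (S' l)"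
    and point_finite: "\<And>x. x \<in> V \<Longrightarrow> finite {k \<in> K. x \<in> S k}"
    and resp: "\<And>g k. g \<in> G \<Longrightarrow> k \<in> K \<Longrightarrow> \<exists>k'\<in>K. \<exists>l\<in>L. g ` S k \<subseteq> S k' \<and>
      (\<exists>t\<in>G'. \<forall>x\<in>S k. \<phi> k l x = t (\<phi> k' l (g x)))"
    and cons: "\<And>k l l'. k \<in> K \<Longrightarrow> l \<in> L \<Longrightarrow> l' \<in> L \<Longrightarrow> \<exists>t\<in>G'. \<forall>x\<in>S k. \<phi> k l x = t (\<phi> k l' x)"
  shows "\<exists>s. \<forall>k\<in>K. \<forall>l\<in>L. \<forall>x\<in>S k. \<forall>y\<in>S k.
    ((x, y) \<in> near E r \<longrightarrow> (\<phi> k l x, \<phi> k l y) \<in> near E' s) \<and>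
    ((\<phi> k l x, \<phi> k l y) \<in> near E' r \<longrightarrow> (x, y) \<in> near E s)"
proof (cases "L = {}")
  case False
  then obtain l0 where l0: "l0 \<in> L" by blast
  have \<phi>: "\<phi> k l x \<in> V'" if "k \<in> K" "l \<in> L" "x \<in> S k" for k l x
    using bij[OF that(1,2)] S'[OF that(2)] that(3) by (auto simp: bij_betw_def)
  have indep: "(\<phi> k l x, \<phi> k l y) \<in> near E' r \<longleftrightarrow> (\<phi> k l' x, \<phi> k l' y) \<in> near E' r"
    if k: "k \<in> K" "l \<in> L" "l' \<in> L" "x \<in> S k" "y \<in> S k" for k l l' x y r
  proof -
    obtain t where t: "t \<in> G'" "\<forall>x\<in>S k. \<phi> k l x = t (\<phi> k l' x)" using cons[OF k(1-3)] by blast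
    then show ?thesis using iso'[OF t(1) \<phi> \<phi>, of k l' x k l' y r] k by simp
  qed
  have move: "\<exists>k'\<in>K. \<exists>x'\<in>X0 \<inter> S k'. \<forall>y\<in>S k. \<exists>y'\<in>S k'.
      (\<forall>r. (x, y) \<in> near E r \<longleftrightarrow> (x', y') \<in> near E r) \<and>
      (\<forall>r. (\<phi> k l x, \<phi> k l y) \<in> near E' r \<longleftrightarrow> (\<phi> k' l0 x', \<phi> k' l0 y') \<in> near E' r)"
    if k: "k \<in> K" "l \<in> L" "x \<in> S k" for k l x
  proof -
    obtain g where g: "g \<in> G" "g x \<in> X0" using reps(2) S k by blast
    obtain k' l' t where k': "k' \<in> K" "l' \<in> L" "g ` S k \<subseteq> S k'" "t \<in> G'"
      "\<forall>x\<in>S k. \<phi> k l' x = t (\<phi> k' l' (g x))"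
      using resp[OF g(1) k(1)] by blast
    have "\<exists>y'\<in>S k'. (\<forall>r. (x, y) \<in> near E r \<longleftrightarrow> (g x, y') \<in> near E r) \<and>
      (\<forall>r. (\<phi> k l x, \<phi> k l y) \<in> near E' r \<longleftrightarrow> (\<phi> k' l0 (g x), \<phi> k' l0 y') \<in> near E' r)"
      if y: "y \<in> S k" for y
    proof (intro bexI[of _ "g y"] conjI allI)
      have gS: "g x \<in> S k'" "g y \<in> S k'" using k'(3) k y by auto
      show "g y \<in> S k'" by fact
      show "(x, y) \<in> near E r \<longleftrightarrow> (g x, g y) \<in> near E r" for r
        using iso[OF g(1)] S[OF k(1)] k(3) y by blast
      have "(\<phi> k l x, \<phi> k l y) \<in> near E' r \<longleftrightarrow> (\<phi> k l' x, \<phi> k l' y) \<in> near E' r" for r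
        using indep k k'(2) y by blast
      also have "\<dots> r \<longleftrightarrow> (\<phi> k' l' (g x), \<phi> k' l' (g y)) \<in> near E' r" for r
        using iso'[OF k'(4) \<phi> \<phi>, of k' l' "g x" k' l' "g y" r] k' k y gS by simp
      also have "\<dots> r \<longleftrightarrow> (\<phi> k' l0 (g x), \<phi> k' l0 (g y)) \<in> near E' r" for r
        using indep k'(1,2) l0 gS by blast
      finally show "(\<phi> k l x, \<phi> k l y) \<in> near E' r \<longleftrightarrow> (\<phi> k' l0 (g x), \<phi> k' l0 (g y)) \<in> near E' r" for r .
    qed
    then show ?thesis using k' g k(3) by (intro bexI[of _ k'] bexI[of _ "g x"]) auto
  qed
  define T where "T = (SIGMA k:(\<Union>x\<in>X0 \<inter> V. {k \<in> K. x \<in> S k}). X0 \<inter> S k)"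
  have T: "finite T"
    unfolding T_def using reps(1) point_finite by (intro finite_SigmaI finite_UN_I) auto
  have T_mem: "(k, x) \<in> T" if "k \<in> K" "x \<in> X0 \<inter> S k" for k x
    using that S by (auto simp: T_def)
  have T_D: "k \<in> K \<and> x \<in> S k" if "(k, x) \<in> T" for k x
    using that by (auto simp: T_def)
  define P where "P = (SIGMA kx:T. {y \<in> S (fst kx). (snd kx, y) \<in> near E r})"
  have "finite P" unfolding P_def
  proof (intro finite_SigmaI T)
    fix kx assume "kx \<in> T"
    then have "snd kx \<in> V" using T_D[of "fst kx" "snd kx"] S by auto
    then show "finite {y \<in> S (fst kx). (snd kx, y) \<in> near E r}"
      by (intro rev_finite_subset[OF ball[of "snd kx" r]]) auto
  qed
  then have "\<exists>s. \<forall>p\<in>P. case p of ((k, x), y) \<Rightarrow> (\<phi> k l0 x, \<phi> k l0 y) \<in> near E' s"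
    by (rule finite_uniform_bound)
      (auto simp: P_def dest!: T_D intro!: conn' \<phi> l0 intro: near_mono split: prod.splits)
  then obtain s1 where s1: "\<And>k x y. ((k, x), y) \<in> P \<Longrightarrow> (\<phi> k l0 x, \<phi> k l0 y) \<in> near E' s1" by blast
  \<comment> \<open>For the reverse estimate the ball is taken in the image; injectivity makes its
    preimage finite.\<close>
  define Q where "Q = (SIGMA kx:T. {y \<in> S (fst kx). (\<phi> (fst kx) l0 (snd kx), \<phi> (fst kx) l0 y) \<in> near E' r})"
  have "finite Q" unfolding Q_def
  proof (intro finite_SigmaI T)
    fix kx assume "kx \<in> T"
    then have k: "fst kx \<in> K" "snd kx \<in> S (fst kx)" using T_D[of "fst kx" "snd kx"] by auto
    have "inj_on (\<phi> (fst kx) l0) (S (fst kx))" using bij[OF k(1) l0] by (simp add: bij_betw_def)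
    then show "finite {y \<in> S (fst kx). (\<phi> (fst kx) l0 (snd kx), \<phi> (fst kx) l0 y) \<in> near E' r}"
      using ball'[OF \<phi>[OF k(1) l0 k(2)], of r]
      by (intro finite_imageD[where f = "\<phi> (fst kx) l0"]) (auto elim: rev_finite_subset inj_on_subset)
  qed
  then have "\<exists>s. \<forall>p\<in>Q. case p of ((k, x), y) \<Rightarrow> (x, y) \<in> near E s"
    by (rule finite_uniform_bound)
      (auto simp: Q_def dest!: T_D intro!: conn subsetD[OF S] intro: near_mono split: prod.splits)
  then obtain s2 where s2: "\<And>k x y. ((k, x), y) \<in> Q \<Longrightarrow> (x, y) \<in> near E s2" by blast
  show ?thesis
  proof (intro exI ballI conjI impI)
    fix k l x y assume k: "k \<in> K" "l \<in> L" "x \<in> S k" "y \<in> S k"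
    obtain k' x' y' where k': "k' \<in> K" "x' \<in> X0 \<inter> S k'" "y' \<in> S k'"
      and eq: "\<And>r. (x, y) \<in> near E r \<longleftrightarrow> (x', y') \<in> near E r"
      and eq': "\<And>r. (\<phi> k l x, \<phi> k l y) \<in> near E' r \<longleftrightarrow> (\<phi> k' l0 x', \<phi> k' l0 y') \<in> near E' r"
      using move[OF k(1-3)] k(4) by meson
    { assume "(x, y) \<in> near E r"
      then have "((k', x'), y') \<in> P" using eq k' T_mem by (simp add: P_def)
      then have "(\<phi> k l x, \<phi> k l y) \<in> near E' s1" using s1 eq' by blast
      then show "(\<phi> k l x, \<phi> k l y) \<in> near E' (max s1 s2)" by (rule near_mono) simp }
    { assume "(\<phi> k l x, \<phi> k l y) \<in> near E' r"
      then have "((k', x'), y') \<in> Q" using eq' k' T_mem by (simp add: Q_def)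
      then have "(x, y) \<in> near E s2" using s2 eq by blast
      then show "(x, y) \<in> near E (max s1 s2)" by (rule near_mono) simp }
  qed
qed simp

section \<open>Trees and group actions on graphs\<close>

lemma (in pair_sym_digraph) connected_iff_rtrancl:
  "Digraph_Component.connected (with_proj G) \<longleftrightarrow>
    pverts G \<noteq> {} \<and> (\<forall>u\<in>pverts G. \<forall>v\<in>pverts G. (u, v) \<in> (parcs G)\<^sup>*)"
  using reachable_conv
  by (auto simp: connected_def strongly_connected_def reachable_mk_symmetric_eq[OF pair_sym_arcs])

lemma near_parcs_closed:
  assumes "pair_wf_digraph G" "(x, y) \<in> near (parcs G) r" "x \<in> pverts G"
  shows "y \<in> pverts G"
  using assms(2,3)
  by (rule near_closed) (use assms(1) pair_wf_digraph.in_arcsD2 in fast)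

locale simple_tree =
  fixes T :: "'t pair_pre_digraph"
  assumes tree: "undirected_tree T"
begin

sublocale pair_bidirected_digraph T
  using tree by (simp add: undirected_tree_def)

lemma arc_sym: "(u, v) \<in> parcs T \<Longrightarrow> (v, u) \<in> parcs T"
  using sym_parcs by (simp add: sym_def)

lemma arc_neq: "(u, v) \<in> parcs T \<Longrightarrow> u \<noteq> v"
  using pair_no_loops[of "(u, v)"] by simp

lemma nonempty: "pverts T \<noteq> {}"
  and joined: "u \<in> pverts T \<Longrightarrow> v \<in> pverts T \<Longrightarrow> (u, v) \<in> (parcs T)\<^sup>*"
  using tree connected_iff_rtrancl by (auto simp: undirected_tree_def)

text \<open>Otherwise a path from \<open>w\<close> to \<open>w'\<close> avoiding \<open>v\<close>
  closes up through \<open>v\<close> to a cycle of length at least 3. The uniqueness of parents and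
  the control of excursions go back to this.\<close>

lemma no_return:
  assumes "(v, w) \<in> parcs T" "(v, w') \<in> parcs T"
    and "(w, w') \<in> (parcs T \<inter> {u. u \<noteq> v} \<times> {u. u \<noteq> v})\<^sup>*"
  shows "w = w'"
proof (rule ccontr)
  assume neq: "w \<noteq> w'"
  let ?A = "parcs T \<inter> {u. u \<noteq> v} \<times> {u. u \<noteq> v}"
  have "\<exists>p. awalk w p w' \<and> set p \<subseteq> ?A"
    using assms(3)
  proof (induction rule: rtrancl_induct)
    case base
    then show ?case using in_arcsD2[OF assms(1)] by (intro exI[of _ "[]"]) (simp add: awalk_Nil_iff)
  next
    case (step y z)
    then obtain p where p: "awalk w p y" "set p \<subseteq> ?A" by blast
    have "awalk y [(y, z)] z" using step.hyps(2) by (auto simp: awalk_simps dest: in_arcsD2)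
    then have "awalk w (p @ [(y, z)]) z" by (rule awalk_appendI[OF p(1)])
    then show ?case using p(2) step.hyps(2) by (intro exI[of _ "p @ [(y, z)]"]) auto
  qed
  then obtain p where p: "awalk w p w'" "set p \<subseteq> ?A" by blast
  define q where "q = awalk_to_apath p"
  have q: "apath w q w'" "set q \<subseteq> ?A"
    using apath_awalk_to_apath[OF p(1)] awalk_to_apath_subset[OF p(1)] p(2) by (auto simp: q_def)
  have walk: "awalk w q w'" and dist: "distinct (pawalk_verts w q)"
    using q(1) by (auto simp: apath_def)
  have "set (pawalk_verts w q) = {w} \<union> set (map fst q) \<union> set (map snd q)"
    using set_awalk_verts[OF walk] .
  then have v: "v \<notin> set (pawalk_verts w q)"
    using q(2) arc_neq[OF assms(1)] by auto
  have ret: "awalk w' [(w', v)] v"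
    using arc_sym[OF assms(2)] by (auto simp: awalk_simps dest: in_arcsD2)
  have closed: "awalk v ((v, w) # q @ [(w', v)]) v"
    using awalk_appendI[OF walk ret] assms(1) by (simp add: awalk_Cons_iff del: awalk_append_iff)
  have "pawalk_verts w (q @ [(w', v)]) = pawalk_verts w q @ [v]"
    using awalk_verts_append[OF awalk_appendI[OF walk ret]] walk by (simp add: awlast_of_awalk)
  then have "distinct (tl (pawalk_verts v ((v, w) # q @ [(w', v)])))"
    using dist v by simp
  then have "cycle ((v, w) # q @ [(w', v)])"
    unfolding cycle_def using closed by blast
  moreover have "q \<noteq> []" using walk neq awalk_empty_ends by blast
  then have "3 \<le> length ((v, w) # q @ [(w', v)])" by (cases q) auto
  ultimately show False using tree unfolding undirected_tree_def by blast
qed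

definition root :: 't where
  "root = (SOME v. v \<in> pverts T)"

definition depth :: "'t \<Rightarrow> nat" where
  "depth v = (if v \<in> pverts T then LEAST k. (root, v) \<in> near (parcs T) k else 0)"

text \<open>The default \<open>v\<close>, together with depth \<open>0\<close> off the vertex set,
  makes \<open>depth_parent\<close> true without side conditions.\<close>

definition parent :: "'t \<Rightarrow> 't" where
  "parent v = (if \<exists>w. (v, w) \<in> parcs T \<and> depth v = Suc (depth w)
    then SOME w. (v, w) \<in> parcs T \<and> depth v = Suc (depth w) else v)"

lemma root: "root \<in> pverts T"
  using nonempty by (simp add: root_def some_in_eq)

lemma near_depth: "v \<in> pverts T \<Longrightarrow> (root, v) \<in> near (parcs T) (depth v)"
  using rtrancl_imp_near[OF joined[OF root]] LeastI_ex[of "\<lambda>k. (root, v) \<in> near (parcs T) k"]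
  by (simp add: depth_def)

lemma depth_le: "(root, v) \<in> near (parcs T) k \<Longrightarrow> depth v \<le> k"
  by (simp add: depth_def Least_le)

lemma depth_step: "(v, w) \<in> parcs T \<Longrightarrow> depth w \<le> Suc (depth v)"
  using near_trans_le[OF near_depth near_arc[of v w "parcs T" 1], of "Suc (depth v)"]
  by (intro depth_le) (simp add: in_arcsD1)

lemma lower_neighbour:
  assumes "v \<in> pverts T" "0 < depth v"
  shows "\<exists>w. (v, w) \<in> parcs T \<and> depth v = Suc (depth w)"
proof -
  obtain k where k: "depth v = Suc k" using assms(2) gr0_conv_Suc by blast
  then obtain w where w: "(root, w) \<in> near (parcs T) k" "w = v \<or> (w, v) \<in> parcs T"
    using near_depth[OF assms(1)] by (auto simp: near_Suc)
  have "depth w \<le> k" using depth_le[OF w(1)] .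
  then have "(w, v) \<in> parcs T" using w(2) k by auto
  then show ?thesis using arc_sym depth_step[of w v] \<open>depth w \<le> k\<close> k by (intro exI[of _ w]) auto
qed

lemma descent_to_root:
  assumes "w \<in> pverts T" "depth w < k"
  shows "(w, root) \<in> (parcs T \<inter> {u. depth u < k} \<times> {u. depth u < k})\<^sup>*"
  using assms
proof (induction "depth w" arbitrary: w)
  case 0
  have "(root, w) \<in> near (parcs T) 0" using near_depth[OF 0(2)] 0(1) by simp
  then show ?case by simp
next
  case (Suc d)
  then obtain u where u: "(w, u) \<in> parcs T" "depth w = Suc (depth u)"
    using lower_neighbour[of w] by auto
  have "(u, root) \<in> (parcs T \<inter> {u. depth u < k} \<times> {u. depth u < k})\<^sup>*"
    using Suc u by (intro Suc.hyps(1)) (auto dest: in_arcsD2)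
  then show ?case
    using u Suc.prems by (intro converse_rtrancl_into_rtrancl[of w u]) auto
qed

text \<open>Both neighbours are joined to the root by walks that avoid \<open>v\<close>. The weak
  inequality for \<open>w\<close> serves two ends: it gives uniqueness of the lower neighbour and
  excludes arcs within a level.\<close>

lemma lower_unique:
  assumes "(v, w) \<in> parcs T" "(v, w') \<in> parcs T" "depth w' < depth v" "depth w \<le> depth v"
  shows "w = w'"
proof (rule no_return[OF assms(1,2)])
  let ?D = "parcs T \<inter> {u. depth u < depth v} \<times> {u. depth u < depth v}"
  let ?A = "parcs T \<inter> {u. u \<noteq> v} \<times> {u. u \<noteq> v}"
  have D: "?D\<^sup>* \<subseteq> ?A\<^sup>*" by (rule rtrancl_mono) auto
  have low: "(u, root) \<in> ?A\<^sup>*" if "u \<in> pverts T" "depth u < depth v" for u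
    using descent_to_root[OF that] D by blast
  have "(w, root) \<in> ?A\<^sup>*"
  proof (cases "depth w < depth v")
    case False
    then have "depth w = depth v" "0 < depth w" using assms by auto
    then obtain u where u: "(w, u) \<in> parcs T" "depth w = Suc (depth u)"
      using lower_neighbour[of w] in_arcsD2[OF assms(1)] by auto
    then have "(w, u) \<in> ?A" using arc_neq[OF assms(1)] \<open>depth w = depth v\<close> by auto
    moreover have "(u, root) \<in> ?A\<^sup>*" using u \<open>depth w = depth v\<close> by (intro low) (auto dest: in_arcsD2)
    ultimately show ?thesis by (rule converse_rtrancl_into_rtrancl)
  qed (use low in_arcsD2[OF assms(1)] in blast)
  moreover have "sym (?A\<^sup>*)" using arc_sym by (intro sym_rtrancl) (auto simp: sym_def)
  then have "(root, w') \<in> ?A\<^sup>*"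
    using low[OF in_arcsD2[OF assms(2)] assms(3)] by (rule symD)
  ultimately show "(w, w') \<in> ?A\<^sup>*" by (rule rtrancl_trans)
qed

lemma parent_eq:
  assumes "(v, w) \<in> parcs T" "depth v = Suc (depth w)"
  shows "parent v = w"
proof -
  have "\<exists>w. (v, w) \<in> parcs T \<and> depth v = Suc (depth w)" using assms by blast
  then have *: "(v, parent v) \<in> parcs T \<and> depth v = Suc (depth (parent v))"
    unfolding parent_def using someI_ex[of "\<lambda>w. (v, w) \<in> parcs T \<and> depth v = Suc (depth w)"] by simp
  show ?thesis
  proof (rule lower_unique[OF conjunct1[OF *] assms(1)])
    show "depth (parent v) \<le> depth v" using conjunct2[OF *] by linarith
  qed (use assms(2) in linarith)
qed

lemma arc_parent:
  assumes "(v, w) \<in> parcs T"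
  shows "w = parent v \<and> depth v = Suc (depth w) \<or> v = parent w \<and> depth w = Suc (depth v)"
proof -
  have "depth v \<noteq> depth w"
  proof
    assume eq: "depth v = depth w"
    show False
    proof (cases "depth v = 0")
      case True
      then have "(root, v) \<in> near (parcs T) 0" "(root, w) \<in> near (parcs T) 0"
        using near_depth[of v] near_depth[of w] eq assms by (auto dest: in_arcsD1 in_arcsD2)
      then show False using arc_neq[OF assms] by simp
    next
      case False
      then obtain u where "(v, u) \<in> parcs T" "depth v = Suc (depth u)"
        using lower_neighbour[OF in_arcsD1[OF assms]] by auto
      then show False using lower_unique[OF assms, of u] eq by simp
    qed
  qed
  moreover have "depth w \<le> Suc (depth v)" "depth v \<le> Suc (depth w)"
    using depth_step assms arc_sym by blast+
  ultimately have "depth v = Suc (depth w) \<or> depth w = Suc (depth v)" by linarith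
  then show ?thesis using parent_eq[OF assms] parent_eq[OF arc_sym[OF assms]] by auto
qed

lemma depth_parent: "depth (parent v) = depth v - 1"
proof (cases "\<exists>w. (v, w) \<in> parcs T \<and> depth v = Suc (depth w)")
  case True
  then show ?thesis using parent_eq by auto
next
  case False
  then have "parent v = v" unfolding parent_def by (rule if_not_P)
  moreover have "depth v = 0"
    using False lower_neighbour[of v] by (cases "v \<in> pverts T") (auto simp: depth_def)
  ultimately show ?thesis by simp
qed

end

section \<open>Finite balls, isometries and orbit representatives\<close>

lemma (in pair_wf_digraph) finite_near_if_locally_finite:
  assumes "locally_finite G" "x \<in> pverts G"
  shows "finite {y. (x, y) \<in> near (parcs G) r}"
proof (induction r)
  case 0
  then show ?case by simp
next
  case (Suc r)
  have nbrs: "finite {y. (z, y) \<in> parcs G}" if "z \<in> pverts G" for z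
  proof -
    have "{y. (z, y) \<in> parcs G} \<subseteq> snd ` out_arcs (with_proj G) z" by (force simp: out_arcs_def)
    then show ?thesis using assms(1) that by (meson finite_imageI finite_subset locally_finite_def)
  qed
  have "{y. (x, y) \<in> near (parcs G) (Suc r)} =
    (\<Union>z\<in>{z. (x, z) \<in> near (parcs G) r}. insert z {y. (z, y) \<in> parcs G})"
    by (auto simp: near_Suc)
  moreover have "z \<in> pverts G" if "(x, z) \<in> near (parcs G) r" for z
    using near_parcs_closed[OF pair_wf_digraph_axioms that assms(2)] .
  ultimately show ?case using Suc nbrs by auto
qed

lemma quasi_transitive_isometry:
  assumes "quasi_transitive_action \<Gamma> \<rho> G" "pair_wf_digraph G" "g \<in> carrier \<Gamma>"
    and "x \<in> pverts G" "y \<in> pverts G"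
  shows "(\<rho> g x, \<rho> g y) \<in> near (parcs G) r \<longleftrightarrow> (x, y) \<in> near (parcs G) r"
proof -
  interpret group_action \<Gamma> "pverts G" \<rho> using assms(1) by (simp add: quasi_transitive_action_def)
  interpret pair_wf_digraph G by fact
  have arc: "(\<rho> g x, \<rho> g y) \<in> parcs G" if "g \<in> carrier \<Gamma>" "(x, y) \<in> parcs G" for g x y
    using that assms(1) in_arcsD1[OF that(2)] in_arcsD2[OF that(2)]
    unfolding quasi_transitive_action_def by blast
  have fwd: "(\<rho> g x, \<rho> g y) \<in> near (parcs G) r"
    if "g \<in> carrier \<Gamma>" "(x, y) \<in> near (parcs G) r" for g x y
    using near_map[of "parcs G" "\<rho> g" "parcs G" 1 x y r] arc[OF that(1)] that(2) by (simp add: near_arc)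
  have inv: "inv\<^bsub>\<Gamma>\<^esub> g \<in> carrier \<Gamma>"
    using group.inv_closed[OF group_hom.axioms(1)[OF group_hom] assms(3)] .
  show ?thesis
    using fwd[OF assms(3)] fwd[OF inv, of "\<rho> g x" "\<rho> g y"]
      orbit_sym_aux[OF assms(3,4) refl] orbit_sym_aux[OF assms(3,5) refl] by auto
qed

lemma quasi_transitive_representatives:
  assumes "quasi_transitive_action \<Gamma> \<rho> G"
  shows "\<exists>X. finite X \<and> (\<forall>x\<in>pverts G. \<exists>g\<in>carrier \<Gamma>. \<rho> g x \<in> X)"
proof (intro exI conjI ballI)
  let ?X = "(\<lambda>Y. SOME z. z \<in> Y) ` orbits \<Gamma> (pverts G) \<rho>"
  show "finite ?X" using assms by (simp add: quasi_transitive_action_def)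
  interpret group_action \<Gamma> "pverts G" \<rho> using assms by (simp add: quasi_transitive_action_def)
  fix x assume x: "x \<in> pverts G"
  let ?z = "SOME z. z \<in> orbit \<Gamma> \<rho> x"
  have "?z \<in> orbit \<Gamma> \<rho> x" using orbit_refl[OF x] by (rule someI)
  then obtain g where "g \<in> carrier \<Gamma>" "?z = \<rho> g x" by (auto simp: orbit_def)
  moreover have "?z \<in> ?X" using x by (auto simp: orbits_def)
  ultimately show "\<exists>g\<in>carrier \<Gamma>. \<rho> g x \<in> ?X" by auto
qed

section \<open>The sum graph of a tree amalgamation\<close>

context tree_amalgamation
begin

abbreviation "TV \<equiv> pverts (conn_tree A)"
abbreviation "TE \<equiv> parcs (conn_tree A)"
abbreviation "side v \<equiv> side_of A v"
abbreviation "HV \<equiv> pverts (sum_graph A)"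
abbreviation "HE \<equiv> parcs (sum_graph A)"
abbreviation "FV v \<equiv> pverts (factor A (side v))"
abbreviation "FE v \<equiv> parcs (factor A (side v))"

text \<open>Indexing by the arcs of \<open>T\<close> hides sides, labels and inverse maps: the two
  directions of an edge then obey the same rules.\<close>

definition edge_adh :: "'t \<Rightarrow> 't \<Rightarrow> 'a set" where
  "edge_adh u v = adh A (side u) (label A (u, v))"

definition edge_bond :: "'t \<Rightarrow> 't \<Rightarrow> 'a \<Rightarrow> 'a" where
  "edge_bond u v = bond A (side u) (label A (u, v)) (label A (v, u))"

sublocale tree: simple_tree "conn_tree A"
  using conn_tree by unfold_locales

lemma in_part_side: "v \<in> TV \<Longrightarrow> v \<in> part A (side v)"
  using part_Un by (auto simp: side_of_def)

lemma side_eq: "v \<in> part A i \<Longrightarrow> side v = i"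
  using part_Int by (cases i) (auto simp: side_of_def)

lemma part_subset: "v \<in> part A i \<Longrightarrow> v \<in> TV"
  using part_Un by (cases i) auto

lemma side_other: "(u, v) \<in> TE \<Longrightarrow> side v = other (side u)"
  using bipartite[OF _ in_part_side] side_eq tree.in_arcsD1 by blast

lemma label_in_index: "(u, v) \<in> TE \<Longrightarrow> label A (u, v) \<in> index A (side u)"
  using label_index[OF in_part_side] tree.in_arcsD1 by (auto simp: out_arcs_def)

lemma ex_arc_label:
  assumes "v \<in> part A i" "k \<in> index A i"
  shows "\<exists>w. (v, w) \<in> TE \<and> label A (v, w) = k"
  using label_unique[OF assms] by (auto simp: out_arcs_def)

lemma edge_adh_subset: "(u, v) \<in> TE \<Longrightarrow> edge_adh u v \<subseteq> FV u"
  using adh_subset[OF label_in_index] by (auto simp: edge_adh_def)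

lemma edge_bond:
  assumes "(u, v) \<in> TE"
  shows "bij_betw (edge_bond u v) (edge_adh u v) (edge_adh v u)"
    and "x \<in> edge_adh u v \<Longrightarrow> edge_bond v u (edge_bond u v x) = x"
proof -
  have l: "label A (u, v) \<in> index A (side u)" "label A (v, u) \<in> index A (side v)"
    using label_in_index assms tree.arc_sym by blast+
  have "bij_betw (edge_bond u v) (edge_adh u v) (edge_adh v u) \<and>
    (x \<in> edge_adh u v \<longrightarrow> edge_bond v u (edge_bond u v x) = x)" for x
  proof (cases "side u")
    case First
    then have b: "bij_betw (bonding A (label A (u, v)) (label A (v, u))) (edge_adh u v) (edge_adh v u)"
      using bonding_bij l side_other[OF assms] by (simp add: edge_adh_def)
    then show ?thesis
      using First side_other[OF assms] by (simp add: edge_bond_def edge_adh_def bij_betw_def)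
  next
    case Second
    then have b: "bij_betw (bonding A (label A (v, u)) (label A (u, v))) (edge_adh v u) (edge_adh u v)"
      using bonding_bij l side_other[OF assms] by (simp add: edge_adh_def)
    then show ?thesis
      using Second side_other[OF assms] bij_betw_inv_into[OF b]
      by (simp add: edge_bond_def edge_adh_def bij_betw_def f_inv_into_f)
  qed
  then show "bij_betw (edge_bond u v) (edge_adh u v) (edge_adh v u)"
    "x \<in> edge_adh u v \<Longrightarrow> edge_bond v u (edge_bond u v x) = x" by blast+
qed

lemma edge_bond_in: "(u, v) \<in> TE \<Longrightarrow> x \<in> edge_adh u v \<Longrightarrow> edge_bond u v x \<in> edge_adh v u"
  using edge_bond(1) by (auto simp: bij_betw_def)

lemma bond_arcs_iff: "(p, q) \<in> bond_arcs A \<longleftrightarrow> (fst p, fst q) \<in> TE \<and>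
    snd p \<in> edge_adh (fst p) (fst q) \<and> snd q = edge_bond (fst p) (fst q) (snd p)"
  unfolding bond_arcs_def edge_adh_def edge_bond_def by (cases p; cases q) auto

lemma copy_arcs_iff: "(p, q) \<in> copy_arcs A \<longleftrightarrow> fst p = fst q \<and> fst p \<in> TV \<and> (snd p, snd q) \<in> FE (fst p)"
  unfolding copy_arcs_def by (cases p; cases q) auto

lemma HE_iff: "(p, q) \<in> HE \<longleftrightarrow> (p, q) \<in> copy_arcs A \<or> (p, q) \<in> bond_arcs A"
  by (simp add: sum_graph_def)

lemma HV_iff: "p \<in> HV \<longleftrightarrow> fst p \<in> TV \<and> snd p \<in> FV (fst p)"
  by (cases p) (simp add: sum_graph_def)

lemma bond_arcs_subset: "bond_arcs A \<subseteq> HE"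
  by (simp add: sum_graph_def)

lemma sym_bond_arcs: "sym (bond_arcs A)"
  unfolding sym_def bond_arcs_iff using tree.arc_sym edge_bond_in edge_bond(2) by auto

lemma factor_wf: "pair_wf_digraph (factor A i)"
  and factor_sym: "sym (parcs (factor A i))"
proof -
  interpret pair_bidirected_digraph "factor A i" by (rule factor_graph)
  show "pair_wf_digraph (factor A i)" by unfold_locales
  show "sym (parcs (factor A i))" by (rule sym_parcs)
qed

lemma sym_HE: "sym HE"
proof -
  have "sym (copy_arcs A)" unfolding sym_def copy_arcs_iff using factor_sym by (metis symD)
  then show ?thesis using sym_bond_arcs by (simp add: sum_graph_def sym_Un)
qed

lemma HE_in_HV: "(p, q) \<in> HE \<Longrightarrow> p \<in> HV"
  unfolding HE_iff bond_arcs_iff copy_arcs_iff HV_iff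
  using edge_adh_subset tree.in_arcsD1 pair_wf_digraph.in_arcsD1[OF factor_wf] by blast

lemma HE_in_HV2: "(p, q) \<in> HE \<Longrightarrow> q \<in> HV"
  by (rule HE_in_HV[OF symD[OF sym_HE]])

lemma HE_nodes: "(p, q) \<in> HE \<Longrightarrow> fst p = fst q \<or> (fst p, fst q) \<in> TE"
  unfolding HE_iff bond_arcs_iff copy_arcs_iff by blast

lemma near_HE_if_near_factor:
  assumes "v \<in> TV" "(x, y) \<in> near (FE v) r"
  shows "((v, x), (v, y)) \<in> near HE r"
proof -
  have "((v, x), (v, y)) \<in> near HE 1" if "(x, y) \<in> FE v" for x y
    using that assms(1) by (intro near_arc) (simp_all add: HE_iff copy_arcs_iff)
  then show ?thesis using near_map[of "FE v" "Pair v" HE 1 x y r] assms(2) by simp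
qed

text \<open>\<open>T\<close> being a tree, a walk that leaves \<open>G\<^sub>v\<close> has to come back over the same edge of \<open>T\<close>.\<close>

lemma excursion:
  assumes "E \<subseteq> HE" "((v, x), (w, x1)) \<in> E" "v \<noteq> w" "((w, x1), (v, y)) \<in> near E m"
  shows "\<exists>k<m. \<exists>j<m. \<exists>y1. (v, w) \<in> TE \<and> x \<in> edge_adh v w \<and> x1 = edge_bond v w x \<and>
    y1 \<in> edge_adh w v \<and> ((w, x1), (w, y1)) \<in> near E k \<and>
    ((v, edge_bond w v y1), (v, y)) \<in> near E j"
proof -
  let ?A = "E \<inter> {z. fst z \<noteq> v} \<times> {z. fst z \<noteq> v}"
  have out: "(v, w) \<in> TE" "x \<in> edge_adh v w" "x1 = edge_bond v w x"
    using assms(1-3) HE_iff[of "(v, x)" "(w, x1)"] by (auto simp: bond_arcs_iff copy_arcs_iff)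
  obtain k j p' q' where *: "k < m" "j < m" "((w, x1), p') \<in> near ?A k" "(p', q') \<in> E"
    "fst p' \<noteq> v" "fst q' = v" "(q', (v, y)) \<in> near E j"
    using first_return[OF assms(4), of fst v] assms(3) by auto
  have "(p', q') \<in> bond_arcs A"
    using *(4-6) assms(1) HE_iff[of p' q'] by (auto simp: copy_arcs_iff)
  then have b: "(fst p', v) \<in> TE" "snd p' \<in> edge_adh (fst p') v" "q' = (v, edge_bond (fst p') v (snd p'))"
    using *(6) by (auto simp: bond_arcs_iff prod_eq_iff)
  have "(fst (w, x1), fst p') \<in> near (TE \<inter> {u. u \<noteq> v} \<times> {u. u \<noteq> v}) (1 * k)"
  proof (rule near_map[OF _ *(3)])
    fix p q assume "(p, q) \<in> ?A"
    then show "(fst p, fst q) \<in> near (TE \<inter> {u. u \<noteq> v} \<times> {u. u \<noteq> v}) 1"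
      using HE_nodes[of p q] assms(1) by (auto simp: near_1)
  qed
  then have "w = fst p'"
    using tree.no_return[OF out(1) tree.arc_sym[OF b(1)]] near_imp_rtrancl by fastforce
  moreover have "((w, x1), (fst p', snd p')) \<in> near E k"
    using near_rel_mono[OF _ *(3), of E] by simp
  ultimately have "snd p' \<in> edge_adh w v" "((w, x1), (w, snd p')) \<in> near E k"
    "((v, edge_bond w v (snd p')), (v, y)) \<in> near E j"
    using b *(7) by simp_all
  then show ?thesis
    using out *(1,2) by (intro exI[of _ k] exI[of _ j] exI[of _ "snd p'"] conjI)
qed

text \<open>Strong induction on the length. A walk leaving the copy comes back over the same edge;
  by induction it ends its stay beyond the edge where it began, and the two maps of the edge are
  mutually inverse. In effect, contraction identifies no two vertices of one copy.\<close>

lemma bond_walk_injective: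
  "((v, x), (v, y)) \<in> near (bond_arcs A) m \<Longrightarrow> x = y"
proof (induction m arbitrary: v x y rule: less_induct)
  case (less m)
  show ?case
  proof (cases m)
    case 0
    then show ?thesis using less.prems by simp
  next
    case (Suc m0)
    then obtain w x1 where z: "(w, x1) = (v, x) \<or> ((v, x), (w, x1)) \<in> bond_arcs A"
      "((w, x1), (v, y)) \<in> near (bond_arcs A) m0"
      using less.prems by (auto simp: near_Suc_left)
    show ?thesis using z(1)
    proof
      assume arc: "((v, x), (w, x1)) \<in> bond_arcs A"
      then have "v \<noteq> w" using tree.arc_neq by (auto simp: bond_arcs_iff)
      then obtain k j y1 where *: "k < m0" "j < m0" "(v, w) \<in> TE" "x \<in> edge_adh v w"
        "x1 = edge_bond v w x" "y1 \<in> edge_adh w v" "((w, x1), (w, y1)) \<in> near (bond_arcs A) k"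
        "((v, edge_bond w v y1), (v, y)) \<in> near (bond_arcs A) j"
        using excursion[OF bond_arcs_subset arc _ z(2)] by blast
      have "x1 = y1" using less.IH[OF _ *(7)] *(1) Suc by simp
      then have "edge_bond w v y1 = x" using *(5) edge_bond(2)[OF *(3,4)] by simp
      moreover have "edge_bond w v y1 = y" using less.IH[OF _ *(8)] *(2) Suc by simp
      ultimately show ?thesis by simp
    qed (use less.IH[of m0] z Suc in auto)
  qed
qed

text \<open>Strong induction on the length. An excursion is a shorter walk between two points of a
  neighbouring copy; they are within \<open>s\<close> there by induction, and the bonding map
  carries this back with distortion \<open>t\<close>. What remains of the walk is again
  shorter.\<close>

lemma factors_coarsely_embedded:
  assumes "\<And>r. \<exists>s. \<forall>(u, v)\<in>TE. \<forall>x\<in>edge_adh u v. \<forall>y\<in>edge_adh u v.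
    (x, y) \<in> near (FE u) r \<longrightarrow> (edge_bond u v x, edge_bond u v y) \<in> near (FE v) s"
  shows "\<exists>s. \<forall>v x y. ((v, x), (v, y)) \<in> near HE m \<longrightarrow> (x, y) \<in> near (FE v) s"
proof (induction m rule: less_induct)
  case (less m)
  have "\<exists>s. \<forall>j\<in>{..<m}. \<forall>v x y. ((v, x), (v, y)) \<in> near HE j \<longrightarrow> (x, y) \<in> near (FE v) s"
  proof (rule finite_uniform_bound)
    show "\<forall>v x y. ((v, x), v, y) \<in> near HE j \<longrightarrow> (x, y) \<in> near (FE v) t"
      if "\<forall>v x y. ((v, x), v, y) \<in> near HE j \<longrightarrow> (x, y) \<in> near (FE v) s" "s \<le> t" for j s t
      by (intro allI impI near_mono[OF _ that(2)]) (simp add: that(1))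
  qed (use less.IH in auto)
  then obtain s where s: "\<And>j v x y. j < m \<Longrightarrow> ((v, x), (v, y)) \<in> near HE j \<Longrightarrow> (x, y) \<in> near (FE v) s"
    by blast
  obtain t where t: "\<And>u v x y. (u, v) \<in> TE \<Longrightarrow> x \<in> edge_adh u v \<Longrightarrow> y \<in> edge_adh u v \<Longrightarrow>
    (x, y) \<in> near (FE u) s \<Longrightarrow> (edge_bond u v x, edge_bond u v y) \<in> near (FE v) t"
    using assms[of s] by blast
  have "(x, y) \<in> near (FE v) (s + 1 + t)" if walk: "((v, x), (v, y)) \<in> near HE m" for v x y
  proof (cases m)
    case 0
    then show ?thesis using walk by simp
  next
    case (Suc m0)
    then obtain w x1 where z: "(w, x1) = (v, x) \<or> ((v, x), (w, x1)) \<in> HE"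
      "((w, x1), (v, y)) \<in> near HE m0"
      using walk by (auto simp: near_Suc_left)
    show ?thesis
    proof (cases "v = w")
      case True
      have "(x, x1) \<in> near (FE v) 1"
        using z(1) True tree.arc_neq by (auto simp: HE_iff bond_arcs_iff copy_arcs_iff near_1)
      moreover have "(x1, y) \<in> near (FE v) s" using s[of m0] z(2) True Suc by simp
      ultimately show ?thesis by (rule near_trans_le) simp
    next
      case False
      then obtain k j y1 where *: "k < m0" "j < m0" "(v, w) \<in> TE" "x \<in> edge_adh v w"
        "x1 = edge_bond v w x" "y1 \<in> edge_adh w v" "((w, x1), (w, y1)) \<in> near HE k"
        "((v, edge_bond w v y1), (v, y)) \<in> near HE j"
        using excursion[OF order_refl _ False z(2)] z(1) by blast
      have "(x1, y1) \<in> near (FE w) s" using s[OF _ *(7)] *(1) Suc by simp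
      moreover have "x1 \<in> edge_adh w v" using *(5) edge_bond_in[OF *(3,4)] by simp
      ultimately have "(edge_bond w v x1, edge_bond w v y1) \<in> near (FE v) t"
        using t[OF tree.arc_sym[OF *(3)] _ *(6)] by simp
      then have "(x, edge_bond w v y1) \<in> near (FE v) t" using *(5) edge_bond(2)[OF *(3,4)] by simp
      moreover have "(edge_bond w v y1, y) \<in> near (FE v) s" using s[OF _ *(8)] *(2) Suc by simp
      ultimately show ?thesis by (rule near_trans_le) simp
    qed
  qed
  then show ?case by blast
qed

section \<open>Classes of contracted vertices and finite identification\<close>

lemma proj_eq_iff: "proj A p = proj A q \<longleftrightarrow> (p, q) \<in> (bond_arcs A)\<^sup>*"
proof
  assume "proj A p = proj A q"
  moreover have "q \<in> proj A q" by (simp add: proj_def contraction_map_def)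
  ultimately have "q \<in> proj A p" by simp
  then show "(p, q) \<in> (bond_arcs A)\<^sup>*" by (simp add: proj_def contraction_map_def)
next
  assume "(p, q) \<in> (bond_arcs A)\<^sup>*"
  moreover have "(q, p) \<in> (bond_arcs A)\<^sup>*"
    using calculation sym_rtrancl[OF sym_bond_arcs] by (rule symD[rotated])
  ultimately show "proj A p = proj A q"
    by (auto simp: proj_def contraction_map_def intro: rtrancl_trans)
qed

lemma bond_walk_in_HV: "(p, q) \<in> (bond_arcs A)\<^sup>* \<Longrightarrow> p \<in> HV \<Longrightarrow> q \<in> HV"
proof (induction rule: rtrancl_induct)
  case (step y z)
  then have "(z, y) \<in> HE" using bond_arcs_subset sym_HE by (meson subsetD symD)
  then show ?case by (rule HE_in_HV)
qed

definition occupied :: "('t \<times> 'a) set \<Rightarrow> 't set" where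
  "occupied X = {u \<in> TV. \<exists>y\<in>FV u. proj A (u, y) = X}"

text \<open>A walk in the bond arcs projects to a walk in \<open>T\<close> through occupied nodes,
  so these induce a subtree. It contains \<open>U\<close>, and maximality of \<open>U\<close> gives
  equality.\<close>

lemma identification_tree_pverts:
  assumes U: "identification_tree A (proj A p) U" and p: "p \<in> HV"
  shows "pverts U = occupied (proj A p)"
proof -
  let ?O = "occupied (proj A p)"
  define U' where "U' = \<lparr>pverts = ?O, parcs = TE \<inter> ?O \<times> ?O\<rparr>"
  have occ: "undirected_tree U" "subgraph (with_proj U) (with_proj (conn_tree A))"
    "\<forall>u\<in>pverts U. \<exists>y\<in>FV u. proj A (u, y) = proj A p"
    using U by (auto simp: identification_tree_def occupied_subtree_def)
  have O_sub: "?O \<subseteq> TV" by (auto simp: occupied_def)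
  interpret U': pair_bidirected_digraph U'
    using tree.arc_neq tree.arc_sym by unfold_locales (auto simp: U'_def symmetric_def sym_def)
  have sub: "subgraph (with_proj U') (with_proj (conn_tree A))"
    using O_sub by (intro subgraphI compatibleI_with_proj U'.wf_digraph_axioms tree.wf_digraph_axioms)
      (auto simp: U'_def)
  have conn: "(u, w) \<in> (TE \<inter> ?O \<times> ?O)\<^sup>*" if uw: "u \<in> ?O" "w \<in> ?O" for u w
  proof -
    obtain y z where yz: "y \<in> FV u" "proj A (u, y) = proj A p" "z \<in> FV w" "proj A (w, z) = proj A p"
      using uw by (auto simp: occupied_def)
    have uy: "(u, y) \<in> HV" using uw(1) yz(1) by (simp add: HV_iff occupied_def)
    have "(fst (u, y), fst q) \<in> (TE \<inter> ?O \<times> ?O)\<^sup>*" if "((u, y), q) \<in> (bond_arcs A)\<^sup>*" for q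
      using that
    proof (induction rule: rtrancl_induct)
      case (step q1 q2)
      have O: "fst q \<in> ?O" if "((u, y), q) \<in> (bond_arcs A)\<^sup>*" for q
        using bond_walk_in_HV[OF that uy] proj_eq_iff[of "(u, y)" q] that yz(2)
        by (cases q) (auto simp: HV_iff occupied_def intro: bexI[of _ "snd q"])
      have "(fst q1, fst q2) \<in> TE \<inter> ?O \<times> ?O"
        using step.hyps O[OF step.hyps(1)] O[OF rtrancl.rtrancl_into_rtrancl[OF step.hyps]]
        by (auto simp: bond_arcs_iff)
      with step.IH show ?case by (rule rtrancl.rtrancl_into_rtrancl)
    qed simp
    moreover have "((u, y), (w, z)) \<in> (bond_arcs A)\<^sup>*" using yz proj_eq_iff by metis
    ultimately show ?thesis by fastforce
  qed
  have "fst p \<in> ?O" using p by (cases p) (auto simp: occupied_def HV_iff)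
  then have "Digraph_Component.connected (with_proj U')"
    using conn U'.connected_iff_rtrancl by (auto simp: U'_def)
  moreover have "\<not> (\<exists>c. pre_digraph.cycle (with_proj U') c \<and> 3 \<le> length c)"
    using tree.subgraph_cycle[OF sub] tree.tree by (auto simp: undirected_tree_def)
  ultimately have "undirected_tree U'"
    using U'.pair_bidirected_digraph_axioms by (simp add: undirected_tree_def)
  then have "occupied_subtree A (proj A p) U'"
    using sub by (auto simp: occupied_subtree_def U'_def occupied_def)
  moreover have "subgraph (with_proj U) (with_proj U')"
  proof (rule subgraphI)
    have V: "pverts U \<subseteq> ?O" using occ by (auto simp: occupied_def elim!: subgraphE)
    then show "verts (with_proj U) \<subseteq> verts (with_proj U')" by (simp add: U'_def)
    interpret Uw: pair_bidirected_digraph U using occ(1) by (simp add: undirected_tree_def)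
    show "arcs (with_proj U) \<subseteq> arcs (with_proj U')"
      using occ(2) V Uw.in_arcsD1 Uw.in_arcsD2 by (auto simp: U'_def elim!: subgraphE)
    show "wf_digraph (with_proj U)" by (rule Uw.wf_digraph_axioms)
  qed (use U'.wf_digraph_axioms in auto)
  ultimately have "U' = U" using U unfolding identification_tree_def by blast
  then show ?thesis by (auto simp: U'_def)
qed

lemma proj_in_pverts: "p \<in> HV \<Longrightarrow> proj A p \<in> pverts (amalgam_graph A)"
  by (auto simp: amalgam_graph_def contract_def proj_def)

lemma finite_identification_bound:
  assumes "finite_identification A"
  obtains N where "\<And>p. p \<in> HV \<Longrightarrow> finite (occupied (proj A p)) \<and> card (occupied (proj A p)) \<le> N"
proof -
  obtain N where N: "\<And>x. x \<in> pverts (amalgam_graph A) \<Longrightarrow>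
    \<exists>U. identification_tree A x U \<and> finite (pverts U) \<and> card (pverts U) \<le> N"
    using assms unfolding finite_identification_def by blast
  show thesis
  proof (rule that[of N])
    fix p assume p: "p \<in> HV"
    obtain U where "identification_tree A (proj A p) U" "finite (pverts U)" "card (pverts U) \<le> N"
      using N[OF proj_in_pverts[OF p]] by blast
    then show "finite (occupied (proj A p)) \<and> card (occupied (proj A p)) \<le> N"
      using identification_tree_pverts[OF _ p] by auto
  qed
qed

text \<open>A class meets each copy at most once, so it has no more members than the identification
  size allows; being connected by bond arcs, it is bounded in terms of its size.\<close>

lemma bond_classes_bounded:
  assumes "finite_identification A"
  obtains M where "\<And>p q. p \<in> HV \<Longrightarrow> (p, q) \<in> (bond_arcs A)\<^sup>* \<Longrightarrow> (p, q) \<in> near HE M"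
proof -
  obtain N where N: "\<And>p. p \<in> HV \<Longrightarrow> finite (occupied (proj A p)) \<and> card (occupied (proj A p)) \<le> N"
    using finite_identification_bound[OF assms] by blast
  show thesis
  proof (rule that[of "N * N"])
    fix p q assume p: "p \<in> HV" and pq: "(p, q) \<in> (bond_arcs A)\<^sup>*"
    let ?C = "(bond_arcs A)\<^sup>* `` {p}"
    have inj: "inj_on fst ?C"
    proof (rule inj_onI)
      fix a b assume C: "a \<in> ?C" "b \<in> ?C" and ab: "fst a = fst b"
      have "proj A p = proj A a" "proj A p = proj A b" using C by (simp_all add: proj_eq_iff)
      then have "proj A a = proj A b" by simp
      then have "(a, b) \<in> (bond_arcs A)\<^sup>*" by (rule iffD1[OF proj_eq_iff])
      then obtain r where "(a, b) \<in> near (bond_arcs A) r" by (elim exE[OF rtrancl_imp_near])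
      then show "a = b"
        using bond_walk_injective[of "fst a" "snd a" "snd b" r] ab by (cases a; cases b) simp
    qed
    have sub: "fst ` ?C \<subseteq> occupied (proj A p)"
    proof
      fix v assume "v \<in> fst ` ?C"
      then obtain a where a: "v = fst a" "(p, a) \<in> (bond_arcs A)\<^sup>*" by auto
      then have "a \<in> HV" "proj A a = proj A p" using bond_walk_in_HV p proj_eq_iff by blast+
      then show "v \<in> occupied (proj A p)" using a(1) by (cases a) (auto simp: occupied_def HV_iff)
    qed
    have fin: "finite ?C" using N[OF p] sub inj by (meson finite_imageD finite_subset)
    have "card ?C \<le> N"
      using N[OF p] card_mono[OF _ sub] card_image[OF inj] by simp
    then have "card ?C * card ?C \<le> N * N" by (rule mult_le_mono) fact
    from near_mono[OF finite_rtrancl_near[OF pq fin] this]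
    show "(p, q) \<in> near HE (N * N)" by (rule near_rel_mono[OF bond_arcs_subset])
  qed
qed

text \<open>Each such \<open>k\<close> labels an edge at \<open>v\<close> whose other end is a node
  occupied by the class of \<open>(v, x)\<close>.\<close>

lemma point_finite_adhesion:
  assumes "finite_identification A" "v \<in> part A i" "x \<in> pverts (factor A i)"
  shows "finite {k \<in> index A i. x \<in> adh A i k}"
proof -
  have v: "v \<in> TV" "side v = i" using assms(2) part_subset side_eq by blast+
  then have vx: "(v, x) \<in> HV" using assms(3) by (simp add: HV_iff)
  have "{k \<in> index A i. x \<in> adh A i k} \<subseteq> (\<lambda>w. label A (v, w)) ` occupied (proj A (v, x))"
  proof
    fix k assume k: "k \<in> {k \<in> index A i. x \<in> adh A i k}"
    then obtain w where w: "(v, w) \<in> TE" "label A (v, w) = k" using ex_arc_label[OF assms(2)] by blast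
    have "((v, x), (w, edge_bond v w x)) \<in> bond_arcs A"
      using w k v by (simp add: bond_arcs_iff edge_adh_def)
    then have "((v, x), (w, edge_bond v w x)) \<in> (bond_arcs A)\<^sup>*" by blast
    then have "(w, edge_bond v w x) \<in> HV" "proj A (w, edge_bond v w x) = proj A (v, x)"
      using bond_walk_in_HV vx proj_eq_iff by blast+
    then have "w \<in> occupied (proj A (v, x))" by (auto simp: occupied_def HV_iff)
    then show "k \<in> (\<lambda>w. label A (v, w)) ` occupied (proj A (v, x))" using w(2) by blast
  qed
  moreover obtain N where
    N: "\<And>p. p \<in> HV \<Longrightarrow> finite (occupied (proj A p)) \<and> card (occupied (proj A p)) \<le> N"
    using finite_identification_bound[OF assms(1)] by blast
  ultimately show ?thesis using N[OF vx] by (meson finite_imageI finite_subset)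
qed

end

section \<open>Amalgamations respecting group actions\<close>

lemma enat_plus_one_leD: "(a::enat) + 1 \<le> enat n \<Longrightarrow> \<exists>m<n. a \<le> enat m"
  by (cases a; cases n) (auto simp: one_enat_def zero_enat_def)

lemma enat_le_by_bounds: "(\<And>n. (b::enat) \<le> enat n \<Longrightarrow> a \<le> enat n) \<Longrightarrow> a \<le> b"
  by (cases b) auto

locale amalgam_of_actions = tree_amalgamation A for A :: "('a, 'i, 't) amalgam" +
  fixes \<Gamma> :: "side \<Rightarrow> 'g monoid" and \<rho> :: "side \<Rightarrow> 'g \<Rightarrow> 'a \<Rightarrow> 'a"
  assumes locally_finite: "locally_finite (factor A i)"
    and connected: "Digraph_Component.connected (with_proj (factor A i))"
    and quasi_transitive: "quasi_transitive_action (\<Gamma> i) (\<rho> i) (factor A i)"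
    and finite_identification: "finite_identification A"
    and respects: "respects_actions A \<Gamma> \<rho>"
begin

text \<open>
  Both types of amalgamations have a set \<open>K\<close> of indices on the first and a set \<open>L\<close> of indices on
  the second side between which all bonding maps that occur go. For Type 1 these are \<open>I\<^sub>1\<close> and
  \<open>I\<^sub>2\<close>, for Type 2 they are \<open>J\<close> and \<open>I - J\<close>.
\<close>

definition oriented :: "'i set \<Rightarrow> 'i set \<Rightarrow> 't \<Rightarrow> 't \<Rightarrow> bool" where
  "oriented K L u v \<longleftrightarrow> label A (u, v) \<in> K \<and> label A (v, u) \<in> L \<and>
     factor A (side u) = factor A First \<and> factor A (side v) = factor A Second \<and>
     edge_adh u v = adh A First (label A (u, v)) \<and>
     edge_adh v u = adh A Second (label A (v, u)) \<and>
     (\<forall>x\<in>edge_adh u v. edge_bond u v x = bonding A (label A (u, v)) (label A (v, u)) x)"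

text \<open>Only the direction from \<open>K\<close> to \<open>L\<close> is recorded.
  Representatives of the orbits on the first factor and finite balls in both factors will control
  the inverse maps as well.\<close>

lemma orientation:
  obtains K L where "K \<subseteq> index A First" "L \<subseteq> index A Second"
    "\<And>\<gamma> k. \<gamma> \<in> carrier (\<Gamma> First) \<Longrightarrow> k \<in> K \<Longrightarrow>
      \<exists>k'\<in>K. \<exists>l\<in>L. \<rho> First \<gamma> ` adh A First k \<subseteq> adh A First k' \<and>
        (\<exists>\<tau>\<in>carrier (\<Gamma> Second). \<forall>x\<in>adh A First k.
          bonding A k l x = \<rho> Second \<tau> (bonding A k' l (\<rho> First \<gamma> x)))"
    "\<And>k l l'. k \<in> K \<Longrightarrow> l \<in> L \<Longrightarrow> l' \<in> L \<Longrightarrow>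
      \<exists>\<gamma>\<in>carrier (\<Gamma> Second). \<forall>x\<in>adh A First k. bonding A k l x = \<rho> Second \<gamma> (bonding A k l' x)"
    "\<And>u v. (u, v) \<in> TE \<Longrightarrow> oriented K L u v \<or> oriented K L v u"
  using respects unfolding respects_actions_def
proof
  assume t: "type1 A \<Gamma> \<rho>"
  show thesis
  proof (rule that[of "index A First" "index A Second"])
    fix \<gamma> k assume "\<gamma> \<in> carrier (\<Gamma> First)" and k: "k \<in> index A First"
    then have "respects_element A \<Gamma> \<rho> (\<lambda>_ _. True) First \<gamma>"
      using t by (auto simp: type1_def respects_group_def)
    then obtain \<sigma> where \<sigma>: "bij_betw \<sigma> (index A First) (index A First)"
      "\<exists>l\<in>index A Second. \<exists>\<tau>\<in>stabilizer (\<Gamma> Second) (\<lambda>g. image (\<rho> Second g)) (adh A Second l).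
         \<rho> First \<gamma> ` adh A First k \<subseteq> adh A First (\<sigma> k) \<and>
         (\<forall>x\<in>adh A First k. bonding A k l x = \<rho> Second \<tau> (bonding A (\<sigma> k) l (\<rho> First \<gamma> x)))"
      using k unfolding respects_element_def other.simps bond.simps by meson
    have "\<sigma> k \<in> index A First" using \<sigma>(1) k by (auto simp: bij_betw_def)
    then show "\<exists>k'\<in>index A First. \<exists>l\<in>index A Second. \<rho> First \<gamma> ` adh A First k \<subseteq> adh A First k' \<and>
        (\<exists>\<tau>\<in>carrier (\<Gamma> Second). \<forall>x\<in>adh A First k.
          bonding A k l x = \<rho> Second \<tau> (bonding A k' l (\<rho> First \<gamma> x)))"
      using \<sigma>(2) unfolding stabilizer_def by blast
  next
    fix k l l' assume "k \<in> index A First" "l \<in> index A Second" "l' \<in> index A Second"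
    then show "\<exists>\<gamma>\<in>carrier (\<Gamma> Second). \<forall>x\<in>adh A First k.
        bonding A k l x = \<rho> Second \<gamma> (bonding A k l' x)"
      using t by (simp add: type1_def consistent_def)
  next
    fix u v assume uv: "(u, v) \<in> TE"
    have "oriented (index A First) (index A Second) u v" if "(u, v) \<in> TE" "side u = First" for u v
      using that side_other[OF that(1)] label_in_index[OF that(1)] label_in_index[OF tree.arc_sym[OF that(1)]]
      by (simp add: oriented_def edge_adh_def edge_bond_def)
    then show "oriented (index A First) (index A Second) u v \<or> oriented (index A First) (index A Second) v u"
      using uv tree.arc_sym[OF uv] side_other[OF uv] by (cases "side u") auto
  qed simp_all
next
  assume t: "type2 A \<Gamma> \<rho>"
  then obtain J where J: "J \<subseteq> index A First"
    and bonds: "\<forall>k\<in>index A First. \<forall>l\<in>index A First. (k \<in> J \<longleftrightarrow> l \<notin> J) \<longrightarrow>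
           (\<forall>x\<in>adh A First k. bond A First k l x = bond A Second k l x)"
    and labels: "\<forall>u v. (u, v) \<in> TE \<longrightarrow> (label A (u, v) \<in> J \<longleftrightarrow> label A (v, u) \<notin> J)"
    and resp: "respects_group A \<Gamma> \<rho> (\<lambda>k l. k \<in> J \<longleftrightarrow> l \<notin> J) First"
    and cons: "consistent A \<Gamma> \<rho> First J (index A First - J)"
    unfolding type2_def by blast
  have eq: "factor A First = factor A Second" "index A First = index A Second"
    "\<And>k. k \<in> index A First \<Longrightarrow> adh A First k = adh A Second k"
    using t by (auto simp: type2_def)
  let ?L = "index A First - J"
  show thesis
  proof (rule that[of J ?L])
    fix \<gamma> k assume "\<gamma> \<in> carrier (\<Gamma> First)" and k: "k \<in> J"
    then have "respects_element A \<Gamma> \<rho> (\<lambda>k l. k \<in> J \<longleftrightarrow> l \<notin> J) First \<gamma>"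
      using resp by (auto simp: respects_group_def)
    \<comment> \<open>As \<open>k\<close> and \<open>\<sigma> k\<close> are bonded to the same
      \<open>l\<close>, which lies outside \<open>J\<close>, also \<open>\<sigma> k\<close> lies in
      \<open>J\<close>.\<close>
    then obtain \<sigma> where \<sigma>: "bij_betw \<sigma> (index A First) (index A First)"
      "\<exists>l\<in>index A Second. (k \<in> J \<longleftrightarrow> l \<notin> J) \<and> (\<sigma> k \<in> J \<longleftrightarrow> l \<notin> J) \<and>
        (\<exists>\<tau>\<in>stabilizer (\<Gamma> Second) (\<lambda>g. image (\<rho> Second g)) (adh A Second l).
         \<rho> First \<gamma> ` adh A First k \<subseteq> adh A First (\<sigma> k) \<and>
         (\<forall>x\<in>adh A First k. bonding A k l x = \<rho> Second \<tau> (bonding A (\<sigma> k) l (\<rho> First \<gamma> x))))"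
      using k J unfolding respects_element_def other.simps bond.simps by (meson subsetD)
    then show "\<exists>k'\<in>J. \<exists>l\<in>?L. \<rho> First \<gamma> ` adh A First k \<subseteq> adh A First k' \<and>
        (\<exists>\<tau>\<in>carrier (\<Gamma> Second). \<forall>x\<in>adh A First k.
          bonding A k l x = \<rho> Second \<tau> (bonding A k' l (\<rho> First \<gamma> x)))"
      using k eq(2) unfolding stabilizer_def by auto
  next
    fix k l l' assume "k \<in> J" "l \<in> ?L" "l' \<in> ?L"
    then show "\<exists>\<gamma>\<in>carrier (\<Gamma> Second). \<forall>x\<in>adh A First k.
        bonding A k l x = \<rho> Second \<gamma> (bonding A k l' x)"
      using cons unfolding consistent_def other.simps bond.simps by blast
  next
    fix u v assume uv: "(u, v) \<in> TE"
    have or: "oriented J ?L u v" if uv: "(u, v) \<in> TE" and k: "label A (u, v) \<in> J" for u v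
    proof -
      have l: "label A (v, u) \<notin> J" using labels uv k by blast
      have ind: "label A (u, v) \<in> index A First" "label A (v, u) \<in> index A First"
        using label_in_index[OF uv] label_in_index[OF tree.arc_sym[OF uv]] eq(2)
        by (cases "side u"; cases "side v"; simp)+
      have ad: "adh A i k = adh A First k" if "k \<in> index A First" for i k
        using eq(3)[OF that] by (cases i) simp_all
      have f: "factor A i = factor A First" "factor A i = factor A Second" for i
        using eq(1) by (cases i; simp)+
      have bd: "edge_bond u v x = bonding A (label A (u, v)) (label A (v, u)) x"
        if "x \<in> edge_adh u v" for x
      \<comment> \<open>From a node of the second part, the bond is formally an inverse map; by Type
        2 it agrees with the map of the first side between the same indices.\<close>
      proof (cases "side u")
        case Second
        have x: "x \<in> adh A First (label A (u, v))" using that ad[OF ind(1), of "side u"] by (simp add: edge_adh_def)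
        have "(label A (u, v) \<in> J) = (label A (v, u) \<notin> J)" using k l by simp
        then have "bond A First (label A (u, v)) (label A (v, u)) x =
            bond A Second (label A (u, v)) (label A (v, u)) x"
          using bonds ind x by blast
        then show ?thesis using Second by (simp add: edge_bond_def)
      qed (simp add: edge_bond_def)
      have "edge_adh u v = adh A First (label A (u, v))" "edge_adh v u = adh A Second (label A (v, u))"
        using ad[OF ind(1), of "side u"] ad[OF ind(2), of "side v"] eq(3)[OF ind(2)]
        by (simp_all add: edge_adh_def)
      then show ?thesis using k l ind f bd by (simp add: oriented_def)
    qed
    show "oriented J ?L u v \<or> oriented J ?L v u"
      using or uv tree.arc_sym[OF uv] labels by blast
  qed (use J eq(2) in auto)
qed

lemma factor_joined: "x \<in> pverts (factor A i) \<Longrightarrow> y \<in> pverts (factor A i) \<Longrightarrow>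
    \<exists>r. (x, y) \<in> near (parcs (factor A i)) r"
proof -
  interpret pair_bidirected_digraph "factor A i" by (rule factor_graph)
  assume "x \<in> pverts (factor A i)" "y \<in> pverts (factor A i)"
  then have "(x, y) \<in> (parcs (factor A i))\<^sup>*"
    using connected[of i] connected_iff_rtrancl by blast
  then show ?thesis by (rule rtrancl_imp_near)
qed

lemma bonding_coarse:
  assumes K: "K \<subseteq> index A First" and L: "L \<subseteq> index A Second"
    and resp: "\<And>\<gamma> k. \<gamma> \<in> carrier (\<Gamma> First) \<Longrightarrow> k \<in> K \<Longrightarrow>
      \<exists>k'\<in>K. \<exists>l\<in>L. \<rho> First \<gamma> ` adh A First k \<subseteq> adh A First k' \<and>
        (\<exists>\<tau>\<in>carrier (\<Gamma> Second). \<forall>x\<in>adh A First k.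
          bonding A k l x = \<rho> Second \<tau> (bonding A k' l (\<rho> First \<gamma> x)))"
    and cons: "\<And>k l l'. k \<in> K \<Longrightarrow> l \<in> L \<Longrightarrow> l' \<in> L \<Longrightarrow>
      \<exists>\<gamma>\<in>carrier (\<Gamma> Second). \<forall>x\<in>adh A First k. bonding A k l x = \<rho> Second \<gamma> (bonding A k l' x)"
    and nonempty: "part A First \<noteq> {}"
  shows "\<exists>s. \<forall>k\<in>K. \<forall>l\<in>L. \<forall>x\<in>adh A First k. \<forall>y\<in>adh A First k.
    ((x, y) \<in> near (parcs (factor A First)) r \<longrightarrow>
      (bonding A k l x, bonding A k l y) \<in> near (parcs (factor A Second)) s) \<and>
    ((bonding A k l x, bonding A k l y) \<in> near (parcs (factor A Second)) r \<longrightarrow>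
      (x, y) \<in> near (parcs (factor A First)) s)"
proof -
  obtain X where X: "finite X" "\<And>x. x \<in> pverts (factor A First) \<Longrightarrow> \<exists>g\<in>carrier (\<Gamma> First). \<rho> First g x \<in> X"
    using quasi_transitive_representatives[OF quasi_transitive[of First]] by blast
  \<comment> \<open>A copy at which finite identification can be read off for the first
    factor.\<close>
  obtain v where v: "v \<in> part A First" using nonempty by blast
  have ball: "finite {y. (x, y) \<in> near (parcs (factor A i)) r}" if "x \<in> pverts (factor A i)" for x i r
    using pair_wf_digraph.finite_near_if_locally_finite[OF factor_wf locally_finite that] .
  show ?thesis
  proof (rule equivariant_bijections_coarse[where V = "pverts (factor A First)" and
        V' = "pverts (factor A Second)" and G = "\<rho> First ` carrier (\<Gamma> First)" and
        G' = "\<rho> Second ` carrier (\<Gamma> Second)" and S' = "adh A Second" and ?X0.0 = X])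
    show "\<exists>g\<in>\<rho> First ` carrier (\<Gamma> First). g x \<in> X" if "x \<in> pverts (factor A First)" for x
      using X(2)[OF that] by blast
    show "(g x, g y) \<in> near (parcs (factor A First)) r \<longleftrightarrow> (x, y) \<in> near (parcs (factor A First)) r"
      if "g \<in> \<rho> First ` carrier (\<Gamma> First)" "x \<in> pverts (factor A First)" "y \<in> pverts (factor A First)" for g x y r
      using that quasi_transitive_isometry[OF quasi_transitive factor_wf] by blast
    show "(g x, g y) \<in> near (parcs (factor A Second)) r \<longleftrightarrow> (x, y) \<in> near (parcs (factor A Second)) r"
      if "g \<in> \<rho> Second ` carrier (\<Gamma> Second)" "x \<in> pverts (factor A Second)" "y \<in> pverts (factor A Second)" for g x y r
      using that quasi_transitive_isometry[OF quasi_transitive factor_wf] by blast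
    show "adh A First k \<subseteq> pverts (factor A First)" if "k \<in> K" for k
      using adh_subset that K by blast
    show "adh A Second l \<subseteq> pverts (factor A Second)" if "l \<in> L" for l
      using adh_subset that L by blast
    show "bij_betw (bonding A k l) (adh A First k) (adh A Second l)" if "k \<in> K" "l \<in> L" for k l
      using bonding_bij that K L by blast
    show "finite {k \<in> K. x \<in> adh A First k}" if "x \<in> pverts (factor A First)" for x
      using K by (intro finite_subset[OF _ point_finite_adhesion[OF finite_identification v that]]) auto
    show "\<exists>k'\<in>K. \<exists>l\<in>L. g ` adh A First k \<subseteq> adh A First k' \<and>
      (\<exists>t\<in>\<rho> Second ` carrier (\<Gamma> Second). \<forall>x\<in>adh A First k. bonding A k l x = t (bonding A k' l (g x)))"
      if g: "g \<in> \<rho> First ` carrier (\<Gamma> First)" and k: "k \<in> K" for g k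
    proof -
      obtain \<gamma> where \<gamma>: "\<gamma> \<in> carrier (\<Gamma> First)" "g = \<rho> First \<gamma>" using g by blast
      show ?thesis using resp[OF \<gamma>(1) k] unfolding \<gamma>(2) bex_simps(7) .
    qed
    show "\<exists>t\<in>\<rho> Second ` carrier (\<Gamma> Second). \<forall>x\<in>adh A First k. bonding A k l x = t (bonding A k l' x)"
      if "k \<in> K" "l \<in> L" "l' \<in> L" for k l l'
      using cons[OF that] unfolding bex_simps(7) .
  qed (use factor_joined ball X(1) in blast)+
qed

lemma parts_nonempty: "(u, v) \<in> TE \<Longrightarrow> part A i \<noteq> {}"
proof -
  assume uv: "(u, v) \<in> TE"
  then have "u \<in> part A (side u)" "v \<in> part A (other (side u))"
    using in_part_side[of u] in_part_side[of v] side_other[OF uv] tree.in_arcsD1 tree.in_arcsD2 by auto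
  then show ?thesis by (cases i; cases "side u") auto
qed

text \<open>Along its orientation an edge carries a map treated in \<open>bonding_coarse\<close>,
  and against it the inverse of one; hence the two estimates of that lemma.\<close>

lemma edge_bond_coarse:
  "\<exists>s. \<forall>(u, v)\<in>TE. \<forall>x\<in>edge_adh u v. \<forall>y\<in>edge_adh u v.
    (x, y) \<in> near (FE u) r \<longrightarrow> (edge_bond u v x, edge_bond u v y) \<in> near (FE v) s"
proof (cases "TE = {}")
  case False
  then have nonempty: "part A First \<noteq> {}" using parts_nonempty by auto
  obtain K L where KL: "K \<subseteq> index A First" "L \<subseteq> index A Second"
    "\<And>\<gamma> k. \<gamma> \<in> carrier (\<Gamma> First) \<Longrightarrow> k \<in> K \<Longrightarrow>
      \<exists>k'\<in>K. \<exists>l\<in>L. \<rho> First \<gamma> ` adh A First k \<subseteq> adh A First k' \<and>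
        (\<exists>\<tau>\<in>carrier (\<Gamma> Second). \<forall>x\<in>adh A First k.
          bonding A k l x = \<rho> Second \<tau> (bonding A k' l (\<rho> First \<gamma> x)))"
    "\<And>k l l'. k \<in> K \<Longrightarrow> l \<in> L \<Longrightarrow> l' \<in> L \<Longrightarrow>
      \<exists>\<gamma>\<in>carrier (\<Gamma> Second). \<forall>x\<in>adh A First k. bonding A k l x = \<rho> Second \<gamma> (bonding A k l' x)"
    "\<And>u v. (u, v) \<in> TE \<Longrightarrow> oriented K L u v \<or> oriented K L v u"
    by (rule orientation) blast
  obtain s where s: "\<And>k l x y. k \<in> K \<Longrightarrow> l \<in> L \<Longrightarrow> x \<in> adh A First k \<Longrightarrow> y \<in> adh A First k \<Longrightarrow>
    ((x, y) \<in> near (parcs (factor A First)) r \<longrightarrow>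
      (bonding A k l x, bonding A k l y) \<in> near (parcs (factor A Second)) s) \<and>
    ((bonding A k l x, bonding A k l y) \<in> near (parcs (factor A Second)) r \<longrightarrow>
      (x, y) \<in> near (parcs (factor A First)) s)"
    using bonding_coarse[OF KL(1,2) KL(3) KL(4) nonempty, of r] by blast
  have "(edge_bond u v x, edge_bond u v y) \<in> near (FE v) s"
    if uv: "(u, v) \<in> TE" and x: "x \<in> edge_adh u v" and y: "y \<in> edge_adh u v"
      and xy: "(x, y) \<in> near (FE u) r" for u v x y
    using KL(5)[OF uv]
  proof
    assume "oriented K L u v"
    then show ?thesis
      using s[of "label A (u, v)" "label A (v, u)" x y] x y xy by (simp add: oriented_def)
  next
    assume o: "oriented K L v u"
    have vu: "(v, u) \<in> TE" using uv by (rule tree.arc_sym)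
    have b: "edge_bond u v x \<in> edge_adh v u" "edge_bond u v y \<in> edge_adh v u"
      using edge_bond_in[OF uv] x y by auto
    then have "bonding A (label A (v, u)) (label A (u, v)) (edge_bond u v x) = x"
      "bonding A (label A (v, u)) (label A (u, v)) (edge_bond u v y) = y"
      using o edge_bond(2)[OF uv x] edge_bond(2)[OF uv y] by (simp_all add: oriented_def)
    then show ?thesis
      using s[of "label A (v, u)" "label A (u, v)" "edge_bond u v x" "edge_bond u v y"] b o xy
      by (simp add: oriented_def)
  qed
  then show ?thesis by (intro exI[of _ s]) blast
qed simp

lemma factor_distortion:
  obtains \<delta> where "\<And>r v x y. ((v, x), (v, y)) \<in> near HE r \<Longrightarrow> (x, y) \<in> near (FE v) (\<delta> r)"
  using factors_coarsely_embedded[OF edge_bond_coarse] by metis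

lemma uniform_asdim_le_fibres:
  assumes "\<And>i. uniform_asdim_le (parcs (factor A i)) {pverts (factor A i)} n"
  shows "uniform_asdim_le HE (range (\<lambda>v. {p \<in> HV. fst p = v})) n"
proof -
  obtain \<delta> where \<delta>: "\<And>r v x y. ((v, x), (v, y)) \<in> near HE r \<Longrightarrow> (x, y) \<in> near (FE v) (\<delta> r)"
    by (rule factor_distortion) blast
  define F where "F i = {{p \<in> HV. fst p = v} |v. v \<in> part A i}" for i
  have F: "uniform_asdim_le HE (F i) n" for i
  proof (rule uniform_asdim_le_coarse_pullback[OF assms(1)[of i], where s = \<delta> and t = "\<lambda>r. r"])
    fix Z assume "Z \<in> F i"
    then obtain v where v: "v \<in> part A i" "Z = {p \<in> HV. fst p = v}" by (auto simp: F_def)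
    have side: "side v = i" "v \<in> TV" using v(1) side_eq part_subset by blast+
    have Z: "\<exists>x. p = (v, x) \<and> x \<in> pverts (factor A i)" if "p \<in> Z" for p
      using that v(2) side by (cases p) (auto simp: HV_iff)
    show "\<exists>Y\<in>{pverts (factor A i)}. \<exists>f. f ` Z \<subseteq> Y \<and>
        (\<forall>r. \<forall>p\<in>Z. \<forall>q\<in>Z. (p, q) \<in> near HE r \<longrightarrow> (f p, f q) \<in> near (parcs (factor A i)) (\<delta> r)) \<and>
        (\<forall>r. \<forall>p\<in>Z. \<forall>q\<in>Z. (f p, f q) \<in> near (parcs (factor A i)) r \<longrightarrow> (p, q) \<in> near HE r)"
    proof (intro bexI[of _ "pverts (factor A i)"] exI[of _ snd] conjI allI ballI impI)
      show "snd ` Z \<subseteq> pverts (factor A i)" using Z by fastforce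
    next
      fix r p q assume pq: "p \<in> Z" "q \<in> Z" "(p, q) \<in> near HE r"
      obtain x y where "p = (v, x)" "q = (v, y)" using Z[OF pq(1)] Z[OF pq(2)] by blast
      then show "(snd p, snd q) \<in> near (parcs (factor A i)) (\<delta> r)" using \<delta>[of v x y r] pq(3) side by simp
    next
      fix r p q assume pq: "p \<in> Z" "q \<in> Z" "(snd p, snd q) \<in> near (parcs (factor A i)) r"
      obtain x y where "p = (v, x)" "q = (v, y)" using Z[OF pq(1)] Z[OF pq(2)] by blast
      then show "(p, q) \<in> near HE r" using near_HE_if_near_factor[of v x y r] pq(3) side by simp
    qed simp
  qed
  have "uniform_asdim_le HE (F First \<union> F Second) n"
    using F by (intro uniform_asdim_le_Un)
  then show ?thesis
  proof (rule uniform_asdim_le_nearby[OF _ sym_HE, where k = 0])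
    fix Z assume "Z \<in> range (\<lambda>v. {p \<in> HV. fst p = v})"
    then obtain v where Z: "Z = {p \<in> HV. fst p = v}" by blast
    \<comment> \<open>Off the tree the fibre is empty, and any node can replace
      \<open>v\<close>.\<close>
    obtain w where w: "w \<in> TV" "v \<in> TV \<longrightarrow> w = v" using tree.nonempty by blast
    have "{p \<in> HV. fst p = w} \<in> F (side w)" using in_part_side[OF w(1)] by (auto simp: F_def)
    then have "{p \<in> HV. fst p = w} \<in> F First \<union> F Second" by (cases "side w") auto
    moreover have "Z \<subseteq> {p \<in> HV. fst p = w}" using w(2) by (auto simp: Z HV_iff)
    ultimately show "\<exists>Y\<in>F First \<union> F Second. \<forall>p\<in>Z. \<exists>q\<in>Y. (p, q) \<in> near HE 0"
      by (intro bexI[of _ "{p \<in> HV. fst p = w}"]) auto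
  qed
qed

text \<open>All adhesion sets on the side of \<open>L\<close> are images of one set
  \<open>adh A First k\<close>, and consistency yields group elements carrying one to another. These
  are isometries of the factor, hence coarse in the sum graph with control \<open>\<delta>\<close>.
  A set on the side of \<open>K\<close> is within distance \<open>1\<close> of its partner across
  the edge.\<close>

lemma uniform_asdim_le_adhesion:
  assumes arc: "(v0, w0) \<in> TE"
    and le: "uniform_asdim_le HE {{v0} \<times> edge_adh v0 w0} m"
  shows "uniform_asdim_le HE {{u} \<times> edge_adh u v |u v. (u, v) \<in> TE} m"
proof -
  obtain \<delta> where \<delta>: "\<And>r v x y. ((v, x), (v, y)) \<in> near HE r \<Longrightarrow> (x, y) \<in> near (FE v) (\<delta> r)"
    by (rule factor_distortion) blast
  obtain K L where cons: "\<And>k l l'. k \<in> K \<Longrightarrow> l \<in> L \<Longrightarrow> l' \<in> L \<Longrightarrow>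
      \<exists>\<gamma>\<in>carrier (\<Gamma> Second). \<forall>x\<in>adh A First k. bonding A k l x = \<rho> Second \<gamma> (bonding A k l' x)"
    and KL: "K \<subseteq> index A First" "L \<subseteq> index A Second"
    and orient: "\<And>u v. (u, v) \<in> TE \<Longrightarrow> oriented K L u v \<or> oriented K L v u"
    by (rule orientation) blast
  have cross: "\<exists>q\<in>{v} \<times> edge_adh v u. (p, q) \<in> near HE 1"
    if uv: "(u, v) \<in> TE" and p: "p \<in> {u} \<times> edge_adh u v" for u v p
  proof -
    obtain x where x: "p = (u, x)" "x \<in> edge_adh u v" using p by blast
    then have "(p, (v, edge_bond u v x)) \<in> HE" using uv by (simp add: HE_iff bond_arcs_iff)
    then have "(p, (v, edge_bond u v x)) \<in> near HE 1" by (rule near_arc) simp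
    then show ?thesis using edge_bond_in[OF uv x(2)] by blast
  qed
  obtain a b where ab: "(a, b) \<in> TE" "oriented K L a b" "(a, b) = (v0, w0) \<or> (a, b) = (w0, v0)"
    using orient[OF arc] arc tree.arc_sym[OF arc] by blast
  have "uniform_asdim_le HE {{b} \<times> edge_adh b a} m"
  proof (rule uniform_asdim_le_nearby[OF le sym_HE, where k = 1])
    fix Z assume "Z \<in> {{b} \<times> edge_adh b a}"
    then show "\<exists>Y\<in>{{v0} \<times> edge_adh v0 w0}. \<forall>p\<in>Z. \<exists>q\<in>Y. (p, q) \<in> near HE 1"
      using ab(3) cross[OF tree.arc_sym[OF ab(1)]] near_refl by fastforce
  qed
  then have "uniform_asdim_le HE {{v} \<times> edge_adh v u |u v. (u, v) \<in> TE \<and> oriented K L u v} m"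
  proof (rule uniform_asdim_le_coarse_pullback[where s = \<delta> and t = \<delta>])
    fix Z assume "Z \<in> {{v} \<times> edge_adh v u |u v. (u, v) \<in> TE \<and> oriented K L u v}"
    then obtain u v where uv: "(u, v) \<in> TE" "oriented K L u v" "Z = {v} \<times> edge_adh v u" by blast
    let ?k = "label A (a, b)" and ?l = "label A (v, u)" and ?l' = "label A (b, a)"
    have kl: "?k \<in> K" "?l \<in> L" "?l' \<in> L" using ab(2) uv(2) by (auto simp: oriented_def)
    obtain \<gamma> where \<gamma>: "\<gamma> \<in> carrier (\<Gamma> Second)"
      "\<forall>x\<in>adh A First ?k. bonding A ?k ?l' x = \<rho> Second \<gamma> (bonding A ?k ?l x)"
      using cons[OF kl(1,3,2)] by blast
    have Sv: "edge_adh v u = bonding A ?k ?l ` adh A First ?k"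
      "edge_adh b a = bonding A ?k ?l' ` adh A First ?k"
      using bij_betw_imp_surj_on[OF bonding_bij[OF subsetD[OF KL(1) kl(1)] subsetD[OF KL(2) kl(2)]]]
        bij_betw_imp_surj_on[OF bonding_bij[OF subsetD[OF KL(1) kl(1)] subsetD[OF KL(2) kl(3)]]]
        uv(2) ab(2) by (simp_all add: oriented_def)
    have f: "factor A (side v) = factor A Second" "factor A (side b) = factor A Second"
      using uv(2) ab(2) by (auto simp: oriented_def)
    have sub: "edge_adh v u \<subseteq> pverts (factor A Second)"
      using edge_adh_subset[OF tree.arc_sym[OF uv(1)]] f by simp
    have TV: "v \<in> TV" "b \<in> TV" using uv(1) ab(1) tree.in_arcsD2 by blast+
    have iso: "(\<rho> Second \<gamma> x, \<rho> Second \<gamma> y) \<in> near (parcs (factor A Second)) r \<longleftrightarrow>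
        (x, y) \<in> near (parcs (factor A Second)) r" if "x \<in> edge_adh v u" "y \<in> edge_adh v u" for x y r
      using quasi_transitive_isometry[OF quasi_transitive factor_wf \<gamma>(1)] sub that by blast
    let ?f = "\<lambda>p. (b, \<rho> Second \<gamma> (snd p))"
    show "\<exists>Y\<in>{{b} \<times> edge_adh b a}. \<exists>f. f ` Z \<subseteq> Y \<and>
        (\<forall>r. \<forall>p\<in>Z. \<forall>q\<in>Z. (p, q) \<in> near HE r \<longrightarrow> (f p, f q) \<in> near HE (\<delta> r)) \<and>
        (\<forall>r. \<forall>p\<in>Z. \<forall>q\<in>Z. (f p, f q) \<in> near HE r \<longrightarrow> (p, q) \<in> near HE (\<delta> r))"
    proof (intro bexI[of _ "{b} \<times> edge_adh b a"] exI[of _ ?f] conjI allI ballI impI)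
      show "?f ` Z \<subseteq> {b} \<times> edge_adh b a" unfolding uv(3) Sv using \<gamma>(2) by fastforce
    next
      fix r p q assume pq: "p \<in> Z" "q \<in> Z" "(p, q) \<in> near HE r"
      then obtain x y where xy: "p = (v, x)" "q = (v, y)" "x \<in> edge_adh v u" "y \<in> edge_adh v u"
        unfolding uv(3) by blast
      have "(x, y) \<in> near (parcs (factor A Second)) (\<delta> r)" using \<delta>[of v x y r] pq(3) xy f by simp
      then have "(\<rho> Second \<gamma> x, \<rho> Second \<gamma> y) \<in> near (FE b) (\<delta> r)" using iso xy f by simp
      then show "(?f p, ?f q) \<in> near HE (\<delta> r)" using near_HE_if_near_factor[OF TV(2)] xy by simp
    next
      fix r p q assume pq: "p \<in> Z" "q \<in> Z" "(?f p, ?f q) \<in> near HE r"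
      then obtain x y where xy: "p = (v, x)" "q = (v, y)" "x \<in> edge_adh v u" "y \<in> edge_adh v u"
        unfolding uv(3) by blast
      have "(\<rho> Second \<gamma> x, \<rho> Second \<gamma> y) \<in> near (parcs (factor A Second)) (\<delta> r)"
        using \<delta>[of b "\<rho> Second \<gamma> x" "\<rho> Second \<gamma> y" r] pq(3) xy f by simp
      then have "(x, y) \<in> near (FE v) (\<delta> r)" using iso xy f by simp
      then show "(p, q) \<in> near HE (\<delta> r)" using near_HE_if_near_factor[OF TV(1)] xy by simp
    qed simp
  qed
  then show ?thesis
  proof (rule uniform_asdim_le_nearby[OF _ sym_HE, where k = 1])
    fix Z assume "Z \<in> {{u} \<times> edge_adh u v |u v. (u, v) \<in> TE}"
    then obtain u v where uv: "(u, v) \<in> TE" "Z = {u} \<times> edge_adh u v" by blast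
    let ?F = "{{v} \<times> edge_adh v u |u v. (u, v) \<in> TE \<and> oriented K L u v}"
    show "\<exists>Y\<in>?F. \<forall>p\<in>Z. \<exists>q\<in>Y. (p, q) \<in> near HE 1"
      using orient[OF uv(1)]
    proof
      assume "oriented K L u v"
      then have "{v} \<times> edge_adh v u \<in> ?F" using uv(1) by blast
      then show ?thesis using cross[OF uv(1)] unfolding uv(2) by (intro bexI) auto
    next
      assume "oriented K L v u"
      then have "Z \<in> ?F" using tree.arc_sym[OF uv(1)] uv(2) by blast
      then show ?thesis by (intro bexI[of _ Z]) auto
    qed
  qed
qed

text \<open>An arc to the fibre of the parent is a bond arc, so each entrance lies in an adhesion
  set and the theorem on graphs over forests applies. If \<open>T\<close> has no edge, the sum graph
  is a single copy of a factor.\<close>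

lemma uniform_asdim_le_sum_graph:
  assumes fibres: "\<And>i. uniform_asdim_le (parcs (factor A i)) {pverts (factor A i)} n"
    and adhesion: "(v0, w0) \<in> TE \<Longrightarrow> \<exists>m<n. uniform_asdim_le HE {{v0} \<times> edge_adh v0 w0} m"
    and arcs: "TE \<noteq> {} \<Longrightarrow> (v0, w0) \<in> TE"
  shows "uniform_asdim_le HE {HV} n"
proof (cases "TE = {}")
  case True
  obtain v where v: "v \<in> TV" using tree.nonempty by blast
  have "u = v" if "u \<in> TV" for u using tree.joined[OF v that] by (simp add: True)
  then have "HV \<subseteq> {p \<in> HV. fst p = v}" by (auto simp: HV_iff)
  then show ?thesis
    by (intro uniform_asdim_le_nearby[OF uniform_asdim_le_fibres[OF fibres] sym_HE, where k = 0]) blast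
next
  case False
  then have arc: "(v0, w0) \<in> TE" by (rule arcs)
  obtain m where m: "m < n" "uniform_asdim_le HE {{v0} \<times> edge_adh v0 w0} m"
    using adhesion[OF arc] by blast
  interpret forest: graph_over_forest HE HV fst tree.depth tree.parent
  proof
    show "fst p = fst q \<or>
      fst q = tree.parent (fst p) \<and> tree.depth (fst p) = Suc (tree.depth (fst q)) \<or>
      fst p = tree.parent (fst q) \<and> tree.depth (fst q) = Suc (tree.depth (fst p))"
      if "(p, q) \<in> HE" for p q
      using HE_nodes[OF that] tree.arc_parent[of "fst p" "fst q"] by blast
  qed (use sym_HE HE_in_HV tree.depth_parent in auto)
  have "uniform_asdim_le HE (range forest.entrance) m"
  proof (rule uniform_asdim_le_nearby[OF uniform_asdim_le_adhesion[OF arc m(2)] sym_HE, where k = 0])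
    fix Z assume "Z \<in> range forest.entrance"
    then obtain v where Z: "Z = forest.entrance v" by blast
    have mem: "fst p = v \<and> (v, tree.parent v) \<in> TE \<and> snd p \<in> edge_adh v (tree.parent v)" if "p \<in> Z" for p
    proof -
      obtain q where q: "fst p = v" "(p, q) \<in> HE" "fst q = tree.parent v" "tree.depth v = Suc (tree.depth (fst q))"
        using \<open>p \<in> Z\<close> unfolding Z forest.entrance_def by blast
      have "fst p \<noteq> fst q" using q by auto
      then have "(p, q) \<in> bond_arcs A" using q(2) by (auto simp: HE_iff copy_arcs_iff)
      then show ?thesis using q by (auto simp: bond_arcs_iff)
    qed
    let ?F = "{{u} \<times> edge_adh u v |u v. (u, v) \<in> TE}"
    show "\<exists>Y\<in>?F. \<forall>p\<in>Z. \<exists>q\<in>Y. (p, q) \<in> near HE 0"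
    proof (cases "Z = {}")
      case False
      then have "(v, tree.parent v) \<in> TE" using mem by blast
      then have "{v} \<times> edge_adh v (tree.parent v) \<in> ?F" by blast
      moreover have "Z \<subseteq> {v} \<times> edge_adh v (tree.parent v)" using mem by fastforce
      ultimately show ?thesis by (intro bexI[of _ "{v} \<times> edge_adh v (tree.parent v)"]) auto
    qed (use arc in auto)
  qed
  then show ?thesis
    using forest.uniform_asdim_le_graph_over_forest[OF uniform_asdim_le_fibres[OF fibres] _ m(1)] by blast
qed

section \<open>From the sum graph to the amalgamation\<close>

lemma amalgam_arc_iff:
  "(X, Y) \<in> parcs (amalgam_graph A) \<longleftrightarrow> X \<noteq> Y \<and> (\<exists>p q. (p, q) \<in> HE \<and> X = proj A p \<and> Y = proj A q)"
  by (simp add: amalgam_graph_def contract_def proj_def)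

text \<open>Contraction does not lengthen walks. Conversely a walk is lifted arc by arc, with a
  correction of length at most \<open>M\<close> inside the contracted class of every vertex; hence
  \<open>M + r * (M + 1)\<close>.\<close>

lemma sum_graph_amalgam_coarse:
  obtains \<epsilon> where "\<And>r p q. (p, q) \<in> near HE r \<Longrightarrow> (proj A p, proj A q) \<in> near (parcs (amalgam_graph A)) r"
    "\<And>r p q. p \<in> HV \<Longrightarrow> q \<in> HV \<Longrightarrow> (proj A p, proj A q) \<in> near (parcs (amalgam_graph A)) r \<Longrightarrow>
      (p, q) \<in> near HE (\<epsilon> r)"
proof -
  let ?G = "parcs (amalgam_graph A)"
  obtain M where M: "\<And>p q. p \<in> HV \<Longrightarrow> (p, q) \<in> (bond_arcs A)\<^sup>* \<Longrightarrow> (p, q) \<in> near HE M"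
    using bond_classes_bounded[OF finite_identification] by blast
  note G = amalgam_arc_iff
  have "(proj A p, proj A q) \<in> near ?G r" if "(p, q) \<in> near HE r" for p q r
  proof -
    have "(proj A p, proj A q) \<in> near ?G 1" if "(p, q) \<in> HE" for p q
    proof (cases "proj A p = proj A q")
      case False
      then have "(proj A p, proj A q) \<in> ?G" using that unfolding G by blast
      then show ?thesis by (rule near_arc) simp
    qed simp
    then show ?thesis using near_map[of HE "proj A" ?G 1 p q r] that by simp
  qed
  moreover have "(p, q) \<in> near HE (M + r * (M + 1))"
    if p: "p \<in> HV" and "q \<in> HV" "(proj A p, proj A q) \<in> near ?G r" for p q r
    using that(2,3)
  proof (induction r arbitrary: q)
    case 0
    then have "(p, q) \<in> (bond_arcs A)\<^sup>*" by (simp add: proj_eq_iff[symmetric])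
    then show ?case using M p by simp
  next
    case (Suc r)
    then obtain Y where Y: "(proj A p, Y) \<in> near ?G r" "Y = proj A q \<or> (Y, proj A q) \<in> ?G"
      by (auto simp: near_Suc)
    show ?case using Y(2)
    proof
      assume "Y = proj A q"
      then have "(p, q) \<in> near HE (M + r * (M + 1))" using Suc.IH[OF Suc.prems(1)] Y(1) by simp
      then show ?thesis by (rule near_mono) simp
    next
      assume "(Y, proj A q) \<in> ?G"
      then obtain a b where ab: "(a, b) \<in> HE" "Y = proj A a" "proj A q = proj A b" unfolding G by blast
      have aV: "a \<in> HV" "b \<in> HV" using HE_in_HV[OF ab(1)] HE_in_HV2[OF ab(1)] by auto
      have 1: "(p, a) \<in> near HE (M + r * (M + 1))" using Suc.IH[OF aV(1)] Y(1) ab(2) by simp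
      have 2: "(a, b) \<in> near HE 1" using ab(1) by (simp add: near_arc)
      have 3: "(b, q) \<in> near HE M" using M[OF aV(2)] ab(3) proj_eq_iff[of b q] by simp
      show ?thesis by (rule near_trans_le[OF near_trans[OF 1 2] 3]) simp
    qed
  qed
  ultimately show thesis by (rule that)
qed

lemma uniform_asdim_le_amalgam_graph:
  assumes "uniform_asdim_le HE {HV} n"
  shows "uniform_asdim_le (parcs (amalgam_graph A)) {pverts (amalgam_graph A)} n"
proof -
  let ?G = "parcs (amalgam_graph A)"
  obtain \<epsilon> where \<epsilon>: "\<And>r p q. (p, q) \<in> near HE r \<Longrightarrow> (proj A p, proj A q) \<in> near ?G r"
    "\<And>r p q. p \<in> HV \<Longrightarrow> q \<in> HV \<Longrightarrow> (proj A p, proj A q) \<in> near ?G r \<Longrightarrow> (p, q) \<in> near HE (\<epsilon> r)"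
    by (rule sum_graph_amalgam_coarse) blast
  have "\<forall>X\<in>pverts (amalgam_graph A). \<exists>p\<in>HV. proj A p = X"
    by (auto simp: amalgam_graph_def contract_def proj_def)
  then obtain f where f: "\<And>X. X \<in> pverts (amalgam_graph A) \<Longrightarrow> f X \<in> HV \<and> proj A (f X) = X"
    by metis
  show ?thesis
  proof (rule uniform_asdim_le_coarse_pullback[OF assms, where s = \<epsilon> and t = "\<lambda>r. r"])
    fix Z assume Z: "Z \<in> {pverts (amalgam_graph A)}"
    have 1: "(f X, f Y) \<in> near HE (\<epsilon> r)" if "X \<in> Z" "Y \<in> Z" "(X, Y) \<in> near ?G r" for X Y r
      using \<epsilon>(2)[of "f X" "f Y" r] f[of X] f[of Y] that Z by simp
    have 2: "(X, Y) \<in> near ?G r" if "X \<in> Z" "Y \<in> Z" "(f X, f Y) \<in> near HE r" for X Y r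
      using \<epsilon>(1)[OF that(3)] f[of X] f[of Y] that Z by simp
    show "\<exists>Y\<in>{HV}. \<exists>f. f ` Z \<subseteq> Y \<and>
        (\<forall>r. \<forall>x\<in>Z. \<forall>y\<in>Z. (x, y) \<in> near ?G r \<longrightarrow> (f x, f y) \<in> near HE (\<epsilon> r)) \<and>
        (\<forall>r. \<forall>x\<in>Z. \<forall>y\<in>Z. (f x, f y) \<in> near HE r \<longrightarrow> (x, y) \<in> near ?G r)"
      using Z f 1 2 by (intro bexI[of _ HV] exI[of _ f] conjI) auto
  qed
qed

lemma amalgam_graph_wf: "pair_sym_digraph (amalgam_graph A)"
proof
  fix e assume "e \<in> parcs (amalgam_graph A)"
  then obtain p q where "e = (proj A p, proj A q)" "(p, q) \<in> HE"
    by (auto simp: amalgam_graph_def contract_def proj_def)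
  then show "fst e \<in> pverts (amalgam_graph A)" "snd e \<in> pverts (amalgam_graph A)"
    using proj_in_pverts[OF HE_in_HV] proj_in_pverts[OF HE_in_HV2] by auto
next
  show "symmetric (with_proj (amalgam_graph A))"
    unfolding symmetric_def with_proj_simps
  proof (rule symI)
    fix X Y assume "(X, Y) \<in> parcs (amalgam_graph A)"
    then obtain p q where "X \<noteq> Y" "(p, q) \<in> HE" "X = proj A p" "Y = proj A q"
      unfolding amalgam_arc_iff by blast
    then show "(Y, X) \<in> parcs (amalgam_graph A)"
      using symD[OF sym_HE] unfolding amalgam_arc_iff by blast
  qed
qed

text \<open>\<open>X\<close> and \<open>d\<close> are left open so that the adhesion set may be
  taken in a factor or in the amalgamation; \<open>bound\<close> transfers its dimension to the sum
  graph.\<close>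

lemma asdim_bound:
  assumes bound: "asdim X d + 1 \<le> enat n \<Longrightarrow>
      TE \<noteq> {} \<Longrightarrow> \<exists>v0 w0. (v0, w0) \<in> TE \<and> (\<exists>m<n. uniform_asdim_le HE {{v0} \<times> edge_adh v0 w0} m)"
    and n: "graph_asdim (factor A First) \<le> enat n" "graph_asdim (factor A Second) \<le> enat n"
    "asdim X d + 1 \<le> enat n"
  shows "graph_asdim (amalgam_graph A) \<le> enat n"
proof -
  have fac: "uniform_asdim_le (parcs (factor A i)) {pverts (factor A i)} n" for i
  proof -
    interpret pair_bidirected_digraph "factor A i" by (rule factor_graph)
    interpret discrete_dist "pverts (factor A i)" "graph_dist (factor A i)" "parcs (factor A i)"
      by (rule discrete_dist_graph_dist) simp
    show ?thesis using n asdim_le_enat_iff by (cases i) (simp_all add: graph_asdim_def)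
  qed
  obtain v0 w0 where vw: "TE \<noteq> {} \<Longrightarrow> (v0, w0) \<in> TE \<and> (\<exists>m<n. uniform_asdim_le HE {{v0} \<times> edge_adh v0 w0} m)"
    using bound[OF n(3)] by blast
  have "uniform_asdim_le HE {HV} n"
    using vw by (intro uniform_asdim_le_sum_graph[OF fac, of v0 w0]) auto
  then have *: "uniform_asdim_le (parcs (amalgam_graph A)) {pverts (amalgam_graph A)} n"
    by (rule uniform_asdim_le_amalgam_graph)
  interpret pair_sym_digraph "amalgam_graph A" by (rule amalgam_graph_wf)
  interpret discrete_dist "pverts (amalgam_graph A)" "graph_dist (amalgam_graph A)" "parcs (amalgam_graph A)"
    by (rule discrete_dist_graph_dist) simp
  show ?thesis using * asdim_le_enat_iff by (simp add: graph_asdim_def)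
qed

lemma uniform_asdim_le_edge_adh_if_factor:
  assumes "(v, w) \<in> TE" "asdim (edge_adh v w) (graph_dist (factor A (side v))) \<le> enat m"
  shows "uniform_asdim_le HE {{v} \<times> edge_adh v w} m"
proof -
  interpret pair_bidirected_digraph "factor A (side v)" by (rule factor_graph)
  interpret discrete_dist "edge_adh v w" "graph_dist (factor A (side v))" "FE v"
    using edge_adh_subset[OF assms(1)] by (rule discrete_dist_graph_dist)
  obtain \<delta> where \<delta>: "\<And>r v x y. ((v, x), (v, y)) \<in> near HE r \<Longrightarrow> (x, y) \<in> near (FE v) (\<delta> r)"
    by (rule factor_distortion) blast
  have v: "v \<in> TV" using assms(1) tree.in_arcsD1 by blast
  have "uniform_asdim_le (FE v) {edge_adh v w} m"
    using assms(2) asdim_le_enat_iff by blast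
  then show ?thesis
  proof (rule uniform_asdim_le_coarse_pullback[where s = \<delta> and t = "\<lambda>r. r"])
    fix Z assume "Z \<in> {{v} \<times> edge_adh v w}"
    then have Z: "Z = {v} \<times> edge_adh v w" by simp
    show "\<exists>Y\<in>{edge_adh v w}. \<exists>f. f ` Z \<subseteq> Y \<and>
        (\<forall>r. \<forall>x\<in>Z. \<forall>y\<in>Z. (x, y) \<in> near HE r \<longrightarrow> (f x, f y) \<in> near (FE v) (\<delta> r)) \<and>
        (\<forall>r. \<forall>x\<in>Z. \<forall>y\<in>Z. (f x, f y) \<in> near (FE v) r \<longrightarrow> (x, y) \<in> near HE r)"
      unfolding Z using \<delta> near_HE_if_near_factor[OF v]
      by (intro bexI[of _ "edge_adh v w"] exI[of _ snd]) auto
  qed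
qed

lemma uniform_asdim_le_edge_adh_if_amalgam:
  assumes "(v, w) \<in> TE" "asdim (proj A ` ({v} \<times> edge_adh v w)) (graph_dist (amalgam_graph A)) \<le> enat m"
  shows "uniform_asdim_le HE {{v} \<times> edge_adh v w} m"
proof -
  let ?G = "parcs (amalgam_graph A)"
  have v: "v \<in> TV" using assms(1) tree.in_arcsD1 by blast
  have sub: "{v} \<times> edge_adh v w \<subseteq> HV" using edge_adh_subset[OF assms(1)] v by (auto simp: HV_iff)
  interpret pair_sym_digraph "amalgam_graph A" by (rule amalgam_graph_wf)
  interpret discrete_dist "proj A ` ({v} \<times> edge_adh v w)" "graph_dist (amalgam_graph A)" ?G
    using sub proj_in_pverts by (intro discrete_dist_graph_dist) blast
  obtain \<epsilon> where \<epsilon>: "\<And>r p q. (p, q) \<in> near HE r \<Longrightarrow> (proj A p, proj A q) \<in> near ?G r"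
    "\<And>r p q. p \<in> HV \<Longrightarrow> q \<in> HV \<Longrightarrow> (proj A p, proj A q) \<in> near ?G r \<Longrightarrow> (p, q) \<in> near HE (\<epsilon> r)"
    by (rule sum_graph_amalgam_coarse) blast
  have "uniform_asdim_le ?G {proj A ` ({v} \<times> edge_adh v w)} m"
    using assms(2) asdim_le_enat_iff by blast
  then show ?thesis
  proof (rule uniform_asdim_le_coarse_pullback[where s = "\<lambda>r. r" and t = \<epsilon>])
    fix Z assume "Z \<in> {{v} \<times> edge_adh v w}"
    then have Z: "Z = {v} \<times> edge_adh v w" by simp
    have 2: "(p, q) \<in> near HE (\<epsilon> r)" if "p \<in> Z" "q \<in> Z" "(proj A p, proj A q) \<in> near ?G r" for p q r
      using \<epsilon>(2) that sub Z by blast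
    show "\<exists>Y\<in>{proj A ` ({v} \<times> edge_adh v w)}. \<exists>f. f ` Z \<subseteq> Y \<and>
        (\<forall>r. \<forall>x\<in>Z. \<forall>y\<in>Z. (x, y) \<in> near HE r \<longrightarrow> (f x, f y) \<in> near ?G r) \<and>
        (\<forall>r. \<forall>x\<in>Z. \<forall>y\<in>Z. (f x, f y) \<in> near ?G r \<longrightarrow> (x, y) \<in> near HE (\<epsilon> r))"
      using \<epsilon>(1) 2 Z by (intro bexI[of _ "proj A ` ({v} \<times> edge_adh v w)"] exI[of _ "proj A"] conjI) auto
  qed
qed

theorem amalgam_asdim_le_factor_adhesion:
  assumes k: "k \<in> index A i"
  shows "graph_asdim (amalgam_graph A) \<le>
    max (max (graph_asdim (factor A First)) (graph_asdim (factor A Second)))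
      (asdim (adh A i k) (graph_dist (factor A i)) + 1)"
proof (rule enat_le_by_bounds)
  fix n assume "max (max (graph_asdim (factor A First)) (graph_asdim (factor A Second)))
      (asdim (adh A i k) (graph_dist (factor A i)) + 1) \<le> enat n"
  then have n: "graph_asdim (factor A First) \<le> enat n" "graph_asdim (factor A Second) \<le> enat n"
    "asdim (adh A i k) (graph_dist (factor A i)) + 1 \<le> enat n" by auto
  show "graph_asdim (amalgam_graph A) \<le> enat n"
  proof (rule asdim_bound[OF _ n])
    assume "TE \<noteq> {}"
    \<comment> \<open>An edge of \<open>T\<close> guarantees nodes on both sides; without one, side
      \<open>i\<close> may have none.\<close>
    then obtain v where v: "v \<in> part A i" using parts_nonempty by (metis ex_in_conv surj_pair)
    obtain w where w: "(v, w) \<in> TE" "label A (v, w) = k" using ex_arc_label[OF v k] by blast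
    obtain m where m: "m < n" "asdim (adh A i k) (graph_dist (factor A i)) \<le> enat m"
      using enat_plus_one_leD[OF n(3)] by blast
    have "uniform_asdim_le HE {{v} \<times> edge_adh v w} m"
      using m(2) w side_eq[OF v] by (intro uniform_asdim_le_edge_adh_if_factor) (simp_all add: edge_adh_def)
    then show "\<exists>v0 w0. (v0, w0) \<in> TE \<and> (\<exists>m<n. uniform_asdim_le HE {{v0} \<times> edge_adh v0 w0} m)"
      using w(1) m(1) by blast
  qed
qed

theorem amalgam_asdim_le_amalgam_adhesion:
  assumes v: "v \<in> part A i" and k: "k \<in> index A i"
  shows "graph_asdim (amalgam_graph A) \<le>
    max (max (graph_asdim (factor A First)) (graph_asdim (factor A Second)))
      (asdim (proj A ` ({v} \<times> adh A i k)) (graph_dist (amalgam_graph A)) + 1)"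
proof (rule enat_le_by_bounds)
  fix n assume "max (max (graph_asdim (factor A First)) (graph_asdim (factor A Second)))
      (asdim (proj A ` ({v} \<times> adh A i k)) (graph_dist (amalgam_graph A)) + 1) \<le> enat n"
  then have n: "graph_asdim (factor A First) \<le> enat n" "graph_asdim (factor A Second) \<le> enat n"
    "asdim (proj A ` ({v} \<times> adh A i k)) (graph_dist (amalgam_graph A)) + 1 \<le> enat n" by auto
  show "graph_asdim (amalgam_graph A) \<le> enat n"
  proof (rule asdim_bound[OF _ n])
    obtain w where w: "(v, w) \<in> TE" "label A (v, w) = k" using ex_arc_label[OF v k] by blast
    obtain m where m: "m < n"
      "asdim (proj A ` ({v} \<times> adh A i k)) (graph_dist (amalgam_graph A)) \<le> enat m"
      using enat_plus_one_leD[OF n(3)] by blast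
    have "uniform_asdim_le HE {{v} \<times> edge_adh v w} m"
      using m(2) w side_eq[OF v] by (intro uniform_asdim_le_edge_adh_if_amalgam) (simp_all add: edge_adh_def)
    then show "\<exists>v0 w0. (v0, w0) \<in> TE \<and> (\<exists>m<n. uniform_asdim_le HE {{v0} \<times> edge_adh v0 w0} m)"
      using w(1) m(1) by blast
  qed
qed

end

theorem theorem1p1:
  fixes A :: "('a, 'i, 't) amalgam"
    and \<Gamma> :: "side \<Rightarrow> 'g monoid"
    and \<rho> :: "side \<Rightarrow> 'g \<Rightarrow> 'a \<Rightarrow> 'a"
  assumes "tree_amalgamation A"
    and "\<And>i. locally_finite (factor A i)"
    and "\<And>i. Digraph_Component.connected (with_proj (factor A i))"
    and "\<And>i. quasi_transitive_action (\<Gamma> i) (\<rho> i) (factor A i)"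
    and "finite_identification A"
    and "respects_actions A \<Gamma> \<rho>"
  shows "(\<forall>i. \<forall>k\<in>index A i.
      graph_asdim (amalgam_graph A)
        \<le> max (max (graph_asdim (factor A First)) (graph_asdim (factor A Second)))
            (asdim (adh A i k) (graph_dist (factor A i)) + 1)) \<and>
    (\<forall>i. \<forall>v\<in>part A i. \<forall>k\<in>index A i.
      graph_asdim (amalgam_graph A)
        \<le> max (max (graph_asdim (factor A First)) (graph_asdim (factor A Second)))
            (asdim (proj A ` ({v} \<times> adh A i k)) (graph_dist (amalgam_graph A)) + 1))"
proof -
  interpret amalgam_of_actions A \<Gamma> \<rho>
    using assms by (simp add: amalgam_of_actions_def amalgam_of_actions_axioms_def)
  show ?thesis
    using amalgam_asdim_le_factor_adhesion amalgam_asdim_le_amalgam_adhesion by blast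
qed

end
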